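(* There exists a unique bilinear pairing $\langle\,,\,\rangle_{\mathbf q}:U_{\mathbf q}^{\le0}\times U_{\mathbf q}^{\ge0}\to\mathbb K$ such that for all $x,x'\in U_{\mathbf q}^{\ge0}$, $y,y'\in U_{\mathbf q}^{\le0}$, $\mu,\nu\in Q$ and $i,j\in I$: $$\langle y,xx'\rangle_{\mathbf q}=\langle\Delta(y),x'\otimes x\rangle_{\mathbf q},\qquad \langle yy',x\rangle_{\mathbf q}=\langle y\otimes y',\Delta(x)\rangle_{\mathbf q},$$ $$\langle f_i,e_j\rangle_{\mathbf q}=\delta_{ij}\frac{q_{ii}}{1-q_{ii}},\quad \langle\omega'_\mu,\omega_\nu\rangle_{\mathbf q}=q_{\nu\mu},\quad \langle\omega'_\mu,e_i\rangle_{\mathbf q}=0,\quad\langle f_i,\omega_\mu\rangle_{\mathbf q}=0.$$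
   Context: Let $A=(a_{ij})_{i,j\in I}$ be a symmetrizable generalized Cartan matrix ($I$ finite); $Q=\bigoplus_i\mathbb Z\alpha_i$. Let $q_{ij}$ ($i,j\in I$) be indeterminates over $\mathbb Q$ subject to $q_{ij}q_{ji}=q_{ii}^{a_{ij}}$, and $\mathbb K\supset\mathbb Q(q_{ij}\mid i,j\in I)$ a field containing $q_{ii}^{1/m}$ for all positive integers $m$. The $q_{ii}$ are not roots of unity. Notation: $(n)_v=\frac{v^n-1}{v-1}$, $(n)_v!=(n)_v\cdots(1)_v$, $(0)_v!=1$, $\binom nk_v=\frac{(n)_v!}{(k)_v!(n-k)_v!}$. $U_{\mathbf q}=U_{\mathbf q}(\mathfrak g_A)$ is the associative unital $\mathbb K$-algebra generated by $e_i,f_i,\omega_i^{\pm1},\omega_i'^{\pm1}$ ($i\in I$) with relations: all $\omega_i^{\pm1},\omega_j'^{\pm1}$ commute with each other, $\omega_i\omega_i^{-1}=\omega_i'\omega_i'^{-1}=1$; $\omega_ie_j\omega_i^{-1}=q_{ij}e_j$, $\omega_i'e_j\omega_i'^{-1}=q_{ji}^{-1}e_j$; $\omega_if_j\omega_i^{-1}=q_{ij}^{-1}f_j$, $\omega_i'f_j\omega_i'^{-1}=q_{ji}f_j$; $e_if_j-f_je_i=\delta_{ij}\frac{q_{ii}}{q_{ii}-1}(\omega_i-\omega_i')$; and for $i\neq j$ $$\sum_{k=0}^{1-a_{ij}}(-1)^k\tbinom{1-a_{ij}}{k}_{q_{ii}}q_{ii}^{k(k-1)/2}q_{ij}^k e_i^{1-a_{ij}-k}e_je_i^k=0,\qquad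 \sum_{k=0}^{1-a_{ij}}(-1)^k\tbinom{1-a_{ij}}{k}_{q_{ii}}q_{ii}^{k(k-1)/2}q_{ij}^k f_i^kf_jf_i^{1-a_{ij}-k}=0.$$ It is a Hopf algebra with $\omega_i^{\pm1},\omega_i'^{\pm1}$ group-like, $\Delta(e_i)=e_i\otimes1+\omega_i\otimes e_i$, $\Delta(f_i)=1\otimes f_i+f_i\otimes\omega_i'$, $\varepsilon(e_i)=\varepsilon(f_i)=0$, $S(e_i)=-\omega_i^{-1}e_i$, $S(f_i)=-f_i\omega_i'^{-1}$. $U_{\mathbf q}^{\ge0}$ (resp. $U_{\mathbf q}^{\le0}$) is the Hopf subalgebra generated by all $e_i,\omega_i^{\pm1}$ (resp. all $f_i,\omega_i'^{\pm1}$). For $\mu=\sum\mu_i\alpha_i$, $\nu=\sum\nu_j\alpha_j\in Q$: $\omega_\mu=\prod\omega_i^{\mu_i}$, $\omega'_\mu=\prod\omega_i'^{\mu_i}$, $q_{\mu\nu}=\prod_{i,j}q_{ij}^{\mu_i\nu_j}$. On tensor products, $\langle y\otimes y',x\otimes x'\rangle_{\mathbf q}=\langle y,x\rangle_{\mathbf q}\langle y',x'\rangle_{\mathbf q}$. *)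

theory Defs
  imports "HOL-Library.Poly_Mapping" "HOL-Algebra.QuotRing" "HOL-Algebra.Subrings" "HOL-Algebra.Module"
begin

text \<open>
  Algebras over a field are records of type \<^typ>\<open>('k, 'u) module\<close> whose scalars are a type
  of class \<^class>\<open>field\<close>; the ring structure is that of HOL-Algebra.
\<close>

definition monoid_algebra :: "('m, 'x) monoid_scheme \<Rightarrow> ('k::field, 'm \<Rightarrow>\<^sub>0 'k) module" where
  "monoid_algebra M =
     \<lparr>carrier = {p. Poly_Mapping.keys p \<subseteq> carrier M},
      mult = (\<lambda>p r. \<Sum>u\<in>Poly_Mapping.keys p. \<Sum>v\<in>Poly_Mapping.keys r.
        Poly_Mapping.single (u \<otimes>\<^bsub>M\<^esub> v) (Poly_Mapping.lookup p u * Poly_Mapping.lookup r v)),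
      one = Poly_Mapping.single \<one>\<^bsub>M\<^esub> 1,
      zero = 0,
      add = (+),
      smult = (\<lambda>c. Poly_Mapping.map (\<lambda>a. c * a))\<rparr>"

definition quot_algebra :: "('k, 'u) module \<Rightarrow> 'u set \<Rightarrow> ('k, 'u set) module" where
  "quot_algebra R J =
     \<lparr>carrier = carrier (R Quot J),
      mult = monoid.mult (R Quot J),
      one = one (R Quot J),
      zero = zero (R Quot J),
      add = add (R Quot J),
      smult = (\<lambda>c X. \<Union>x\<in>X. J +>\<^bsub>R\<^esub> (c \<odot>\<^bsub>R\<^esub> x))\<rparr>"

definition opp_algebra :: "('k, 'u) module \<Rightarrow> ('k, 'u) module" where
  "opp_algebra U = U\<lparr>mult := (\<lambda>x y. y \<otimes>\<^bsub>U\<^esub> x)\<rparr>"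

definition word_monoid :: "'g list monoid" where
  "word_monoid = \<lparr>carrier = UNIV, mult = (@), one = []\<rparr>"

abbreviation free_algebra :: "('k::field, 'g list \<Rightarrow>\<^sub>0 'k) module" where
  "free_algebra \<equiv> monoid_algebra word_monoid"

definition free_lift :: "('k::field, 'u) module \<Rightarrow> ('g \<Rightarrow> 'u) \<Rightarrow> ('g list \<Rightarrow>\<^sub>0 'k) \<Rightarrow> 'u" where
  "free_lift B \<phi> p =
     (\<Oplus>\<^bsub>B\<^esub>w\<in>Poly_Mapping.keys p.
        Poly_Mapping.lookup p w \<odot>\<^bsub>B\<^esub> foldr (\<lambda>g b. \<phi> g \<otimes>\<^bsub>B\<^esub> b) w \<one>\<^bsub>B\<^esub>)"

text \<open>
  The free vector space on \<open>U \<times> V\<close>, with the multiplication \<open>(x, y) (x', y') = (x x', y y')\<close> on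
  basis elements, is the monoid algebra of \<^term>\<open>U \<times>\<times> V\<close>.  The span of the bilinearity relators
  is stable under multiplication by basis elements, so it is the two-sided ideal they generate.
\<close>

definition bilinear_relators :: "('k::field, 'u) module \<Rightarrow> ('k, 'v) module \<Rightarrow> ('u \<times> 'v \<Rightarrow>\<^sub>0 'k) set" where
  "bilinear_relators U V =
     {Poly_Mapping.single (x \<oplus>\<^bsub>U\<^esub> x', y) 1 - Poly_Mapping.single (x, y) 1 - Poly_Mapping.single (x', y) 1
        | x x' y. x \<in> carrier U \<and> x' \<in> carrier U \<and> y \<in> carrier V} \<union>
     {Poly_Mapping.single (x, y \<oplus>\<^bsub>V\<^esub> y') 1 - Poly_Mapping.single (x, y) 1 - Poly_Mapping.single (x, y') 1
        | x y y'. x \<in> carrier U \<and> y \<in> carrier V \<and> y' \<in> carrier V} \<union>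
     {Poly_Mapping.single (c \<odot>\<^bsub>U\<^esub> x, y) 1 - Poly_Mapping.single (x, y) c
        | c x y. x \<in> carrier U \<and> y \<in> carrier V} \<union>
     {Poly_Mapping.single (x, c \<odot>\<^bsub>V\<^esub> y) 1 - Poly_Mapping.single (x, y) c
        | c x y. x \<in> carrier U \<and> y \<in> carrier V}"

definition tensor_ideal :: "('k::field, 'u) module \<Rightarrow> ('k, 'v) module \<Rightarrow> ('u \<times> 'v \<Rightarrow>\<^sub>0 'k) set" where
  "tensor_ideal U V = Idl\<^bsub>monoid_algebra (U \<times>\<times> V)\<^esub> (bilinear_relators U V)"

definition tensor_algebra :: "('k::field, 'u) module \<Rightarrow> ('k, 'v) module \<Rightarrow> ('k, ('u \<times> 'v \<Rightarrow>\<^sub>0 'k) set) module" where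
  "tensor_algebra U V = quot_algebra (monoid_algebra (U \<times>\<times> V)) (tensor_ideal U V)"

definition tensor_class :: "('k::field, 'u) module \<Rightarrow> ('k, 'v) module \<Rightarrow> ('u \<times> 'v \<Rightarrow>\<^sub>0 'k) \<Rightarrow> ('u \<times> 'v \<Rightarrow>\<^sub>0 'k) set" where
  "tensor_class U V s = tensor_ideal U V +>\<^bsub>monoid_algebra (U \<times>\<times> V)\<^esub> s"

definition pure_tensor :: "('k::field, 'u) module \<Rightarrow> ('k, 'v) module \<Rightarrow> 'u \<Rightarrow> 'v \<Rightarrow> ('u \<times> 'v \<Rightarrow>\<^sub>0 'k) set" where
  "pure_tensor U V x y = tensor_class U V (Poly_Mapping.single (x, y) 1)"

text \<open>The image of \<open>G \<otimes> H\<close> in \<open>U \<otimes> V\<close>, for subspaces \<open>G\<close> of \<open>U\<close> and \<open>H\<close> of \<open>V\<close>.\<close>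

definition tensor_sub ::
  "('k::field, 'u) module \<Rightarrow> ('k, 'v) module \<Rightarrow> 'u set \<Rightarrow> 'v set \<Rightarrow> ('u \<times> 'v \<Rightarrow>\<^sub>0 'k) set set" where
  "tensor_sub U V G H = tensor_class U V ` {s. Poly_Mapping.keys s \<subseteq> G \<times> H}"

text \<open>
  The extension of a bilinear \<open>P : G \<times> H \<rightarrow> K\<close> to \<open>(G \<otimes> G) \<times> (H \<otimes> H)\<close> that sends
  \<open>(y \<otimes> y', x \<otimes> x')\<close> to \<open>P y x * P y' x'\<close>.  Tensors are cosets of formal combinations of pairs;
  the value is computed on any representatives supported on \<open>G \<times> G\<close> and \<open>H \<times> H\<close>.
\<close>

definition tensor_pairing ::
  "'u set \<Rightarrow> 'v set \<Rightarrow> ('u \<Rightarrow> 'v \<Rightarrow> 'k::field) \<Rightarrow> ('u \<times> 'u \<Rightarrow>\<^sub>0 'k) set \<Rightarrow> ('v \<times> 'v \<Rightarrow>\<^sub>0 'k) set \<Rightarrow> 'k" where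
  "tensor_pairing G H P S T =
     the_elem {(\<Sum>(y, y')\<in>Poly_Mapping.keys s. \<Sum>(x, x')\<in>Poly_Mapping.keys t.
                  Poly_Mapping.lookup s (y, y') * Poly_Mapping.lookup t (x, x') * (P y x * P y' x'))
               | s t. s \<in> S \<and> Poly_Mapping.keys s \<subseteq> G \<times> G \<and> t \<in> T \<and> Poly_Mapping.keys t \<subseteq> H \<times> H}"

definition symmetrizable_gcm :: "('i \<Rightarrow> 'i \<Rightarrow> int) \<Rightarrow> bool" where
  "symmetrizable_gcm A \<longleftrightarrow>
     (\<forall>i. A i i = 2) \<and>
     (\<forall>i j. i \<noteq> j \<longrightarrow> A i j \<le> 0) \<and>
     (\<forall>i j. A i j = 0 \<longrightarrow> A j i = 0) \<and>
     (\<exists>d :: 'i \<Rightarrow> int. (\<forall>i. d i > 0) \<and> (\<forall>i j. d i * A i j = d j * A j i))"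

definition laurent_monomial :: "('i::finite \<Rightarrow> 'i \<Rightarrow> 'k::field) \<Rightarrow> ('i \<Rightarrow> 'i \<Rightarrow> int) \<Rightarrow> 'k" where
  "laurent_monomial q n = (\<Prod>i\<in>UNIV. \<Prod>j\<in>UNIV. q i j powi n i j)"

text \<open>The exponent of the Laurent monomial \<open>q\<^sub>i\<^sub>j q\<^sub>j\<^sub>i q\<^sub>i\<^sub>i\<^bsup>-a\<^esup>\<close>, where \<open>a\<close> is \<^term>\<open>A i j\<close>.\<close>

definition relation_exponent :: "('i \<Rightarrow> 'i \<Rightarrow> int) \<Rightarrow> 'i \<Rightarrow> 'i \<Rightarrow> 'i \<Rightarrow> 'i \<Rightarrow> int" where
  "relation_exponent A i j k l =
     of_bool (k = i \<and> l = j) + of_bool (k = j \<and> l = i) - A i j * of_bool (k = i \<and> l = i)"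

text \<open>
  Exponents are equivalent if their difference is a rational combination of relation exponents.
  Integral combinations would be too few: the relations imply \<open>q\<^sub>i\<^sub>i\<^bsup>a\<^esup> = q\<^sub>j\<^sub>j\<^bsup>b\<^esup>\<close>
  (\<open>a = A i j\<close>, \<open>b = A j i\<close>), and if for instance \<open>a = b = -2\<close> then in a field
  \<open>q\<^sub>i\<^sub>i = \<plusminus> q\<^sub>j\<^sub>j\<close>, although the exponents of \<open>q\<^sub>i\<^sub>i\<close> and \<open>q\<^sub>j\<^sub>j\<close> need not differ by an
  integral combination.
\<close>

definition equiv_exponents ::
  "('i::finite \<Rightarrow> 'i \<Rightarrow> int) \<Rightarrow> ('i \<Rightarrow> 'i \<Rightarrow> int) \<Rightarrow> ('i \<Rightarrow> 'i \<Rightarrow> int) \<Rightarrow> bool" where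
  "equiv_exponents A m n \<longleftrightarrow>
     (\<exists>c :: 'i \<Rightarrow> 'i \<Rightarrow> rat. \<forall>k l.
        of_int (m k l - n k l) = (\<Sum>i\<in>UNIV. \<Sum>j\<in>UNIV. c i j * of_int (relation_exponent A i j k l)))"

text \<open>
  The \<open>q\<^sub>i\<^sub>j\<close> are indeterminates over the rationals subject only to \<open>q\<^sub>i\<^sub>j q\<^sub>j\<^sub>i = q\<^sub>i\<^sub>i\<^bsup>a\<^esup>\<close>
  (\<open>a = A i j\<close>): Laurent monomials not identified by these relations are linearly independent
  over the rationals.
\<close>

definition generic_parameters ::
  "('i::finite \<Rightarrow> 'i \<Rightarrow> int) \<Rightarrow> ('i \<Rightarrow> 'i \<Rightarrow> 'k::field_char_0) \<Rightarrow> bool" where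
  "generic_parameters A q \<longleftrightarrow>
     (\<forall>i j. q i j \<noteq> 0) \<and>
     (\<forall>i j. q i j * q j i = q i i powi A i j) \<and>
     (\<forall>S. finite S \<and> pairwise (\<lambda>m n. \<not> equiv_exponents A m n) S \<longrightarrow>
        (\<forall>c :: ('i \<Rightarrow> 'i \<Rightarrow> int) \<Rightarrow> rat.
           (\<Sum>n\<in>S. of_rat (c n) * laurent_monomial q n) = 0 \<longrightarrow> (\<forall>n\<in>S. c n = 0)))"

text \<open>The element \<open>q\<^bsub>\<mu>\<nu>\<^esub>\<close>, for elements of the root lattice given by their coordinates.\<close>

definition q_lattice :: "('i::finite \<Rightarrow> 'i \<Rightarrow> 'k::field) \<Rightarrow> ('i \<Rightarrow> int) \<Rightarrow> ('i \<Rightarrow> int) \<Rightarrow> 'k" where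
  "q_lattice q \<mu> \<nu> = (\<Prod>i\<in>UNIV. \<Prod>j\<in>UNIV. q i j powi (\<mu> i * \<nu> j))"

definition qnum :: "'k::field \<Rightarrow> nat \<Rightarrow> 'k" where
  "qnum v n = (v ^ n - 1) / (v - 1)"

definition qfact :: "'k::field \<Rightarrow> nat \<Rightarrow> 'k" where
  "qfact v n = (\<Prod>k=1..n. qnum v k)"

definition qbinom :: "'k::field \<Rightarrow> nat \<Rightarrow> nat \<Rightarrow> 'k" where
  "qbinom v n k = qfact v n / (qfact v k * qfact v (n - k))"

datatype 'i gen = E 'i | F 'i | Om 'i | OmInv 'i | Om' 'i | OmInv' 'i

definition torus_gens :: "'i gen set" where
  "torus_gens = range Om \<union> range OmInv \<union> range Om' \<union> range OmInv'"

abbreviation word :: "'k::field \<Rightarrow> 'g list \<Rightarrow> ('g list \<Rightarrow>\<^sub>0 'k)" where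
  "word c w \<equiv> Poly_Mapping.single w c"

definition serre_coeff :: "('i \<Rightarrow> 'i \<Rightarrow> int) \<Rightarrow> ('i \<Rightarrow> 'i \<Rightarrow> 'k::field) \<Rightarrow> 'i \<Rightarrow> 'i \<Rightarrow> nat \<Rightarrow> 'k" where
  "serre_coeff A q i j k =
     (-1) ^ k * qbinom (q i i) (nat (1 - A i j)) k * q i i ^ (k * (k - 1) div 2) * q i j ^ k"

definition serre_E :: "('i \<Rightarrow> 'i \<Rightarrow> int) \<Rightarrow> ('i \<Rightarrow> 'i \<Rightarrow> 'k::field) \<Rightarrow> 'i \<Rightarrow> 'i \<Rightarrow> 'i gen list \<Rightarrow>\<^sub>0 'k" where
  "serre_E A q i j = (let N = nat (1 - A i j) in
     \<Sum>k\<le>N. word (serre_coeff A q i j k) (replicate (N - k) (E i) @ [E j] @ replicate k (E i)))"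

definition serre_F :: "('i \<Rightarrow> 'i \<Rightarrow> int) \<Rightarrow> ('i \<Rightarrow> 'i \<Rightarrow> 'k::field) \<Rightarrow> 'i \<Rightarrow> 'i \<Rightarrow> 'i gen list \<Rightarrow>\<^sub>0 'k" where
  "serre_F A q i j = (let N = nat (1 - A i j) in
     \<Sum>k\<le>N. word (serre_coeff A q i j k) (replicate k (F i) @ [F j] @ replicate (N - k) (F i)))"

definition Uq_relators ::
  "('i \<Rightarrow> 'i \<Rightarrow> int) \<Rightarrow> ('i \<Rightarrow> 'i \<Rightarrow> 'k::field) \<Rightarrow> ('i gen list \<Rightarrow>\<^sub>0 'k) set" where
  "Uq_relators A q =
     {word 1 [g, h] - word 1 [h, g] | g h. g \<in> torus_gens \<and> h \<in> torus_gens} \<union>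
     {word 1 [Om i, OmInv i] - word 1 [] | i. True} \<union>
     {word 1 [Om' i, OmInv' i] - word 1 [] | i. True} \<union>
     {word 1 [Om i, E j, OmInv i] - word (q i j) [E j] | i j. True} \<union>
     {word 1 [Om' i, E j, OmInv' i] - word (inverse (q j i)) [E j] | i j. True} \<union>
     {word 1 [Om i, F j, OmInv i] - word (inverse (q i j)) [F j] | i j. True} \<union>
     {word 1 [Om' i, F j, OmInv' i] - word (q j i) [F j] | i j. True} \<union>
     {word 1 [E i, F j] - word 1 [F j, E i]
        - (if i = j then word (q i i / (q i i - 1)) [Om i] - word (q i i / (q i i - 1)) [Om' i] else 0)
        | i j. True} \<union>
     {serre_E A q i j | i j. i \<noteq> j} \<union>
     {serre_F A q i j | i j. i \<noteq> j}"

definition Uq_ideal ::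
  "('i \<Rightarrow> 'i \<Rightarrow> int) \<Rightarrow> ('i \<Rightarrow> 'i \<Rightarrow> 'k::field) \<Rightarrow> ('i gen list \<Rightarrow>\<^sub>0 'k) set" where
  "Uq_ideal A q = Idl\<^bsub>free_algebra\<^esub> (Uq_relators A q)"

definition Uq ::
  "('i \<Rightarrow> 'i \<Rightarrow> int) \<Rightarrow> ('i \<Rightarrow> 'i \<Rightarrow> 'k::field) \<Rightarrow> ('k, ('i gen list \<Rightarrow>\<^sub>0 'k) set) module" where
  "Uq A q = quot_algebra free_algebra (Uq_ideal A q)"

definition ugen ::
  "('i \<Rightarrow> 'i \<Rightarrow> int) \<Rightarrow> ('i \<Rightarrow> 'i \<Rightarrow> 'k::field) \<Rightarrow> 'i gen \<Rightarrow> ('i gen list \<Rightarrow>\<^sub>0 'k) set" where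
  "ugen A q g = Uq_ideal A q +>\<^bsub>free_algebra\<^esub> word 1 [g]"

text \<open>The library's finite product is used although \<^term>\<open>Uq A q\<close> is not commutative;
  the factors commute with each other, so the order of multiplication is immaterial.\<close>

definition omega ::
  "('i::finite \<Rightarrow> 'i \<Rightarrow> int) \<Rightarrow> ('i \<Rightarrow> 'i \<Rightarrow> 'k::field) \<Rightarrow> ('i \<Rightarrow> int) \<Rightarrow> ('i gen list \<Rightarrow>\<^sub>0 'k) set" where
  "omega A q \<mu> = (\<Otimes>\<^bsub>Uq A q\<^esub>i\<in>UNIV. ugen A q (Om i) [^]\<^bsub>Uq A q\<^esub> \<mu> i)"

definition omega' ::
  "('i::finite \<Rightarrow> 'i \<Rightarrow> int) \<Rightarrow> ('i \<Rightarrow> 'i \<Rightarrow> 'k::field) \<Rightarrow> ('i \<Rightarrow> int) \<Rightarrow> ('i gen list \<Rightarrow>\<^sub>0 'k) set" where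
  "omega' A q \<mu> = (\<Otimes>\<^bsub>Uq A q\<^esub>i\<in>UNIV. ugen A q (Om' i) [^]\<^bsub>Uq A q\<^esub> \<mu> i)"

abbreviation UqUq ::
  "('i \<Rightarrow> 'i \<Rightarrow> int) \<Rightarrow> ('i \<Rightarrow> 'i \<Rightarrow> 'k::field) \<Rightarrow>
     ('k, (('i gen list \<Rightarrow>\<^sub>0 'k) set \<times> ('i gen list \<Rightarrow>\<^sub>0 'k) set \<Rightarrow>\<^sub>0 'k) set) module" where
  "UqUq A q \<equiv> tensor_algebra (Uq A q) (Uq A q)"

abbreviation utensor ::
  "('i \<Rightarrow> 'i \<Rightarrow> int) \<Rightarrow> ('i \<Rightarrow> 'i \<Rightarrow> 'k::field) \<Rightarrow> ('i gen list \<Rightarrow>\<^sub>0 'k) set \<Rightarrow> ('i gen list \<Rightarrow>\<^sub>0 'k) set \<Rightarrow>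
     (('i gen list \<Rightarrow>\<^sub>0 'k) set \<times> ('i gen list \<Rightarrow>\<^sub>0 'k) set \<Rightarrow>\<^sub>0 'k) set" where
  "utensor A q \<equiv> pure_tensor (Uq A q) (Uq A q)"

fun comult_gen ::
  "('i \<Rightarrow> 'i \<Rightarrow> int) \<Rightarrow> ('i \<Rightarrow> 'i \<Rightarrow> 'k::field) \<Rightarrow> 'i gen \<Rightarrow>
     (('i gen list \<Rightarrow>\<^sub>0 'k) set \<times> ('i gen list \<Rightarrow>\<^sub>0 'k) set \<Rightarrow>\<^sub>0 'k) set" where
  "comult_gen A q (E i) =
     utensor A q (ugen A q (E i)) \<one>\<^bsub>Uq A q\<^esub> \<oplus>\<^bsub>UqUq A q\<^esub> utensor A q (ugen A q (Om i)) (ugen A q (E i))"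
| "comult_gen A q (F i) =
     utensor A q \<one>\<^bsub>Uq A q\<^esub> (ugen A q (F i)) \<oplus>\<^bsub>UqUq A q\<^esub> utensor A q (ugen A q (F i)) (ugen A q (Om' i))"
| "comult_gen A q g = utensor A q (ugen A q g) (ugen A q g)"

fun antipode_gen ::
  "('i \<Rightarrow> 'i \<Rightarrow> int) \<Rightarrow> ('i \<Rightarrow> 'i \<Rightarrow> 'k::field) \<Rightarrow> 'i gen \<Rightarrow> ('i gen list \<Rightarrow>\<^sub>0 'k) set" where
  "antipode_gen A q (E i) = \<ominus>\<^bsub>Uq A q\<^esub> (ugen A q (OmInv i) \<otimes>\<^bsub>Uq A q\<^esub> ugen A q (E i))"
| "antipode_gen A q (F i) = \<ominus>\<^bsub>Uq A q\<^esub> (ugen A q (F i) \<otimes>\<^bsub>Uq A q\<^esub> ugen A q (OmInv' i))"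
| "antipode_gen A q (Om i) = ugen A q (OmInv i)"
| "antipode_gen A q (OmInv i) = ugen A q (Om i)"
| "antipode_gen A q (Om' i) = ugen A q (OmInv' i)"
| "antipode_gen A q (OmInv' i) = ugen A q (Om' i)"

text \<open>
  The comultiplication is the algebra homomorphism, and the antipode the anti-homomorphism,
  with the given values on generators: the homomorphisms on the free algebra are constant on the
  cosets that are the elements of \<^term>\<open>Uq A q\<close>.
\<close>

definition comult ::
  "('i \<Rightarrow> 'i \<Rightarrow> int) \<Rightarrow> ('i \<Rightarrow> 'i \<Rightarrow> 'k::field) \<Rightarrow> ('i gen list \<Rightarrow>\<^sub>0 'k) set \<Rightarrow>
     (('i gen list \<Rightarrow>\<^sub>0 'k) set \<times> ('i gen list \<Rightarrow>\<^sub>0 'k) set \<Rightarrow>\<^sub>0 'k) set" where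
  "comult A q X = the_elem (free_lift (UqUq A q) (comult_gen A q) ` X)"

definition antipode ::
  "('i \<Rightarrow> 'i \<Rightarrow> int) \<Rightarrow> ('i \<Rightarrow> 'i \<Rightarrow> 'k::field) \<Rightarrow> ('i gen list \<Rightarrow>\<^sub>0 'k) set \<Rightarrow> ('i gen list \<Rightarrow>\<^sub>0 'k) set" where
  "antipode A q X = the_elem (free_lift (opp_algebra (Uq A q)) (antipode_gen A q) ` X)"

definition hopf_subalgebra ::
  "('i \<Rightarrow> 'i \<Rightarrow> int) \<Rightarrow> ('i \<Rightarrow> 'i \<Rightarrow> 'k::field) \<Rightarrow> ('i gen list \<Rightarrow>\<^sub>0 'k) set set \<Rightarrow> bool" where
  "hopf_subalgebra A q H \<longleftrightarrow>
     subring H (Uq A q) \<and>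
     (\<forall>c. \<forall>x\<in>H. c \<odot>\<^bsub>Uq A q\<^esub> x \<in> H) \<and>
     (\<forall>x\<in>H. comult A q x \<in> tensor_sub (Uq A q) (Uq A q) H H) \<and>
     (\<forall>x\<in>H. antipode A q x \<in> H)"

definition Uq_nonneg ::
  "('i \<Rightarrow> 'i \<Rightarrow> int) \<Rightarrow> ('i \<Rightarrow> 'i \<Rightarrow> 'k::field) \<Rightarrow> ('i gen list \<Rightarrow>\<^sub>0 'k) set set" where
  "Uq_nonneg A q =
     \<Inter>{H. hopf_subalgebra A q H \<and> (\<forall>i. {ugen A q (E i), ugen A q (Om i), ugen A q (OmInv i)} \<subseteq> H)}"

definition Uq_nonpos ::
  "('i \<Rightarrow> 'i \<Rightarrow> int) \<Rightarrow> ('i \<Rightarrow> 'i \<Rightarrow> 'k::field) \<Rightarrow> ('i gen list \<Rightarrow>\<^sub>0 'k) set set" where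
  "Uq_nonpos A q =
     \<Inter>{H. hopf_subalgebra A q H \<and> (\<forall>i. {ugen A q (F i), ugen A q (Om' i), ugen A q (OmInv' i)} \<subseteq> H)}"

definition bilinear_on :: "('k::field, 'u) module \<Rightarrow> 'u set \<Rightarrow> 'u set \<Rightarrow> ('u \<Rightarrow> 'u \<Rightarrow> 'k) \<Rightarrow> bool" where
  "bilinear_on U G H P \<longleftrightarrow>
     (\<forall>y\<in>G. \<forall>y'\<in>G. \<forall>x\<in>H. P (y \<oplus>\<^bsub>U\<^esub> y') x = P y x + P y' x) \<and>
     (\<forall>y\<in>G. \<forall>x\<in>H. \<forall>x'\<in>H. P y (x \<oplus>\<^bsub>U\<^esub> x') = P y x + P y x') \<and>
     (\<forall>c. \<forall>y\<in>G. \<forall>x\<in>H. P (c \<odot>\<^bsub>U\<^esub> y) x = c * P y x \<and> P y (c \<odot>\<^bsub>U\<^esub> x) = c * P y x)"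

end

theory Submission
  imports Defs
begin

text \<open>
  On words in the generators a pairing with the two multiplicativity properties is determined by its
  values on generators, which gives uniqueness.  For existence, the convolution product of functionals
  on \<open>U\<^sub>q\<close> reduces the first variable to generators: it suffices that the functionals
  \<open>\<langle>f\<^sub>i, _\<rangle>\<close> and \<open>\<langle>\<omega>'\<^sub>i, _\<rangle>\<close>, defined on words, come from functionals on all of \<open>U\<^sub>q\<close>.
  They are matrix coefficients of a \<open>U\<^sub>q\<close>-module in which the \<open>f\<^sub>i\<close> act by q-commutators and the \<open>e\<^sub>i\<close>
  by skew derivations, so no triangular decomposition is needed.  The second variable is reduced to the
  first by the isomorphism with the quantum group of the transposed parameters.  The Serre elements are
  iterated q-commutators \<open>z \<mapsto> x z - c z x\<close> whose order is immaterial; choosing the order makes the mixed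
  terms vanish one by one, which shows at once that the coproduct respects the Serre relations and that
  they hold in the module.
\<close>

section \<open>Algebras over a field\<close>

text \<open>The halves are intersections of Hopf subalgebras of U_q, so no presentation of them is
  at hand: a functional given on words is shown to be well defined by extending it to all words,
  mixed ones included, and killing the whole ideal. The same embedding affects
  \<open>tensor_pairing\<close>, whose arguments are classes in U tensor U with representatives
  supported on the halves; independence of the representatives amounts to injectivity of G tensor G
  -> U tensor U and comes from linear projections onto the halves. All Serre arguments rest on one
  identity, q_ii^N q_ij q_ji = 1 with N = -a_ij. It makes the parameters q_ij, q_ii q_ij, ...,
  q_ii^N q_ij, read backwards, a geometric list starting at 1/q_ji with ratio 1/q_ii. So a Serre
  element can be rewritten with q_ji in place of q_ij in the opposite algebra, as the antipode and
  the exchange of the halves require. The module keeps a free weight z of the empty word: z_j = q_ji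
  yields the functionals of f_i and omega'_i, z_j = 1/q_ji that of the inverse of omega'_i, and z =
  1 the counit.\<close>

locale K_algebra = ring U for U :: "('k::field, 'u) module" (structure) +
  assumes smult_closed [simp, intro]: "x \<in> carrier U \<Longrightarrow> c \<odot> x \<in> carrier U"
    and smult_l_distr: "x \<in> carrier U \<Longrightarrow> (c + d) \<odot> x = c \<odot> x \<oplus> d \<odot> x"
    and smult_r_distr: "x \<in> carrier U \<Longrightarrow> y \<in> carrier U \<Longrightarrow> c \<odot> (x \<oplus> y) = c \<odot> x \<oplus> c \<odot> y"
    and smult_smult: "x \<in> carrier U \<Longrightarrow> c \<odot> (d \<odot> x) = (c * d) \<odot> x"
    and smult_one [simp]: "x \<in> carrier U \<Longrightarrow> 1 \<odot> x = x"
    and smult_mult_left: "x \<in> carrier U \<Longrightarrow> y \<in> carrier U \<Longrightarrow> (c \<odot> x) \<otimes> y = c \<odot> (x \<otimes> y)"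
    and smult_mult_right: "x \<in> carrier U \<Longrightarrow> y \<in> carrier U \<Longrightarrow> x \<otimes> (c \<odot> y) = c \<odot> (x \<otimes> y)"
begin

lemma smult_zero_left [simp]: "x \<in> carrier U \<Longrightarrow> 0 \<odot> x = \<zero>"
  using smult_l_distr[of x 0 0] by (simp add: add.r_cancel_one')

lemma smult_zero_right [simp]: "c \<odot> \<zero> = \<zero>"
  using smult_r_distr[of \<zero> \<zero> c] by (simp add: add.r_cancel_one')

lemma minus_eq_smult: "x \<in> carrier U \<Longrightarrow> \<ominus> x = (-1) \<odot> x"
  using smult_l_distr[of x "-1" 1] by (intro minus_equality) simp_all

lemma smult_add_cancel [simp]: "x \<in> carrier U \<Longrightarrow> (- c) \<odot> x \<oplus> c \<odot> x = \<zero>"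
  "x \<in> carrier U \<Longrightarrow> c \<odot> x \<oplus> (- c) \<odot> x = \<zero>"
  by (simp_all flip: smult_l_distr)

lemma cancel_opposite:
  assumes "x \<in> carrier U" "a \<in> carrier U" "b \<in> carrier U"
  shows "x \<oplus> (c \<odot> a \<oplus> (- c) \<odot> b) \<oplus> (c \<odot> b \<oplus> (- c) \<odot> a) = x"
proof -
  have "x \<oplus> (c \<odot> a \<oplus> (- c) \<odot> b) \<oplus> (c \<odot> b \<oplus> (- c) \<odot> a)
    = x \<oplus> (c \<odot> a \<oplus> (- c) \<odot> a) \<oplus> (c \<odot> b \<oplus> (- c) \<odot> b)"
    using assms by (simp add: a_ac del: smult_add_cancel)
  then show ?thesis using assms by simp
qed

end

text \<open>Additive inverses come from the scalars: \<open>(-1) \<odot> x\<close> is the inverse of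
  x because -1 + 1 acts as 0.\<close>

lemma K_algebraI:
  fixes U :: "('k::field, 'u) module" (structure)
  assumes "\<And>x y. x \<in> carrier U \<Longrightarrow> y \<in> carrier U \<Longrightarrow> x \<oplus> y \<in> carrier U"
    and "\<zero> \<in> carrier U"
    and "\<And>x y z. x \<in> carrier U \<Longrightarrow> y \<in> carrier U \<Longrightarrow> z \<in> carrier U \<Longrightarrow> x \<oplus> y \<oplus> z = x \<oplus> (y \<oplus> z)"
    and "\<And>x y. x \<in> carrier U \<Longrightarrow> y \<in> carrier U \<Longrightarrow> x \<oplus> y = y \<oplus> x"
    and l_zero: "\<And>x. x \<in> carrier U \<Longrightarrow> \<zero> \<oplus> x = x"
    and "\<And>x y. x \<in> carrier U \<Longrightarrow> y \<in> carrier U \<Longrightarrow> x \<otimes> y \<in> carrier U"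
    and "\<one> \<in> carrier U"
    and "\<And>x y z. x \<in> carrier U \<Longrightarrow> y \<in> carrier U \<Longrightarrow> z \<in> carrier U \<Longrightarrow> x \<otimes> y \<otimes> z = x \<otimes> (y \<otimes> z)"
    and "\<And>x. x \<in> carrier U \<Longrightarrow> \<one> \<otimes> x = x"
    and "\<And>x. x \<in> carrier U \<Longrightarrow> x \<otimes> \<one> = x"
    and "\<And>x y z. x \<in> carrier U \<Longrightarrow> y \<in> carrier U \<Longrightarrow> z \<in> carrier U \<Longrightarrow> (x \<oplus> y) \<otimes> z = x \<otimes> z \<oplus> y \<otimes> z"
    and "\<And>x y z. x \<in> carrier U \<Longrightarrow> y \<in> carrier U \<Longrightarrow> z \<in> carrier U \<Longrightarrow> z \<otimes> (x \<oplus> y) = z \<otimes> x \<oplus> z \<otimes> y"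
    and closed: "\<And>c x. x \<in> carrier U \<Longrightarrow> c \<odot> x \<in> carrier U"
    and distr: "\<And>c d x. x \<in> carrier U \<Longrightarrow> (c + d) \<odot> x = c \<odot> x \<oplus> d \<odot> x"
    and "\<And>c x y. x \<in> carrier U \<Longrightarrow> y \<in> carrier U \<Longrightarrow> c \<odot> (x \<oplus> y) = c \<odot> x \<oplus> c \<odot> y"
    and "\<And>c d x. x \<in> carrier U \<Longrightarrow> c \<odot> (d \<odot> x) = (c * d) \<odot> x"
    and one: "\<And>x. x \<in> carrier U \<Longrightarrow> 1 \<odot> x = x"
    and zero: "\<And>x. x \<in> carrier U \<Longrightarrow> 0 \<odot> x = \<zero>"
    and "\<And>c x y. x \<in> carrier U \<Longrightarrow> y \<in> carrier U \<Longrightarrow> (c \<odot> x) \<otimes> y = c \<odot> (x \<otimes> y)"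
    and "\<And>c x y. x \<in> carrier U \<Longrightarrow> y \<in> carrier U \<Longrightarrow> x \<otimes> (c \<odot> y) = c \<odot> (x \<otimes> y)"
  shows "K_algebra U"
proof -
  have inv: "\<exists>y\<in>carrier U. y \<oplus> x = \<zero>" if "x \<in> carrier U" for x
    using distr[OF that, of "-1" 1] closed[OF that, of "-1"] one[OF that] zero[OF that] by auto
  have "ring U"
    by (intro ringI abelian_groupI monoidI) (use assms inv in auto)
  then show ?thesis
    by (intro K_algebra.intro K_algebra_axioms.intro) (use assms in auto)
qed

section \<open>Algebra homomorphisms and opposite algebras\<close>

definition alg_hom :: "('k, 'u) module \<Rightarrow> ('k, 'v) module \<Rightarrow> ('u \<Rightarrow> 'v) \<Rightarrow> bool" where
  "alg_hom U V h \<longleftrightarrow> h \<in> ring_hom U V \<and> (\<forall>c. \<forall>x\<in>carrier U. h (c \<odot>\<^bsub>U\<^esub> x) = c \<odot>\<^bsub>V\<^esub> h x)"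

lemma alg_homD:
  assumes "alg_hom U V h"
  shows "x \<in> carrier U \<Longrightarrow> h x \<in> carrier V"
    and "x \<in> carrier U \<Longrightarrow> y \<in> carrier U \<Longrightarrow> h (x \<oplus>\<^bsub>U\<^esub> y) = h x \<oplus>\<^bsub>V\<^esub> h y"
    and "x \<in> carrier U \<Longrightarrow> y \<in> carrier U \<Longrightarrow> h (x \<otimes>\<^bsub>U\<^esub> y) = h x \<otimes>\<^bsub>V\<^esub> h y"
    and "h \<one>\<^bsub>U\<^esub> = \<one>\<^bsub>V\<^esub>"
    and "x \<in> carrier U \<Longrightarrow> h (c \<odot>\<^bsub>U\<^esub> x) = c \<odot>\<^bsub>V\<^esub> h x"
  using assms by (auto simp: alg_hom_def ring_hom_def)

lemma alg_hom_zero: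
  assumes "K_algebra U" "K_algebra V" "alg_hom U V h"
  shows "h \<zero>\<^bsub>U\<^esub> = \<zero>\<^bsub>V\<^esub>"
proof -
  interpret U: K_algebra U by fact
  interpret V: K_algebra V by fact
  have "h (0 \<odot>\<^bsub>U\<^esub> \<zero>\<^bsub>U\<^esub>) = 0 \<odot>\<^bsub>V\<^esub> h \<zero>\<^bsub>U\<^esub>"
    by (rule alg_homD(5)[OF assms(3)]) simp
  then show ?thesis
    using alg_homD(1)[OF assms(3), of "\<zero>\<^bsub>U\<^esub>"] by simp
qed

lemma opp_algebra_simps [simp]:
  "carrier (opp_algebra U) = carrier U" "one (opp_algebra U) = one U" "zero (opp_algebra U) = zero U"
  "add (opp_algebra U) = add U" "smult (opp_algebra U) = smult U"
  "x \<otimes>\<^bsub>opp_algebra U\<^esub> y = y \<otimes>\<^bsub>U\<^esub> x"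
  by (simp_all add: opp_algebra_def)

lemma K_algebra_opp: "K_algebra U \<Longrightarrow> K_algebra (opp_algebra U)"
proof -
  assume "K_algebra U"
  then interpret K_algebra U .
  show ?thesis
    by (rule K_algebraI)
      (auto simp: a_ac m_assoc l_distr r_distr smult_l_distr smult_r_distr smult_smult
        smult_mult_left smult_mult_right)
qed

subsection \<open>Finitely supported functions\<close>

text \<open>The linear functional with values f on the basis. Functionals on the free algebra and on
  formal tensors are all written in this form.\<close>

definition lin :: "('a \<Rightarrow> 'k) \<Rightarrow> ('a \<Rightarrow>\<^sub>0 'k::field) \<Rightarrow> 'k" where
  "lin f p = (\<Sum>k\<in>Poly_Mapping.keys p. Poly_Mapping.lookup p k * f k)"

definition scale :: "'k::field \<Rightarrow> ('a \<Rightarrow>\<^sub>0 'k) \<Rightarrow> ('a \<Rightarrow>\<^sub>0 'k)" where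
  "scale c = Poly_Mapping.map (\<lambda>a. c * a)"

lemma lookup_scale [simp]: "Poly_Mapping.lookup (scale c p) k = c * Poly_Mapping.lookup p k"
  by (simp add: scale_def Poly_Mapping.map.rep_eq when_def)

lemma keys_scale: "Poly_Mapping.keys (scale c p) \<subseteq> Poly_Mapping.keys p"
  by (auto simp: in_keys_iff)

lemma sum_keys_superset:
  assumes "finite S" "Poly_Mapping.keys p \<subseteq> S" "\<And>k. g k 0 = 0"
  shows "(\<Sum>k\<in>Poly_Mapping.keys p. g k (Poly_Mapping.lookup p k)) = (\<Sum>k\<in>S. g k (Poly_Mapping.lookup p k))"
  using assms by (intro sum.mono_neutral_left) (auto simp: in_keys_iff)

text \<open>Keys may cancel in p + r, so all three sums are taken over the union of the two
  supports, where the additional summands are g k 0 = 0.\<close>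

lemma sum_keys_add:
  fixes g :: "'a \<Rightarrow> 'b::comm_monoid_add \<Rightarrow> 'c::comm_monoid_add"
  assumes "\<And>k. g k 0 = 0" "\<And>k a b. g k (a + b) = g k a + g k b"
  shows "(\<Sum>k\<in>Poly_Mapping.keys (p + r). g k (Poly_Mapping.lookup (p + r) k))
    = (\<Sum>k\<in>Poly_Mapping.keys p. g k (Poly_Mapping.lookup p k)) + (\<Sum>k\<in>Poly_Mapping.keys r. g k (Poly_Mapping.lookup r
        k))"
proof -
  have "(\<Sum>k\<in>Poly_Mapping.keys s. g k (Poly_Mapping.lookup s k))
      = (\<Sum>k\<in>Poly_Mapping.keys p \<union> Poly_Mapping.keys r. g k (Poly_Mapping.lookup s k))"
    if "Poly_Mapping.keys s \<subseteq> Poly_Mapping.keys p \<union> Poly_Mapping.keys r" for s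
    using that assms(1) by (intro sum_keys_superset) auto
  from this[of "p + r"] this[of p] this[of r] show ?thesis
    using Poly_Mapping.keys_add[of p r] by (simp add: assms(2) lookup_add sum.distrib)
qed

lemma sum_keys_single:
  assumes "\<And>k. g k 0 = 0"
  shows "(\<Sum>k\<in>Poly_Mapping.keys (Poly_Mapping.single a c). g k (Poly_Mapping.lookup (Poly_Mapping.single a c) k))
      = g a c"
  using assms by simp

lemma lin_zero [simp]: "lin f 0 = 0"
  by (simp add: lin_def)

lemma lin_add [simp]: "lin f (p + r) = lin f p + lin f r"
  unfolding lin_def by (rule sum_keys_add) (auto simp: algebra_simps)

lemma lin_single [simp]: "lin f (Poly_Mapping.single k c) = c * f k"
  by (simp add: lin_def)

lemma lin_sum [simp]: "lin f (\<Sum>x\<in>A. g x) = (\<Sum>x\<in>A. lin f (g x))"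
  by (induction A rule: infinite_finite_induct) simp_all

lemma lin_minus [simp]: "lin f (p - r) = lin f p - lin f r"
  using lin_add[of f "p - r" r] by simp

lemma sum_single_lookup: "(\<Sum>k\<in>Poly_Mapping.keys p. Poly_Mapping.single k (Poly_Mapping.lookup p k)) = p"
  by (rule poly_mapping_eqI)
    (auto simp: lookup_sum lookup_single when_def in_keys_iff)

lemma lin_scale [simp]: "lin f (scale c p) = c * lin f p"
  unfolding lin_def
  by (subst sum_keys_superset[where g="\<lambda>k a. a * f k", OF _ keys_scale])
    (auto simp: sum_distrib_left mult.assoc)

lemma lin_cong: "(\<And>k. k \<in> Poly_Mapping.keys p \<Longrightarrow> f k = g k) \<Longrightarrow> lin f p = lin g p"
  by (simp add: lin_def)

lemma lin_add_fun: "lin (\<lambda>k. f k + g k) p = lin f p + lin g p"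
  by (simp add: lin_def distrib_left sum.distrib)

lemma lin_mult_fun: "lin (\<lambda>k. c * f k) p = c * lin f p"
  by (simp add: lin_def sum_distrib_left algebra_simps)

text \<open>Built up one monomial at a time while the support is remembered. The step admits a
  monomial whose key already occurs in p, so a proof of the step needs additivity alone.\<close>

lemma keys_induct [consumes 1, case_names zero add]:
  fixes p :: "'a \<Rightarrow>\<^sub>0 'b::comm_monoid_add"
  assumes "Poly_Mapping.keys p \<subseteq> S"
    and "P 0"
    and add: "\<And>k c p. k \<in> S \<Longrightarrow> Poly_Mapping.keys p \<subseteq> S \<Longrightarrow> P p \<Longrightarrow> P (Poly_Mapping.single k c + p)"
  shows "P p"
proof -
  have "P (\<Sum>k\<in>A. Poly_Mapping.single k (Poly_Mapping.lookup p k)) \<and>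
      Poly_Mapping.keys (\<Sum>k\<in>A. Poly_Mapping.single k (Poly_Mapping.lookup p k)) \<subseteq> S"
    if "finite A" "A \<subseteq> S" for A
    using that
  proof (induction A rule: finite_induct)
    case (insert a A)
    let ?r = "\<Sum>k\<in>A. Poly_Mapping.single k (Poly_Mapping.lookup p k)"
    have "Poly_Mapping.keys (Poly_Mapping.single a (Poly_Mapping.lookup p a) + ?r) \<subseteq> S"
      using Poly_Mapping.keys_add[of "Poly_Mapping.single a (Poly_Mapping.lookup p a)" ?r] insert
      by (auto split: if_splits)
    then show ?case using insert add by auto
  qed (use assms in simp)
  from this[of "Poly_Mapping.keys p"] show ?thesis
    using assms(1) by (simp add: sum_single_lookup)
qed

subsection \<open>Monoid algebras\<close>

lemma monoid_algebra_simps [simp]: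
  "carrier (monoid_algebra M) = {p. Poly_Mapping.keys p \<subseteq> carrier M}"
  "one (monoid_algebra M) = Poly_Mapping.single \<one>\<^bsub>M\<^esub> 1"
  "zero (monoid_algebra M) = 0"
  "add (monoid_algebra M) = (+)"
  "smult (monoid_algebra M) = scale"
  by (simp_all add: monoid_algebra_def scale_def fun_eq_iff)

context
  fixes M :: "('m, 'x) monoid_scheme" and R :: "('k::field, 'm \<Rightarrow>\<^sub>0 'k) module"
  defines "R \<equiv> monoid_algebra M"
begin

lemma monoid_algebra_mult:
  "p \<otimes>\<^bsub>R\<^esub> r = (\<Sum>u\<in>Poly_Mapping.keys p. \<Sum>v\<in>Poly_Mapping.keys r.
     Poly_Mapping.single (u \<otimes>\<^bsub>M\<^esub> v) (Poly_Mapping.lookup p u * Poly_Mapping.lookup r v))"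
  by (simp add: R_def monoid_algebra_def)

lemma monoid_algebra_mult_add_left: "(p + p') \<otimes>\<^bsub>R\<^esub> r = p \<otimes>\<^bsub>R\<^esub> r + p' \<otimes>\<^bsub>R\<^esub> r"
  unfolding monoid_algebra_mult
  by (rule sum_keys_add[where g="\<lambda>u a. \<Sum>v\<in>Poly_Mapping.keys r.
     Poly_Mapping.single (u \<otimes>\<^bsub>M\<^esub> v) (a * Poly_Mapping.lookup r v)"])
    (simp_all add: distrib_right single_add sum.distrib)

lemma monoid_algebra_mult_add_right: "p \<otimes>\<^bsub>R\<^esub> (r + r') = p \<otimes>\<^bsub>R\<^esub> r + p \<otimes>\<^bsub>R\<^esub> r'"
  unfolding monoid_algebra_mult
  by (subst sum_keys_add[where g="\<lambda>v a. Poly_Mapping.single (_ \<otimes>\<^bsub>M\<^esub> v) (_ * a)"])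
    (simp_all add: distrib_left single_add sum.distrib)

lemma monoid_algebra_mult_zero [simp]: "0 \<otimes>\<^bsub>R\<^esub> r = 0" "p \<otimes>\<^bsub>R\<^esub> 0 = 0"
  by (simp_all add: monoid_algebra_mult)

lemma monoid_algebra_mult_single:
  "Poly_Mapping.single u a \<otimes>\<^bsub>R\<^esub> Poly_Mapping.single v b = Poly_Mapping.single (u \<otimes>\<^bsub>M\<^esub> v) (a * b)"
  by (simp add: monoid_algebra_mult)

end

lemma keys_add_subset: "Poly_Mapping.keys p \<subseteq> S \<Longrightarrow> Poly_Mapping.keys r \<subseteq> S \<Longrightarrow> Poly_Mapping.keys (p + r) \<subseteq> S"
  using Poly_Mapping.keys_add[of p r] by blast

lemma keys_sum_subset: "(\<And>x. x \<in> A \<Longrightarrow> Poly_Mapping.keys (f x) \<subseteq> S) \<Longrightarrow> Poly_Mapping.keys (\<Sum>x\<in>A. f x) \<subseteq> S"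
  by (induction A rule: infinite_finite_induct) (simp_all add: keys_add_subset)

lemma scale_add: "scale c (p + r) = scale c p + scale c r"
  by (rule poly_mapping_eqI) (simp add: lookup_add algebra_simps)

lemma scale_zero [simp]: "scale c 0 = 0"
  by (rule poly_mapping_eqI) simp

lemma scale_single [simp]: "scale c (Poly_Mapping.single k d) = Poly_Mapping.single k (c * d)"
  by (rule poly_mapping_eqI) (simp add: lookup_single when_def)

lemma K_algebra_monoid_algebra:
  assumes "monoid M"
  shows "K_algebra (monoid_algebra M :: ('k::field, 'm \<Rightarrow>\<^sub>0 'k) module)"
proof -
  interpret M: monoid M by fact
  let ?R = "monoid_algebra M :: ('k::field, 'm \<Rightarrow>\<^sub>0 'k) module"
  note simps = monoid_algebra_mult_add_left monoid_algebra_mult_add_right monoid_algebra_mult_single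
  have assoc: "(p \<otimes>\<^bsub>?R\<^esub> r) \<otimes>\<^bsub>?R\<^esub> s = p \<otimes>\<^bsub>?R\<^esub> (r \<otimes>\<^bsub>?R\<^esub> s)"
    if "p \<in> carrier ?R" "r \<in> carrier ?R" "s \<in> carrier ?R" for p r s
  proof -
    \<comment> \<open>Additivity is used once for each factor: s is decomposed here, r in the next
      claim, and p at the end; on monomials the claim is associativity of M.\<close>
    have 1: "(Poly_Mapping.single u a \<otimes>\<^bsub>?R\<^esub> Poly_Mapping.single v b) \<otimes>\<^bsub>?R\<^esub> s
      = Poly_Mapping.single u a \<otimes>\<^bsub>?R\<^esub> (Poly_Mapping.single v b \<otimes>\<^bsub>?R\<^esub> s)"
      if "u \<in> carrier M" "v \<in> carrier M" "Poly_Mapping.keys s \<subseteq> carrier M" for u a v b s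
      using that(3)
      by (induction rule: keys_induct) (use that in \<open>simp_all add: simps M.m_assoc mult.assoc\<close>)
    have 2: "(Poly_Mapping.single u a \<otimes>\<^bsub>?R\<^esub> r) \<otimes>\<^bsub>?R\<^esub> s
      = Poly_Mapping.single u a \<otimes>\<^bsub>?R\<^esub> (r \<otimes>\<^bsub>?R\<^esub> s)"
      if "u \<in> carrier M" "Poly_Mapping.keys r \<subseteq> carrier M" "Poly_Mapping.keys s \<subseteq> carrier M" for u a r s
      using that(2)
      by (induction rule: keys_induct)
        (use that 1 in \<open>simp_all add: monoid_algebra_mult_add_left monoid_algebra_mult_add_right\<close>)
    from that have "Poly_Mapping.keys p \<subseteq> carrier M" by simp
    then show ?thesis
      by (induction rule: keys_induct)
        (use that 2 in \<open>simp_all add: monoid_algebra_mult_add_left monoid_algebra_mult_add_right\<close>)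
  qed
  have closed: "p \<otimes>\<^bsub>?R\<^esub> r \<in> carrier ?R" if "p \<in> carrier ?R" "r \<in> carrier ?R" for p r
    using that unfolding monoid_algebra_mult monoid_algebra_simps mem_Collect_eq
    by (intro keys_sum_subset) (auto split: if_splits)
  have l_one: "\<one>\<^bsub>?R\<^esub> \<otimes>\<^bsub>?R\<^esub> p = p" and r_one: "p \<otimes>\<^bsub>?R\<^esub> \<one>\<^bsub>?R\<^esub> = p" if "p \<in> carrier ?R" for p
    using that by (simp_all add: monoid_algebra_mult subset_iff sum_single_lookup)
  have scale: "scale c p \<otimes>\<^bsub>?R\<^esub> r = scale c (p \<otimes>\<^bsub>?R\<^esub> r)" "p \<otimes>\<^bsub>?R\<^esub> scale c r = scale c (p \<otimes>\<^bsub>?R\<^esub> r)"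
    for c p r
  proof -
    have 1: "scale c (Poly_Mapping.single u a) \<otimes>\<^bsub>?R\<^esub> r = scale c (Poly_Mapping.single u a \<otimes>\<^bsub>?R\<^esub> r)"
      "Poly_Mapping.single u a \<otimes>\<^bsub>?R\<^esub> scale c r = scale c (Poly_Mapping.single u a \<otimes>\<^bsub>?R\<^esub> r)" for u a r
      by (rule keys_induct[of r UNIV]; simp add: simps scale_add mult_ac)+
    show "scale c p \<otimes>\<^bsub>?R\<^esub> r = scale c (p \<otimes>\<^bsub>?R\<^esub> r)" "p \<otimes>\<^bsub>?R\<^esub> scale c r = scale c (p \<otimes>\<^bsub>?R\<^esub> r)"
      using 1 by (rule_tac[!] keys_induct[of p UNIV]) (simp_all add: monoid_algebra_mult_add_left scale_add)
  qed
  show ?thesis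
  proof (rule K_algebraI, goal_cases)
    case 13 then show ?case using keys_scale by fastforce
  next
    case 14 then show ?case by (auto intro!: poly_mapping_eqI simp: lookup_add algebra_simps)
  next
    case 16 then show ?case by (auto intro!: poly_mapping_eqI simp: algebra_simps)
  next
    case 17 then show ?case by (auto intro!: poly_mapping_eqI)
  next
    case 18 then show ?case by (auto intro!: poly_mapping_eqI)
  qed (use assoc closed l_one r_one scale in \<open>simp_all add: keys_add_subset ac_simps scale_add
      monoid_algebra_mult_add_left monoid_algebra_mult_add_right\<close>)
qed

subsection \<open>Quotients\<close>

context K_algebra
begin

context
  fixes J assumes J: "ideal J U"
begin

lemma quot_algebra_carrier: "carrier (quot_algebra U J) = (\<lambda>x. J +> x) ` carrier U"
  by (auto simp: quot_algebra_def FactRing_simps)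

lemma quot_algebra_one: "\<one>\<^bsub>quot_algebra U J\<^esub> = J +> \<one>"
  by (simp add: quot_algebra_def FactRing_def)

lemma quot_algebra_zero: "\<zero>\<^bsub>quot_algebra U J\<^esub> = J +> \<zero>"
  using J by (simp add: quot_algebra_def FactRing_def a_rcos_zero ideal.Icarr ideal.axioms(1)
      additive_subgroup.zero_closed)

lemma quot_algebra_add:
  "x \<in> carrier U \<Longrightarrow> y \<in> carrier U \<Longrightarrow> (J +> x) \<oplus>\<^bsub>quot_algebra U J\<^esub> (J +> y) = J +> (x \<oplus> y)"
  using ideal.a_rcos_sum[OF J] by (simp add: quot_algebra_def FactRing_def)

lemma quot_algebra_mult:
  "x \<in> carrier U \<Longrightarrow> y \<in> carrier U \<Longrightarrow> (J +> x) \<otimes>\<^bsub>quot_algebra U J\<^esub> (J +> y) = J +> (x \<otimes> y)"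
  using ideal.rcoset_mult_add[OF J] by (simp add: quot_algebra_def FactRing_def)

lemma ideal_smult: "x \<in> J \<Longrightarrow> c \<odot> x \<in> J"
  using ideal.I_l_closed[OF J, of x "c \<odot> \<one>"] ideal.Icarr[OF J, of x] by (simp add: smult_mult_left)

lemma coset_eq_iff:
  assumes "x \<in> carrier U" "y \<in> carrier U" shows "J +> x = J +> y \<longleftrightarrow> x \<ominus> y \<in> J"
  using quotient_eq_iff_same_a_r_cos[OF J assms] by simp

lemma mem_coset_iff:
  assumes "x \<in> carrier U" shows "y \<in> J +> x \<longleftrightarrow> y \<in> carrier U \<and> J +> y = J +> x"
proof -
  interpret J: ideal J U by (rule J)
  show ?thesis
    using J.a_rcos_self[of y] J.a_repr_independence'[of y x] J.a_elemrcos_carrier[of x y] assms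
    by blast
qed

text \<open>The scalar multiple is defined as a union of cosets over all representatives. An ideal
  is stable under scalars, since c x = (c 1) x, so these cosets coincide and the union is one of
  them.\<close>

lemma quot_algebra_smult:
  assumes "x \<in> carrier U"
  shows "c \<odot>\<^bsub>quot_algebra U J\<^esub> (J +> x) = J +> (c \<odot> x)"
proof -
  have "J +> (c \<odot> y) = J +> (c \<odot> x)" if "y \<in> J +> x" for y
  proof -
    have y: "y \<in> carrier U" "y \<ominus> x \<in> J"
      using that assms mem_coset_iff coset_eq_iff by auto
    then have "c \<odot> (y \<ominus> x) \<in> J" by (intro ideal_smult)
    then have "c \<odot> y \<ominus> c \<odot> x \<in> J"
      using y assms by (simp add: minus_eq minus_eq_smult smult_r_distr smult_smult mult.commute)
    then show ?thesis using y assms by (simp add: coset_eq_iff)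
  qed
  then have "(\<Union>y\<in>J +> x. J +> (c \<odot> y)) = (\<Union>y\<in>J +> x. J +> (c \<odot> x))"
    by (rule SUP_cong[OF refl])
  moreover have "x \<in> J +> x" using assms by (simp add: mem_coset_iff)
  then have "J +> x \<noteq> {}" by blast
  ultimately show ?thesis
    by (simp add: quot_algebra_def)
qed

lemmas quot_algebra_simps = quot_algebra_one quot_algebra_zero quot_algebra_add quot_algebra_mult
  quot_algebra_smult

lemma K_algebra_quot_algebra: "K_algebra (quot_algebra U J)"
proof (rule K_algebraI, goal_cases)
  case (4 x y)
  then obtain a b where "x = J +> a" "y = J +> b" "a \<in> carrier U" "b \<in> carrier U"
    by (auto simp: quot_algebra_carrier)
  then show ?case by (simp add: quot_algebra_add a_comm)
qed (auto simp: quot_algebra_carrier quot_algebra_simps a_assoc m_assoc l_distr r_distr smult_l_distr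
      smult_r_distr smult_smult smult_mult_left smult_mult_right)

lemma alg_hom_coset: "alg_hom U (quot_algebra U J) (\<lambda>x. J +> x)"
  by (auto simp: alg_hom_def ring_hom_def quot_algebra_carrier quot_algebra_simps)

end

lemma kernel_ideal:
  assumes "K_algebra V" "alg_hom U V h"
  shows "ideal {x \<in> carrier U. h x = \<zero>\<^bsub>V\<^esub>} U"
proof -
  interpret V: K_algebra V by fact
  have "ring_hom_ring U V h"
    using assms(2) by (intro ring_hom_ringI2 ring_axioms V.ring_axioms) (simp add: alg_hom_def)
  from ring_hom_ring.kernel_is_ideal[OF this] show ?thesis
    by (simp add: a_kernel_def')
qed

text \<open>The kernel of h is an ideal containing S, hence contains \<open>Idl S\<close>; so h is
  constant on cosets and the image of a coset is a singleton. This evaluates the coproduct and the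
  antipode, both defined through \<open>the_elem\<close>.\<close>

lemma the_elem_coset:
  assumes "K_algebra V" "alg_hom U V h" "S \<subseteq> carrier U" "\<And>x. x \<in> S \<Longrightarrow> h x = \<zero>\<^bsub>V\<^esub>" "x \<in> carrier U"
  shows "the_elem (h ` (Idl S +> x)) = h x"
proof -
  interpret V: K_algebra V by fact
  have J: "ideal (Idl S) U" using assms(3) by (rule genideal_ideal)
  have sub: "Idl S \<subseteq> {x \<in> carrier U. h x = \<zero>\<^bsub>V\<^esub>}"
    using assms by (intro genideal_minimal kernel_ideal) auto
  have "h y = h x" if "y \<in> Idl S +> x" for y
  proof -
    have y: "y \<in> carrier U" "y \<ominus> x \<in> Idl S"
      using that assms mem_coset_iff[OF J] coset_eq_iff[OF J] by auto
    have "h (y \<ominus> x) = h y \<oplus>\<^bsub>V\<^esub> (-1) \<odot>\<^bsub>V\<^esub> h x"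
      using y assms by (simp add: minus_eq minus_eq_smult alg_homD[OF assms(2)])
    moreover have "h (y \<ominus> x) = \<zero>\<^bsub>V\<^esub>" using y sub by auto
    ultimately have "h y \<ominus>\<^bsub>V\<^esub> h x = \<zero>\<^bsub>V\<^esub>"
      using V.minus_eq_smult[OF alg_homD(1)[OF assms(2) assms(5)]] by (metis V.minus_eq)
    then show ?thesis
      using V.r_right_minus_eq[of "h y" "h x"] alg_homD(1)[OF assms(2)] y(1) assms(5) by simp
  qed
  moreover have "x \<in> Idl S +> x" using assms by (simp add: mem_coset_iff[OF J])
  ultimately have "h ` (Idl S +> x) = {h x}" by blast
  then show ?thesis by simp
qed

end

subsection \<open>Tensor products\<close>

definition bilin :: "('k::field, 'u) module \<Rightarrow> ('k, 'v) module \<Rightarrow> ('u \<Rightarrow> 'v \<Rightarrow> 'k) \<Rightarrow> bool" where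
  "bilin U V f \<longleftrightarrow>
     (\<forall>x\<in>carrier U. \<forall>x'\<in>carrier U. \<forall>y\<in>carrier V. f (x \<oplus>\<^bsub>U\<^esub> x') y = f x y + f x' y) \<and>
     (\<forall>x\<in>carrier U. \<forall>y\<in>carrier V. \<forall>y'\<in>carrier V. f x (y \<oplus>\<^bsub>V\<^esub> y') = f x y + f x y') \<and>
     (\<forall>c. \<forall>x\<in>carrier U. \<forall>y\<in>carrier V. f (c \<odot>\<^bsub>U\<^esub> x) y = c * f x y \<and> f x (c \<odot>\<^bsub>V\<^esub> y) = c * f x y)"

locale K_algebra_pair = U: K_algebra U + V: K_algebra V
  for U :: "('k::field, 'u) module" and V :: "('k, 'v) module"
begin

abbreviation pairs :: "('k, 'u \<times> 'v \<Rightarrow>\<^sub>0 'k) module" where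
  "pairs \<equiv> monoid_algebra (U \<times>\<times> V)"

lemma monoid_pairs: "monoid (U \<times>\<times> V)"
  by (intro DirProd_monoid U.monoid_axioms V.monoid_axioms)

sublocale pairs: K_algebra pairs
  by (intro K_algebra_monoid_algebra monoid_pairs)

lemma bilinear_relators_closed: "bilinear_relators U V \<subseteq> carrier pairs"
  unfolding bilinear_relators_def
  by (auto simp: in_keys_iff lookup_minus lookup_single when_def split: if_splits)

lemma tensor_ideal: "ideal (tensor_ideal U V) pairs"
  unfolding tensor_ideal_def using bilinear_relators_closed by (rule pairs.genideal_ideal)

lemma K_algebra_tensor: "K_algebra (tensor_algebra U V)"
  unfolding tensor_algebra_def by (rule pairs.K_algebra_quot_algebra[OF tensor_ideal])

lemma alg_hom_tensor_class: "alg_hom pairs (tensor_algebra U V) (tensor_class U V)"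
  unfolding tensor_algebra_def tensor_class_def by (rule pairs.alg_hom_coset[OF tensor_ideal])

lemma tensor_class_eq_iff:
  assumes "s \<in> carrier pairs" "t \<in> carrier pairs"
  shows "tensor_class U V s = tensor_class U V t \<longleftrightarrow> s - t \<in> tensor_ideal U V"
proof -
  have "s \<ominus>\<^bsub>pairs\<^esub> t = s - t"
    using assms by (auto intro!: poly_mapping_eqI
      simp: pairs.minus_eq pairs.minus_eq_smult lookup_add lookup_minus)
  then show ?thesis
    unfolding tensor_class_def using pairs.coset_eq_iff[OF tensor_ideal assms] by simp
qed

lemma pure_tensor_closed [simp]:
  "x \<in> carrier U \<Longrightarrow> y \<in> carrier V \<Longrightarrow> pure_tensor U V x y \<in> carrier (tensor_algebra U V)"
  unfolding pure_tensor_def by (rule alg_homD(1)[OF alg_hom_tensor_class]) simp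

lemma tensor_class_relator:
  assumes "s \<in> carrier pairs" "t \<in> carrier pairs" "s - t \<in> bilinear_relators U V"
  shows "tensor_class U V s = tensor_class U V t"
  using pairs.genideal_self[OF bilinear_relators_closed] assms
  by (auto simp: tensor_class_eq_iff tensor_ideal_def)

lemma tensor_class_add:
  "s \<in> carrier pairs \<Longrightarrow> t \<in> carrier pairs \<Longrightarrow>
    tensor_class U V (s + t) = tensor_class U V s \<oplus>\<^bsub>tensor_algebra U V\<^esub> tensor_class U V t"
  using alg_homD(2)[OF alg_hom_tensor_class] by simp

lemma pure_tensor_add_left:
  assumes "x \<in> carrier U" "x' \<in> carrier U" "y \<in> carrier V"
  shows "pure_tensor U V (x \<oplus>\<^bsub>U\<^esub> x') y = pure_tensor U V x y \<oplus>\<^bsub>tensor_algebra U V\<^esub> pure_tensor U V x' y"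
  unfolding pure_tensor_def
proof (subst tensor_class_add[symmetric]; (intro tensor_class_relator)?)
  show "Poly_Mapping.single (x \<oplus>\<^bsub>U\<^esub> x', y) 1 - (Poly_Mapping.single (x, y) 1
      + Poly_Mapping.single (x', y) 1) \<in> bilinear_relators U V"
    unfolding bilinear_relators_def diff_diff_eq[symmetric] using assms by blast
qed (use assms in \<open>auto simp: in_keys_iff lookup_add lookup_single when_def split: if_splits\<close>)

lemma pure_tensor_add_right:
  assumes "x \<in> carrier U" "y \<in> carrier V" "y' \<in> carrier V"
  shows "pure_tensor U V x (y \<oplus>\<^bsub>V\<^esub> y') = pure_tensor U V x y \<oplus>\<^bsub>tensor_algebra U V\<^esub> pure_tensor U V x y'"
  unfolding pure_tensor_def
proof (subst tensor_class_add[symmetric]; (intro tensor_class_relator)?)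
  show "Poly_Mapping.single (x, y \<oplus>\<^bsub>V\<^esub> y') 1 - (Poly_Mapping.single (x, y) 1
      + Poly_Mapping.single (x, y') 1) \<in> bilinear_relators U V"
    unfolding bilinear_relators_def diff_diff_eq[symmetric] using assms by blast
qed (use assms in \<open>auto simp: in_keys_iff lookup_add lookup_single when_def split: if_splits\<close>)

lemma tensor_class_single:
  assumes "x \<in> carrier U" "y \<in> carrier V"
  shows "tensor_class U V (Poly_Mapping.single (x, y) c) = c \<odot>\<^bsub>tensor_algebra U V\<^esub> pure_tensor U V x y"
  unfolding pure_tensor_def
  using alg_homD(5)[OF alg_hom_tensor_class, of "Poly_Mapping.single (x, y) 1" c] assms by simp

lemma pure_tensor_smult_left:
  assumes "x \<in> carrier U" "y \<in> carrier V"
  shows "pure_tensor U V (c \<odot>\<^bsub>U\<^esub> x) y = c \<odot>\<^bsub>tensor_algebra U V\<^esub> pure_tensor U V x y"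
  unfolding tensor_class_single[OF assms, symmetric] unfolding pure_tensor_def using assms
  by (intro tensor_class_relator) (auto simp: bilinear_relators_def)

lemma pure_tensor_smult_right:
  assumes "x \<in> carrier U" "y \<in> carrier V"
  shows "pure_tensor U V x (c \<odot>\<^bsub>V\<^esub> y) = c \<odot>\<^bsub>tensor_algebra U V\<^esub> pure_tensor U V x y"
  unfolding tensor_class_single[OF assms, symmetric] unfolding pure_tensor_def using assms
  by (intro tensor_class_relator) (auto simp: bilinear_relators_def)

lemma pure_tensor_mult:
  assumes "x \<in> carrier U" "x' \<in> carrier U" "y \<in> carrier V" "y' \<in> carrier V"
  shows "pure_tensor U V x y \<otimes>\<^bsub>tensor_algebra U V\<^esub> pure_tensor U V x' y'
    = pure_tensor U V (x \<otimes>\<^bsub>U\<^esub> x') (y \<otimes>\<^bsub>V\<^esub> y')"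
  unfolding pure_tensor_def using assms
  by (subst alg_homD(3)[OF alg_hom_tensor_class, symmetric])
    (simp_all add: monoid_algebra_mult_single)

lemma one_tensor: "\<one>\<^bsub>tensor_algebra U V\<^esub> = pure_tensor U V \<one>\<^bsub>U\<^esub> \<one>\<^bsub>V\<^esub>"
  unfolding pure_tensor_def using alg_homD(4)[OF alg_hom_tensor_class] by simp

text \<open>The common kernel of all functionals induced by bilinear maps is stable under
  multiplication by basis elements, because \<open>f (u \<otimes> _) (v \<otimes> _)\<close> is again bilinear.\<close>

lemma lin_tensor_ideal:
  assumes "s \<in> tensor_ideal U V" "bilin U V f"
  shows "lin (\<lambda>(x, y). f x y) s = 0"
proof -
  define Z where "Z = {s \<in> carrier pairs. \<forall>f. bilin U V f \<longrightarrow> lin (\<lambda>(x, y). f x y) s = 0}"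
  have mult_l: "r \<otimes>\<^bsub>pairs\<^esub> s \<in> Z" and mult_r: "s \<otimes>\<^bsub>pairs\<^esub> r \<in> Z"
    if s: "s \<in> Z" and r: "r \<in> carrier pairs" for r s
  proof -
    have "lin (\<lambda>(x, y). f x y) (r \<otimes>\<^bsub>pairs\<^esub> s) = 0 \<and> lin (\<lambda>(x, y). f x y) (s \<otimes>\<^bsub>pairs\<^esub> r) = 0"
      if f: "bilin U V f" for f
    proof -
      have "Poly_Mapping.keys r \<subseteq> carrier (U \<times>\<times> V)" using r by simp
      then show ?thesis
      proof (induction rule: keys_induct)
        case (add k c p)
        obtain u v where k: "k = (u, v)" "u \<in> carrier U" "v \<in> carrier V" using add(1) by auto
        have sub: "Poly_Mapping.keys s \<subseteq> carrier (U \<times>\<times> V)" using s by (simp add: Z_def)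
        have "lin (\<lambda>(x, y). f x y) (Poly_Mapping.single k c \<otimes>\<^bsub>pairs\<^esub> s)
          = c * lin (\<lambda>(x, y). f (u \<otimes>\<^bsub>U\<^esub> x) (v \<otimes>\<^bsub>V\<^esub> y)) s"
          "lin (\<lambda>(x, y). f x y) (s \<otimes>\<^bsub>pairs\<^esub> Poly_Mapping.single k c)
          = c * lin (\<lambda>(x, y). f (x \<otimes>\<^bsub>U\<^esub> u) (y \<otimes>\<^bsub>V\<^esub> v)) s"
          using sub by (induction rule: keys_induct)
            (use k in \<open>auto simp: monoid_algebra_mult_add_right monoid_algebra_mult_add_left
              monoid_algebra_mult_single algebra_simps\<close>)
        moreover have "bilin U V (\<lambda>x y. f (u \<otimes>\<^bsub>U\<^esub> x) (v \<otimes>\<^bsub>V\<^esub> y))"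
          "bilin U V (\<lambda>x y. f (x \<otimes>\<^bsub>U\<^esub> u) (y \<otimes>\<^bsub>V\<^esub> v))"
          using f k by (simp_all add: bilin_def U.r_distr U.l_distr V.r_distr V.l_distr
            U.smult_mult_right V.smult_mult_right U.smult_mult_left V.smult_mult_left)
        ultimately have "lin (\<lambda>(x, y). f x y) (Poly_Mapping.single k c \<otimes>\<^bsub>pairs\<^esub> s) = 0"
          "lin (\<lambda>(x, y). f x y) (s \<otimes>\<^bsub>pairs\<^esub> Poly_Mapping.single k c) = 0"
          using s by (simp_all add: Z_def)
        then show ?case using add
          by (simp add: monoid_algebra_mult_add_left monoid_algebra_mult_add_right)
      qed simp
    qed
    then show "r \<otimes>\<^bsub>pairs\<^esub> s \<in> Z" "s \<otimes>\<^bsub>pairs\<^esub> r \<in> Z"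
      using s r pairs.m_closed[of r s] pairs.m_closed[of s r] by (auto simp: Z_def)
  qed
  have "ideal Z pairs"
  proof (rule idealI[OF pairs.ring_axioms])
    show "subgroup Z (add_monoid pairs)"
    proof (rule group.subgroupI[OF pairs.a_group])
      fix s assume s: "s \<in> Z"
      then have c: "s \<in> carrier pairs" by (simp add: Z_def)
      have "\<ominus>\<^bsub>pairs\<^esub> s = scale (-1) s" using pairs.minus_eq_smult[OF c] by simp
      then have "\<ominus>\<^bsub>pairs\<^esub> s \<in> Z" using s pairs.a_inv_closed[OF c] by (simp add: Z_def)
      then show "inv\<^bsub>add_monoid pairs\<^esub> s \<in> Z" by (simp add: a_inv_def)
    next
      have "0 \<in> Z" by (simp add: Z_def)
      then show "Z \<noteq> {}" by blast
    next
      fix s t assume "s \<in> Z" "t \<in> Z"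
      then show "s \<otimes>\<^bsub>add_monoid pairs\<^esub> t \<in> Z"
        using keys_add_subset[of s "carrier (U \<times>\<times> V)" t] by (simp add: Z_def)
    qed (simp add: Z_def Collect_mono)
  qed (use mult_l mult_r in auto)
  moreover have "bilinear_relators U V \<subseteq> Z"
  proof
    fix s assume s: "s \<in> bilinear_relators U V"
    then have "lin (\<lambda>(x, y). f x y) s = 0" if "bilin U V f" for f
      using that unfolding bilinear_relators_def bilin_def by auto
    then show "s \<in> Z" using s bilinear_relators_closed by (auto simp: Z_def)
  qed
  ultimately have "tensor_ideal U V \<subseteq> Z"
    unfolding tensor_ideal_def by (rule pairs.genideal_minimal)
  then show ?thesis using assms by (auto simp: Z_def)
qed

end

subsection \<open>The pairing of tensors\<close>

definition subspace_of :: "('k::field, 'u) module \<Rightarrow> 'u set \<Rightarrow> bool" where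
  "subspace_of U G \<longleftrightarrow> G \<subseteq> carrier U \<and> \<zero>\<^bsub>U\<^esub> \<in> G \<and> (\<forall>x\<in>G. \<forall>y\<in>G. x \<oplus>\<^bsub>U\<^esub> y \<in> G) \<and> (\<forall>c. \<forall>x\<in>G. c \<odot>\<^bsub>U\<^esub> x \<in> G)"

definition linear_image :: "('k::field, 'u) module \<Rightarrow> (('a \<Rightarrow>\<^sub>0 'k) \<Rightarrow> 'u) \<Rightarrow> bool" where
  "linear_image U h \<longleftrightarrow> range h = carrier U \<and> (\<forall>p r. h (p + r) = h p \<oplus>\<^bsub>U\<^esub> h r) \<and>
     (\<forall>c p. h (scale c p) = c \<odot>\<^bsub>U\<^esub> h p)"

lemma vector_space_scale: "vector_space (scale :: 'k::field \<Rightarrow> ('a \<Rightarrow>\<^sub>0 'k) \<Rightarrow> _)"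
  by unfold_locales (auto intro!: poly_mapping_eqI simp: lookup_add algebra_simps)

text \<open>U is a carrier set rather than a type, so h transports the problem to the vector space
  of formal combinations. A projection onto W = h^-1(G) descends along h because W contains the
  kernel of h.\<close>

lemma (in K_algebra) exists_projection:
  fixes h :: "('a \<Rightarrow>\<^sub>0 'k) \<Rightarrow> 'u"
  assumes h: "linear_image U h" and G: "subspace_of U G"
  obtains pr where "\<And>x. x \<in> carrier U \<Longrightarrow> pr x \<in> G" "\<And>x. x \<in> G \<Longrightarrow> pr x = x"
    "\<And>x y. x \<in> carrier U \<Longrightarrow> y \<in> carrier U \<Longrightarrow> pr (x \<oplus> y) = pr x \<oplus> pr y"
    "\<And>c x. x \<in> carrier U \<Longrightarrow> pr (c \<odot> x) = c \<odot> pr x"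
proof -
  interpret vs: vector_space "scale :: 'k \<Rightarrow> ('a \<Rightarrow>\<^sub>0 'k) \<Rightarrow> _" by (rule vector_space_scale)
  interpret vp: vector_space_pair "scale :: 'k \<Rightarrow> ('a \<Rightarrow>\<^sub>0 'k) \<Rightarrow> _" "scale :: 'k \<Rightarrow> ('a \<Rightarrow>\<^sub>0 'k) \<Rightarrow> _"
    by unfold_locales
  have h_add: "h (p + r) = h p \<oplus> h r" and h_scale: "h (scale c p) = c \<odot> h p" and
    h_closed: "h p \<in> carrier U" for c p r
    using h by (auto simp: linear_image_def)
  have h0: "h 0 = \<zero>" using h_scale[of 0 0] h_closed by simp
  define W where "W = {p. h p \<in> G}"
  have W: "vs.subspace W"
    using G by (auto simp: vs.subspace_def W_def h0 h_add h_scale subspace_of_def)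
  have "Vector_Spaces.linear scale scale (\<lambda>p :: 'a \<Rightarrow>\<^sub>0 'k. p)"
    by (rule vs.linear_ident)
  \<comment> \<open>A linear left inverse, with range in W, of the identity restricted to W is a
    projection onto W.\<close>
  from vp.linear_exists_left_inverse_on[OF this W] obtain g where g: "range g \<subseteq> W"
    "Vector_Spaces.linear scale scale g" "\<And>v. v \<in> W \<Longrightarrow> g v = v"
    by (auto simp: inj_on_def)
  interpret g: Vector_Spaces.linear scale scale g by (rule g)
  define r where "r = (\<lambda>x. SOME p. h p = x)"
  have r: "h (r x) = x" if "x \<in> carrier U" for x
  proof -
    have "\<exists>p. h p = x" using that h unfolding linear_image_def by (metis imageE)
    then show ?thesis unfolding r_def by (rule someI_ex)
  qed
  \<comment> \<open>Two preimages of one element differ by an element of the kernel of h; it lies in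
    W, so g fixes it and h sends it to 0.\<close>
  have hg: "h (g p) = h (g p')" if "h p = h p'" for p p'
  proof -
    have "h (p - p') \<oplus> h p' = h p" using h_add[of "p - p'" p'] by simp
    then have z: "h (p - p') = \<zero>"
      using that h_closed[of "p - p'"] h_closed[of p'] by (simp add: add.r_cancel_one)
    then have "p - p' \<in> W" using G by (simp add: W_def subspace_of_def)
    then have "g p = g p' + (p - p')" using g(3)[of "p - p'"] g.diff[of p p'] by (simp add: algebra_simps)
    then show ?thesis using z h_closed by (simp add: h_add)
  qed
  show thesis
  proof (rule that[of "\<lambda>x. h (g (r x))"])
    show "h (g (r x)) \<in> G" for x using g(1) by (auto simp: W_def)
    show "h (g (r x)) = x" if "x \<in> G" for x
    proof -
      have "h (r x) = x" using r that G by (auto simp: subspace_of_def)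
      then show ?thesis using g(3)[of "r x"] that by (simp add: W_def)
    qed
    show "h (g (r (x \<oplus> y))) = h (g (r x)) \<oplus> h (g (r y))" if "x \<in> carrier U" "y \<in> carrier U" for x y
      unfolding h_add[symmetric] g.add[symmetric]
      by (rule hg) (use that r in \<open>simp add: h_add\<close>)
    show "h (g (r (c \<odot> x))) = c \<odot> h (g (r x))" if "x \<in> carrier U" for x c
      unfolding h_scale[symmetric] g.scale[symmetric]
      by (rule hg) (use that r in \<open>simp add: h_scale\<close>)
  qed
qed

lemma (in K_algebra) tensor_pairing_eq:
  fixes h :: "('a \<Rightarrow>\<^sub>0 'k) \<Rightarrow> 'u"
  assumes h: "linear_image U h" and G: "subspace_of U G" and H: "subspace_of U H"
    and P: "bilinear_on U G H P"
    and s: "Poly_Mapping.keys s \<subseteq> G \<times> G" and t: "Poly_Mapping.keys t \<subseteq> H \<times> H"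
  shows "tensor_pairing G H P (tensor_class U U s) (tensor_class U U t)
    = lin (\<lambda>(y, y'). lin (\<lambda>(x, x'). P y x * P y' x') t) s"
proof -
  interpret UU: K_algebra_pair U U by unfold_locales
  obtain pG where pG: "\<And>x. x \<in> carrier U \<Longrightarrow> pG x \<in> G" "\<And>x. x \<in> G \<Longrightarrow> pG x = x"
    "\<And>x y. x \<in> carrier U \<Longrightarrow> y \<in> carrier U \<Longrightarrow> pG (x \<oplus> y) = pG x \<oplus> pG y"
    "\<And>c x. x \<in> carrier U \<Longrightarrow> pG (c \<odot> x) = c \<odot> pG x"
    by (rule exists_projection[OF h G]) (rule that; assumption)
  obtain pH where pH: "\<And>x. x \<in> carrier U \<Longrightarrow> pH x \<in> H" "\<And>x. x \<in> H \<Longrightarrow> pH x = x"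
    "\<And>x y. x \<in> carrier U \<Longrightarrow> y \<in> carrier U \<Longrightarrow> pH (x \<oplus> y) = pH x \<oplus> pH y"
    "\<And>c x. x \<in> carrier U \<Longrightarrow> pH (c \<odot> x) = c \<odot> pH x"
    by (rule exists_projection[OF h H]) (rule that; assumption)
  define P' where "P' = (\<lambda>y x. P (pG y) (pH x))"
  have P'_eq: "P' y x = P y x" if "y \<in> G" "x \<in> H" for y x using that by (simp add: P'_def pG pH)
  have P': "P' (y \<oplus> y') x = P' y x + P' y' x" "P' y (x \<oplus> x') = P' y x + P' y x'"
    "P' (c \<odot> y) x = c * P' y x" "P' y (c \<odot> x) = c * P' y x"
    if "y \<in> carrier U" "y' \<in> carrier U" "x \<in> carrier U" "x' \<in> carrier U" for y y' x x' c
    using P that pG(1) pH(1) by (simp_all add: P'_def pG(3,4) pH(3,4) bilinear_on_def)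
  define B where "B = (\<lambda>s t. lin (\<lambda>(y, y'). lin (\<lambda>(x, x'). P' y x * P' y' x') t) s)"
  have val: "(\<Sum>(y, y')\<in>Poly_Mapping.keys s. \<Sum>(x, x')\<in>Poly_Mapping.keys t.
      Poly_Mapping.lookup s (y, y') * Poly_Mapping.lookup t (x, x') * (P y x * P y' x')) = B s t"
    "lin (\<lambda>(y, y'). lin (\<lambda>(x, x'). P y x * P y' x') t) s = B s t"
    if "Poly_Mapping.keys s \<subseteq> G \<times> G" "Poly_Mapping.keys t \<subseteq> H \<times> H" for s t
  proof -
    show eq: "lin (\<lambda>(y, y'). lin (\<lambda>(x, x'). P y x * P y' x') t) s = B s t"
      unfolding B_def by (intro lin_cong) (use that in \<open>auto intro!: lin_cong simp: P'_eq subset_iff\<close>)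
    show "(\<Sum>(y, y')\<in>Poly_Mapping.keys s. \<Sum>(x, x')\<in>Poly_Mapping.keys t.
      Poly_Mapping.lookup s (y, y') * Poly_Mapping.lookup t (x, x') * (P y x * P y' x')) = B s t"
      unfolding eq[symmetric] by (simp add: lin_def case_prod_unfold sum_distrib_left mult.assoc)
  qed
  have t_lin: "lin (\<lambda>(x, x'). P' (y \<oplus> z) x * P' y' x') t
      = lin (\<lambda>(x, x'). P' y x * P' y' x') t + lin (\<lambda>(x, x'). P' z x * P' y' x') t"
    "lin (\<lambda>(x, x'). P' y' x * P' (y \<oplus> z) x') t
      = lin (\<lambda>(x, x'). P' y' x * P' y x') t + lin (\<lambda>(x, x'). P' y' x * P' z x') t"
    "lin (\<lambda>(x, x'). P' (c \<odot> y) x * P' y' x') t = c * lin (\<lambda>(x, x'). P' y x * P' y' x') t"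
    "lin (\<lambda>(x, x'). P' y' x * P' (c \<odot> y) x') t = c * lin (\<lambda>(x, x'). P' y' x * P' y x') t"
    if "Poly_Mapping.keys t \<subseteq> carrier U \<times> carrier U" "y \<in> carrier U" "z \<in> carrier U" "y' \<in> carrier U"
    for t c y z y'
    unfolding lin_add_fun[symmetric] lin_mult_fun[symmetric]
    by (rule_tac[!] lin_cong) (use that in \<open>auto simp: P' algebra_simps subset_iff\<close>)
  \<comment> \<open>For fixed t the extended expression is bilinear in the two components of s, so
    it vanishes on a difference lying in the tensor ideal.\<close>
  have B_s: "B s t = B s' t"
    if "tensor_class U U s = tensor_class U U s'" "s \<in> carrier UU.pairs" "s' \<in> carrier UU.pairs"
      "t \<in> carrier UU.pairs" for s s' t
  proof -
    have "bilin U U (\<lambda>y y'. lin (\<lambda>(x, x'). P' y x * P' y' x') t)"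
      using that(4) by (auto simp: bilin_def t_lin)
    from UU.lin_tensor_ideal[OF _ this, of "s - s'"] show ?thesis
      using that UU.tensor_class_eq_iff[of s s'] by (simp add: B_def)
  qed
  have B_t: "B s t = B s t'"
    if "tensor_class U U t = tensor_class U U t'" "t \<in> carrier UU.pairs" "t' \<in> carrier UU.pairs"
      "s \<in> carrier UU.pairs" for s t t'
  proof -
    have "lin (\<lambda>(x, x'). P' y x * P' y' x') t = lin (\<lambda>(x, x'). P' y x * P' y' x') t'"
      if "y \<in> carrier U" "y' \<in> carrier U" for y y'
    proof -
      have "bilin U U (\<lambda>x x'. P' y x * P' y' x')"
        using that by (auto simp: bilin_def P' algebra_simps)
      from UU.lin_tensor_ideal[OF _ this, of "t - t'"] show ?thesis
        using \<open>tensor_class U U t = tensor_class U U t'\<close> \<open>t \<in> carrier UU.pairs\<close> \<open>t' \<in> carrier UU.pairs\<close>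
          UU.tensor_class_eq_iff[of t t'] by simp
    qed
    then show ?thesis unfolding B_def
      by (intro lin_cong) (use that in \<open>auto simp: subset_iff\<close>)
  qed
  have sub: "r \<in> carrier UU.pairs" if "Poly_Mapping.keys r \<subseteq> K \<times> K" "subspace_of U K" for r K
    using that by (auto simp: subspace_of_def)
  have class_cong: "tensor_class U U s' = tensor_class U U s"
    if "s' \<in> tensor_class U U s" "s \<in> carrier UU.pairs" for s s'
    using that UU.pairs.mem_coset_iff[OF UU.tensor_ideal, of s s'] by (simp add: tensor_class_def)
  have self: "s \<in> tensor_class U U s" if "s \<in> carrier UU.pairs" for s
    using that UU.pairs.mem_coset_iff[OF UU.tensor_ideal, of s s] by (simp add: tensor_class_def)
  have "{(\<Sum>(y, y')\<in>Poly_Mapping.keys s'. \<Sum>(x, x')\<in>Poly_Mapping.keys t'.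
        Poly_Mapping.lookup s' (y, y') * Poly_Mapping.lookup t' (x, x') * (P y x * P y' x')) | s' t'.
      s' \<in> tensor_class U U s \<and> Poly_Mapping.keys s' \<subseteq> G \<times> G \<and>
      t' \<in> tensor_class U U t \<and> Poly_Mapping.keys t' \<subseteq> H \<times> H} = {B s t}" (is "?L = _")
  proof (intro equalityI subsetI)
    fix b assume "b \<in> ?L"
    then obtain s' t' where b: "b = B s' t'" and s': "s' \<in> tensor_class U U s" "Poly_Mapping.keys s' \<subseteq> G \<times> G"
      and t': "t' \<in> tensor_class U U t" "Poly_Mapping.keys t' \<subseteq> H \<times> H"
      using val by auto
    have "B s' t' = B s t'"
      using class_cong[OF s'(1)] sub[OF s G] sub[OF s'(2) G] sub[OF t'(2) H] by (intro B_s) auto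
    also have "\<dots> = B s t"
      using class_cong[OF t'(1)] sub[OF t H] sub[OF s G] sub[OF t'(2) H] by (intro B_t) auto
    finally show "b \<in> {B s t}" using b by simp
  next
    fix b assume "b \<in> {B s t}"
    then have "b = B s t" by simp
    then show "b \<in> ?L"
      unfolding mem_Collect_eq using val(1)[OF s t] s t self[OF sub[OF s G]] self[OF sub[OF t H]]
      by (intro exI[of _ s] exI[of _ t]) simp
  qed
  then show ?thesis
    unfolding tensor_pairing_def using val(2)[OF s t] by simp
qed

subsection \<open>Free algebras\<close>

lemma monoid_word: "monoid word_monoid"
  by unfold_locales (simp_all add: word_monoid_def)

global_interpretation FA: K_algebra "free_algebra :: ('k::field, 'g list \<Rightarrow>\<^sub>0 'k) module"
  by (intro K_algebra_monoid_algebra monoid_word)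

lemma word_monoid_simps [simp]:
  "carrier word_monoid = UNIV" "\<one>\<^bsub>word_monoid\<^esub> = []" "u \<otimes>\<^bsub>word_monoid\<^esub> v = u @ v"
  by (simp_all add: word_monoid_def)

lemma free_mult_word [simp]: "word a u \<otimes>\<^bsub>free_algebra\<^esub> word b v = word (a * b) (u @ v)"
  by (simp add: monoid_algebra_mult_single)

lemma free_minus: "p \<ominus>\<^bsub>free_algebra\<^esub> r = p - r"
  by (intro poly_mapping_eqI)
    (simp add: FA.minus_eq FA.minus_eq_smult lookup_add lookup_minus)

lemma free_uminus: "\<ominus>\<^bsub>free_algebra\<^esub> r = - r"
  by (intro poly_mapping_eqI) (simp add: FA.minus_eq_smult)

context K_algebra
begin

definition word_image :: "('g \<Rightarrow> 'u) \<Rightarrow> 'g list \<Rightarrow> 'u" where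
  "word_image \<phi> w = foldr (\<lambda>g b. \<phi> g \<otimes> b) w \<one>"

context
  fixes \<phi> :: "'g \<Rightarrow> 'u"
  assumes \<phi>: "\<And>g. \<phi> g \<in> carrier U"
begin

lemma word_image_closed [simp]: "word_image \<phi> w \<in> carrier U"
  by (induction w) (simp_all add: word_image_def \<phi>)

lemma word_image_append: "word_image \<phi> (u @ v) = word_image \<phi> u \<otimes> word_image \<phi> v"
proof (induction u)
  case Nil
  then show ?case using word_image_closed[of v] by (simp add: word_image_def)
next
  case (Cons g u)
  then show ?case using word_image_closed[of v] word_image_closed[of u] \<phi>
    by (simp add: word_image_def m_assoc)
qed

lemma free_lift_superset:
  assumes "finite S" "Poly_Mapping.keys p \<subseteq> S"
  shows "free_lift U \<phi> p = (\<Oplus>w\<in>S. Poly_Mapping.lookup p w \<odot> word_image \<phi> w)"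
  unfolding free_lift_def word_image_def[symmetric]
  by (rule add.finprod_mono_neutral_cong_left) (use assms in \<open>auto simp: in_keys_iff\<close>)

lemma free_lift_closed [simp]: "free_lift U \<phi> p \<in> carrier U"
  by (simp add: free_lift_superset[of "Poly_Mapping.keys p" p] finsum_closed)

lemma free_lift_add: "free_lift U \<phi> (p + r) = free_lift U \<phi> p \<oplus> free_lift U \<phi> r"
  using Poly_Mapping.keys_add[of p r]
  by (simp add: free_lift_superset[of "Poly_Mapping.keys p \<union> Poly_Mapping.keys r"] lookup_add
    smult_l_distr finsum_addf)

lemma free_lift_word: "free_lift U \<phi> (word c w) = c \<odot> word_image \<phi> w"
  by (simp add: free_lift_superset[of "{w}"])

lemma free_lift_zero: "free_lift U \<phi> 0 = \<zero>"
  by (simp add: free_lift_superset[of "{}"])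

lemma alg_hom_free_lift: "alg_hom free_algebra U (free_lift U \<phi>)"
proof -
  have mult: "free_lift U \<phi> (p \<otimes>\<^bsub>free_algebra\<^esub> r) = free_lift U \<phi> p \<otimes> free_lift U \<phi> r" for p r
  proof -
    have 1: "free_lift U \<phi> (word a u \<otimes>\<^bsub>free_algebra\<^esub> r) = free_lift U \<phi> (word a u) \<otimes> free_lift U \<phi> r" for a u
      by (rule keys_induct[of r UNIV])
        (simp_all add: free_lift_zero monoid_algebra_mult_add_right free_lift_add r_distr
          free_lift_word word_image_append smult_mult_left smult_mult_right smult_smult mult.commute)
    show ?thesis
      by (rule keys_induct[of p UNIV])
        (simp_all add: free_lift_zero monoid_algebra_mult_add_left free_lift_add l_distr 1)
  qed
  have "free_lift U \<phi> (scale c p) = c \<odot> free_lift U \<phi> p" for c p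
    by (rule keys_induct[of p UNIV])
      (simp_all add: free_lift_zero scale_add free_lift_add smult_r_distr free_lift_word smult_smult)
  moreover have "free_lift U \<phi> (word 1 []) = \<one>"
    by (simp add: free_lift_word) (simp add: word_image_def)
  ultimately show ?thesis
    unfolding alg_hom_def by (auto intro!: ring_hom_memI simp: mult free_lift_add)
qed

end

end

lemma free_mult_add:
  "(p + p') \<otimes>\<^bsub>free_algebra\<^esub> r = p \<otimes>\<^bsub>free_algebra\<^esub> r + p' \<otimes>\<^bsub>free_algebra\<^esub> r"
  "p \<otimes>\<^bsub>free_algebra\<^esub> (r + r') = p \<otimes>\<^bsub>free_algebra\<^esub> r + p \<otimes>\<^bsub>free_algebra\<^esub> r'"
  by (rule monoid_algebra_mult_add_left monoid_algebra_mult_add_right)+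

subsection \<open>Iterated q-commutators\<close>

context K_algebra
begin

definition qcomm :: "'u \<Rightarrow> 'k \<Rightarrow> 'u \<Rightarrow> 'u" where
  "qcomm x c z = x \<otimes> z \<oplus> (- c) \<odot> (z \<otimes> x)"

text \<open>Parameters are consumed from the right: the last entry of the list is the innermost
  commutator.\<close>

fun qcomms :: "'u \<Rightarrow> 'k list \<Rightarrow> 'u \<Rightarrow> 'u" where
  "qcomms x [] y = y"
| "qcomms x (c # cs) y = qcomm x c (qcomms x cs y)"

lemma qcomm_closed [simp]: "x \<in> carrier U \<Longrightarrow> z \<in> carrier U \<Longrightarrow> qcomm x c z \<in> carrier U"
  by (simp add: qcomm_def)

lemma qcomms_closed [simp]: "x \<in> carrier U \<Longrightarrow> y \<in> carrier U \<Longrightarrow> qcomms x cs y \<in> carrier U"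
  by (induction cs) simp_all

text \<open>A q-commutator is a linear combination of left and right multiplication by x, and these
  two commute. Hence the order of the parameters is immaterial.\<close>

lemma qcomm_commute:
  assumes "x \<in> carrier U" "z \<in> carrier U"
  shows "qcomm x c (qcomm x d z) = qcomm x d (qcomm x c z)"
proof -
  have "qcomm x c (qcomm x d z)
      = x \<otimes> (x \<otimes> z) \<oplus> (((- d) \<odot> (x \<otimes> (z \<otimes> x)) \<oplus> (- c) \<odot> (x \<otimes> (z \<otimes> x))) \<oplus> (c * d) \<odot> (z \<otimes> (x \<otimes> x)))" for c d
    using assms by (simp add: qcomm_def r_distr l_distr smult_r_distr smult_mult_left smult_mult_right
      smult_smult m_assoc a_assoc)
  then show ?thesis using assms by (simp add: a_comm mult.commute)
qed

lemma qcomms_snoc: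
  assumes "x \<in> carrier U" "y \<in> carrier U"
  shows "qcomms x (cs @ [c]) y = qcomm x c (qcomms x cs y)"
  using assms by (induction cs) (simp_all add: qcomm_commute)

lemma qcomms_rev:
  assumes "x \<in> carrier U" "y \<in> carrier U"
  shows "qcomms x (rev cs) y = qcomms x cs y"
  using assms by (induction cs) (simp_all add: qcomms_snoc)

lemma qcomms_add_right:
  assumes "x \<in> carrier U" "y \<in> carrier U" "y' \<in> carrier U"
  shows "qcomms x cs (y \<oplus> y') = qcomms x cs y \<oplus> qcomms x cs y'"
proof (induction cs)
  case (Cons c cs)
  then show ?case using assms
    by (simp add: qcomm_def r_distr l_distr smult_r_distr a_ac)
qed simp

lemma qcomm_add_left:
  assumes "x \<in> carrier U" "x' \<in> carrier U" "z \<in> carrier U"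
  shows "qcomm (x \<oplus> x') c z = qcomm x c z \<oplus> qcomm x' c z"
  using assms by (simp add: qcomm_def r_distr l_distr smult_r_distr a_ac)

text \<open>Every monomial of the iterated commutator contains x once per parameter and y once, so
  moving g across it costs one \<alpha> for each x and one \<beta>.\<close>

lemma qcomms_commute_right:
  assumes [simp]: "x \<in> carrier U" "y \<in> carrier U" "g \<in> carrier U"
    and x: "x \<otimes> g = \<alpha> \<odot> (g \<otimes> x)" and y: "y \<otimes> g = \<beta> \<odot> (g \<otimes> y)"
  shows "qcomms x cs y \<otimes> g = (\<alpha> ^ length cs * \<beta>) \<odot> (g \<otimes> qcomms x cs y)"
proof (induction cs)
  case (Cons c cs)
  let ?z = "qcomms x cs y"
  have "x \<otimes> ?z \<otimes> g = (\<alpha> ^ length cs * \<beta> * \<alpha>) \<odot> (g \<otimes> (x \<otimes> ?z))"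
    by (simp add: m_assoc Cons smult_mult_right) (simp add: m_assoc[symmetric] x smult_mult_left smult_smult)
  moreover have "?z \<otimes> x \<otimes> g = (\<alpha> ^ length cs * \<beta> * \<alpha>) \<odot> (g \<otimes> (?z \<otimes> x))"
    by (simp add: m_assoc x smult_mult_right) (simp add: m_assoc[symmetric] Cons smult_mult_left smult_smult mult_ac)
  ultimately show ?case
    by (simp add: qcomm_def r_distr l_distr smult_r_distr smult_smult smult_mult_left smult_mult_right mult_ac)
qed (simp add: y)

lemma qcomms_commute_left:
  assumes [simp]: "x \<in> carrier U" "y \<in> carrier U" "g \<in> carrier U"
    and x: "g \<otimes> x = \<alpha> \<odot> (x \<otimes> g)" and y: "g \<otimes> y = \<beta> \<odot> (y \<otimes> g)"
  shows "g \<otimes> qcomms x cs y = (\<alpha> ^ length cs * \<beta>) \<odot> (qcomms x cs y \<otimes> g)"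
proof (induction cs)
  case (Cons c cs)
  let ?z = "qcomms x cs y"
  have "g \<otimes> (x \<otimes> ?z) = (\<alpha> ^ length cs * \<beta> * \<alpha>) \<odot> (x \<otimes> ?z \<otimes> g)"
    by (simp add: m_assoc[symmetric] x smult_mult_left) (simp add: m_assoc Cons smult_mult_right smult_smult mult_ac)
  moreover have "g \<otimes> (?z \<otimes> x) = (\<alpha> ^ length cs * \<beta> * \<alpha>) \<odot> (?z \<otimes> x \<otimes> g)"
    by (simp add: m_assoc[symmetric] Cons smult_mult_left) (simp add: m_assoc x smult_mult_right smult_smult mult_ac)
  ultimately show ?case
    by (simp add: qcomm_def r_distr l_distr smult_r_distr smult_smult smult_mult_left smult_mult_right mult_ac)
qed (simp add: y)

lemma qcomm_eq_zero:
  assumes "x \<in> carrier U" "z \<in> carrier U" "x \<otimes> z = c \<odot> (z \<otimes> x)"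
  shows "qcomm x c z = \<zero>"
  using assms by (simp add: qcomm_def)

end

text \<open>For v = q_ii and r = q_ij these are the parameters of the Serre element. As arguments of
  \<open>qcomms\<close> they are applied in ascending order of the power: r first, v^(n-1) r
  last.\<close>

fun qpowers :: "'k::field \<Rightarrow> 'k \<Rightarrow> nat \<Rightarrow> 'k list" where
  "qpowers v r 0 = []"
| "qpowers v r (Suc n) = (v ^ n * r) # qpowers v r n"

lemma length_qpowers [simp]: "length (qpowers v r n) = n"
  by (induction n) simp_all

lemma map_inverse_qpowers: "map inverse (qpowers v r n) = qpowers (inverse v) (inverse r) n"
  by (induction n) (simp_all add: power_inverse)

lemma qpowers_snoc: "qpowers v r (Suc n) = qpowers v (v * r) n @ [r]"
  by (induction n) (simp_all add: mult_ac)

lemma rev_qpowers: "rev (qpowers v r n) = map (\<lambda>t. v ^ t * r) [0..<n]"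
  by (induction n) simp_all

text \<open>The hypothesis identifies the extreme entry v^N r with 1/s; read backwards the list is
  geometric again, with ratio 1/v and starting value 1/s.\<close>

lemma rev_qpowers_eq:
  assumes "v ^ N * r * s = 1"
  shows "rev (qpowers v r (Suc N)) = qpowers (inverse v) (inverse s) (Suc N)"
proof -
  have v: "s \<noteq> 0" "N \<noteq> 0 \<Longrightarrow> v \<noteq> 0" using assms by (auto simp: power_0_left split: if_splits)
  have "qpowers (inverse v) (inverse s) n = map (\<lambda>t. v ^ (Suc N - n + t) * r) [0..<n]" if "n \<le> Suc N" for n
    using that
  proof (induction n)
    case (Suc n)
    have "inverse v ^ n * inverse s = v ^ (N - n) * r"
    \<comment> \<open>The case v = 0 is compatible with the hypothesis only if N = 0, when the list
      has a single entry.\<close>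
    proof (cases "v = 0")
      case True
      then have "N = 0" "n = 0" using v(2) Suc.prems by auto
      then show ?thesis using assms v(1) by (simp add: field_simps)
    next
      case False
      have "v ^ N = v ^ (N - n) * v ^ n" using Suc.prems by (simp flip: power_add)
      then show ?thesis using assms v(1) False by (simp add: field_simps)
    qed
    moreover have "[0..<Suc n] = 0 # map Suc [0..<n]" by (simp add: upt_conv_Cons map_Suc_upt del: upt_Suc)
    ultimately show ?case using Suc by (simp add: o_def Suc_diff_le del: upt_Suc)
  qed simp
  from this[of "Suc N"] show ?thesis by (simp add: rev_qpowers del: qpowers.simps upt_Suc)
qed

context K_algebra
begin

lemma qcomms_qpowers_reverse:
  assumes "v ^ N * r * s = 1" "x \<in> carrier U" "y \<in> carrier U"
  shows "qcomms x (qpowers v r (Suc N)) y = qcomms x (qpowers (inverse v) (inverse s) (Suc N)) y"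
  using qcomms_rev[OF assms(2,3)] rev_qpowers_eq[OF assms(1)] by metis

text \<open>Applied in ascending order the q-commutators annihilate the mixed terms with \<open>a'\<close>, in
  descending order those with \<open>b'\<close>.\<close>

lemma qcomms_sum:
  assumes [simp]: "a \<in> carrier U" "a' \<in> carrier U" "b \<in> carrier U" "b' \<in> carrier U"
    and ba: "b \<otimes> a = v \<odot> (a \<otimes> b)" and ba': "b \<otimes> a' = r \<odot> (a' \<otimes> b)" and b'a: "b' \<otimes> a = s \<odot> (a \<otimes> b')"
    and N: "v ^ N * r * s = 1" and v: "v \<noteq> 0"
  shows "qcomms (a \<oplus> b) (qpowers v r (Suc N)) (a' \<oplus> b')
    = qcomms a (qpowers v r (Suc N)) a' \<oplus> qcomms b (qpowers v r (Suc N)) b'"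
proof -
  have s: "s \<noteq> 0" using N by auto
  have 1: "qcomms (a \<oplus> b) (qpowers v r n) a' = qcomms a (qpowers v r n) a'" for n
  proof (induction n)
    case (Suc n)
    \<comment> \<open>By \<open>qcomms_commute_left\<close>, b passes the n-fold commutator of a and
      a' with factor v^n r, which is exactly the next parameter.\<close>
    have "qcomm b (v ^ n * r) (qcomms a (qpowers v r n) a') = \<zero>"
      using qcomms_commute_left[OF _ _ _ ba ba', of "qpowers v r n"] by (intro qcomm_eq_zero) simp_all
    then show ?case using Suc by (simp add: qcomm_add_left)
  qed simp
  have 2: "qcomms (a \<oplus> b) (qpowers (inverse v) (inverse s) n) b' = qcomms b (qpowers (inverse v) (inverse s) n) b'"
      for n
  proof (induction n)
    case (Suc n)
    let ?z = "qcomms b (qpowers (inverse v) (inverse s) n) b'"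
    \<comment> \<open>In this order the next parameter is the inverse of v^n s, so the commutator of
      a with z vanishes.\<close>
    have "?z \<otimes> a = (v ^ n * s) \<odot> (a \<otimes> ?z)"
      using qcomms_commute_right[OF _ _ _ ba b'a, of "qpowers (inverse v) (inverse s) n"] by simp
    then have "qcomm a (inverse v ^ n * inverse s) ?z = \<zero>"
      using s v by (intro qcomm_eq_zero) (simp_all add: smult_smult field_simps)
    then show ?case using Suc by (simp add: qcomm_add_left)
  qed simp
  show ?thesis
    using 1[of "Suc N"] 2[of "Suc N"] qcomms_qpowers_reverse[OF N, of "a \<oplus> b" b']
      qcomms_qpowers_reverse[OF N, of b b']
    by (simp only: qcomms_add_right a_closed assms(1-4))
qed

text \<open>Extracting the factor m costs \<rho>^n \<sigma> in the product a z and \<rho>^n \<tau>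
  in the product z a. The power of \<rho> is common to both, so every parameter is multiplied by the
  same quotient \<tau>/\<sigma> and the list stays geometric with ratio v.\<close>

lemma qcomms_twisted:
  assumes [simp]: "m \<in> carrier U" "m' \<in> carrier U" "a \<in> carrier U" "a' \<in> carrier U"
    and mm': "m \<otimes> m' = m' \<otimes> m"
    and am: "a \<otimes> m = \<rho> \<odot> (m \<otimes> a)" and am': "a \<otimes> m' = \<sigma> \<odot> (m' \<otimes> a)" and a'm: "a' \<otimes> m = \<tau> \<odot> (m \<otimes> a')"
    and \<sigma>: "\<sigma> \<noteq> 0"
  shows "\<exists>\<gamma>. \<exists>M\<in>carrier U. qcomms (m \<otimes> a) (qpowers v r n) (m' \<otimes> a')
    = \<gamma> \<odot> (M \<otimes> qcomms a (qpowers v (r * \<tau> / \<sigma>) n) a')"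
proof -
  \<comment> \<open>The two further conjuncts record how the extracted factor M passes m and a; the
    induction step consumes them.\<close>
  have "\<exists>\<gamma>. \<exists>M\<in>carrier U. qcomms (m \<otimes> a) (qpowers v r n) (m' \<otimes> a')
    = \<gamma> \<odot> (M \<otimes> qcomms a (qpowers v (r * \<tau> / \<sigma>) n) a') \<and> M \<otimes> m = m \<otimes> M \<and> a \<otimes> M = (\<rho> ^ n * \<sigma>) \<odot> (M \<otimes> a)"
  proof (induction n)
    case 0
    show ?case
      by (intro exI[of _ 1] bexI[of _ m']) (simp_all add: mm' am')
  next
    case (Suc n)
    then obtain \<gamma> M where [simp]: "M \<in> carrier U"
      and eq: "qcomms (m \<otimes> a) (qpowers v r n) (m' \<otimes> a') = \<gamma> \<odot> (M \<otimes> qcomms a (qpowers v (r * \<tau> / \<sigma>) n) a')"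
      and Mm: "M \<otimes> m = m \<otimes> M" and aM: "a \<otimes> M = (\<rho> ^ n * \<sigma>) \<odot> (M \<otimes> a)" by blast
    let ?z = "qcomms a (qpowers v (r * \<tau> / \<sigma>) n) a'"
    have zm: "?z \<otimes> m = (\<rho> ^ n * \<tau>) \<odot> (m \<otimes> ?z)"
      using qcomms_commute_right[OF _ _ _ am a'm, of "qpowers v (r * \<tau> / \<sigma>) n"] by simp
    have 1: "(m \<otimes> a) \<otimes> (M \<otimes> ?z) = (\<rho> ^ n * \<sigma>) \<odot> (m \<otimes> M \<otimes> (a \<otimes> ?z))"
    proof -
      have "(m \<otimes> a) \<otimes> (M \<otimes> ?z) = m \<otimes> (a \<otimes> M) \<otimes> ?z" by (simp add: m_assoc)
      also have "\<dots> = (\<rho> ^ n * \<sigma>) \<odot> (m \<otimes> M \<otimes> (a \<otimes> ?z))"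
        by (simp add: aM smult_mult_left smult_mult_right m_assoc)
      finally show ?thesis .
    qed
    have 2: "(M \<otimes> ?z) \<otimes> (m \<otimes> a) = (\<rho> ^ n * \<tau>) \<odot> (m \<otimes> M \<otimes> (?z \<otimes> a))"
    proof -
      have "(M \<otimes> ?z) \<otimes> (m \<otimes> a) = M \<otimes> (?z \<otimes> m) \<otimes> a" by (simp add: m_assoc)
      also have "\<dots> = (\<rho> ^ n * \<tau>) \<odot> ((M \<otimes> m) \<otimes> (?z \<otimes> a))"
        by (simp add: zm smult_mult_left smult_mult_right m_assoc)
      finally show ?thesis by (simp add: Mm)
    qed
    have "qcomms (m \<otimes> a) (qpowers v r (Suc n)) (m' \<otimes> a')
      = (\<gamma> * (\<rho> ^ n * \<sigma>)) \<odot> ((m \<otimes> M) \<otimes> qcomms a (qpowers v (r * \<tau> / \<sigma>) (Suc n)) a')"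
      using \<sigma> by (simp add: eq qcomm_def[of "m \<otimes> a"] smult_mult_left smult_mult_right 1 2)
        (simp add: qcomm_def r_distr smult_r_distr smult_mult_right smult_smult field_simps)
    moreover have "(m \<otimes> M) \<otimes> m = m \<otimes> (m \<otimes> M)" by (simp add: m_assoc Mm)
    moreover have "a \<otimes> (m \<otimes> M) = (\<rho> ^ Suc n * \<sigma>) \<odot> (m \<otimes> M \<otimes> a)"
    proof -
      have "a \<otimes> (m \<otimes> M) = \<rho> \<odot> (m \<otimes> (a \<otimes> M))" by (simp add: m_assoc[symmetric] am smult_mult_left)
      then show ?thesis by (simp add: aM smult_mult_right smult_smult m_assoc mult_ac)
    qed
    ultimately show ?case by (intro exI bexI[of _ "m \<otimes> M"] conjI) simp_all
  qed
  then show ?thesis by blast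
qed

text \<open>The error K sits at y. The innermost parameter c makes the two multiples of K x cancel;
  from then on both x and the inner commutator commute with L, whatever the remaining parameters
  are.\<close>

lemma qcomms_derivation_right:
  assumes [simp]: "x \<in> carrier U" "y \<in> carrier U" "L \<in> carrier U" "K \<in> carrier U"
    and x: "x \<otimes> L = L \<otimes> x" and y: "y \<otimes> L = L \<otimes> y \<oplus> K" and K: "x \<otimes> K = c \<odot> (K \<otimes> x)"
  shows "qcomms x (cs @ [c]) y \<otimes> L = L \<otimes> qcomms x (cs @ [c]) y"
proof (induction cs)
  case Nil
  have 1: "x \<otimes> y \<otimes> L = L \<otimes> (x \<otimes> y) \<oplus> c \<odot> (K \<otimes> x)"
    by (simp add: m_assoc y r_distr K) (simp add: m_assoc[symmetric] x)
  have 2: "y \<otimes> x \<otimes> L = L \<otimes> (y \<otimes> x) \<oplus> K \<otimes> x"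
    by (simp add: m_assoc x) (simp add: m_assoc[symmetric] y l_distr)
  have "qcomm x c y \<otimes> L = L \<otimes> (x \<otimes> y) \<oplus> (c \<odot> (K \<otimes> x) \<oplus> ((- c) \<odot> (K \<otimes> x) \<oplus> (- c) \<odot> (L \<otimes> (y \<otimes> x))))"
    by (simp add: qcomm_def l_distr smult_mult_left 1 2 smult_r_distr a_assoc a_comm)
  also have "\<dots> = L \<otimes> qcomm x c y"
    by (simp add: a_assoc[symmetric]) (simp add: qcomm_def r_distr smult_mult_right a_assoc)
  finally show ?case by simp
next
  case (Cons d cs)
  let ?z = "qcomms x (cs @ [c]) y"
  have "x \<otimes> ?z \<otimes> L = L \<otimes> (x \<otimes> ?z)"
    by (simp add: m_assoc Cons) (simp add: m_assoc[symmetric] x)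
  moreover have "?z \<otimes> x \<otimes> L = L \<otimes> (?z \<otimes> x)"
    by (simp add: m_assoc x) (simp add: m_assoc[symmetric] Cons)
  ultimately show ?case
    by (simp add: qcomm_def l_distr r_distr smult_mult_left smult_mult_right)
qed

text \<open>Here the error K sits at x and reappears with each commutator. It passes the n-fold
  commutator z with factor \<alpha>^n \<beta>, the next parameter, so K z and the multiple of z K
  cancel every time.\<close>

lemma qcomms_derivation_left:
  assumes [simp]: "x \<in> carrier U" "y \<in> carrier U" "L \<in> carrier U" "K \<in> carrier U"
    and x: "x \<otimes> L = L \<otimes> x \<oplus> K" and y: "y \<otimes> L = L \<otimes> y"
    and Kx: "K \<otimes> x = \<alpha> \<odot> (x \<otimes> K)" and Ky: "K \<otimes> y = \<beta> \<odot> (y \<otimes> K)"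
  shows "qcomms x (qpowers \<alpha> \<beta> n) y \<otimes> L = L \<otimes> qcomms x (qpowers \<alpha> \<beta> n) y"
proof (induction n)
  case (Suc n)
  let ?z = "qcomms x (qpowers \<alpha> \<beta> n) y" and ?c = "\<alpha> ^ n * \<beta>"
  have Kz: "K \<otimes> ?z = ?c \<odot> (?z \<otimes> K)"
    using qcomms_commute_left[OF _ _ _ Kx Ky, of "qpowers \<alpha> \<beta> n"] by simp
  have 1: "x \<otimes> ?z \<otimes> L = L \<otimes> (x \<otimes> ?z) \<oplus> ?c \<odot> (?z \<otimes> K)"
    by (simp add: m_assoc Suc) (simp add: m_assoc[symmetric] x l_distr Kz)
  have 2: "?z \<otimes> x \<otimes> L = L \<otimes> (?z \<otimes> x) \<oplus> ?z \<otimes> K"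
    by (simp add: m_assoc x r_distr) (simp add: m_assoc[symmetric] Suc)
  have "qcomm x ?c ?z \<otimes> L = L \<otimes> (x \<otimes> ?z) \<oplus> (?c \<odot> (?z \<otimes> K) \<oplus> ((- ?c) \<odot> (?z \<otimes> K) \<oplus> (- ?c) \<odot> (L \<otimes> (?z \<otimes> x))))"
    by (simp add: qcomm_def l_distr smult_mult_left 1 2 smult_r_distr a_assoc a_comm)
  also have "\<dots> = L \<otimes> qcomm x ?c ?z"
    by (simp add: a_assoc[symmetric]) (simp add: qcomm_def r_distr smult_mult_right a_assoc)
  finally show ?case by simp
qed (simp add: y)

end

lemma qcomms_hom:
  assumes "K_algebra U" "K_algebra V" "alg_hom U V h" "x \<in> carrier U" "y \<in> carrier U"
  shows "h (K_algebra.qcomms U x cs y) = K_algebra.qcomms V (h x) cs (h y)"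
proof -
  interpret U: K_algebra U by fact
  interpret V: K_algebra V by fact
  show ?thesis
    by (induction cs) (use assms(4,5) in \<open>simp_all add: U.qcomm_def V.qcomm_def alg_homD[OF assms(3)]\<close>)
qed

lemma opp_opp_algebra [simp]: "opp_algebra (opp_algebra U) = U"
  by (simp add: opp_algebra_def)

lemma alg_hom_opp: "alg_hom U V h \<Longrightarrow> alg_hom (opp_algebra U) (opp_algebra V) h"
  by (auto simp: alg_hom_def ring_hom_def)

text \<open>In the opposite algebra the q-commutator is z x - c x z, that is, -c times the ordinary
  one with parameter 1/c.\<close>

lemma qcomms_opp:
  assumes "K_algebra U" "x \<in> carrier U" "y \<in> carrier U" "0 \<notin> set cs"
  shows "\<exists>\<gamma>. \<gamma> \<noteq> 0 \<and> K_algebra.qcomms (opp_algebra U) x cs y = \<gamma> \<odot>\<^bsub>U\<^esub> K_algebra.qcomms U x (map inverse cs) y"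
proof -
  interpret U: K_algebra U by fact
  interpret O: K_algebra "opp_algebra U" by (rule K_algebra_opp) fact
  show ?thesis using assms(4)
  proof (induction cs)
    case Nil
    then show ?case by (intro exI[of _ 1]) (simp add: assms)
  next
    case (Cons c cs)
    then obtain \<gamma> where \<gamma>: "\<gamma> \<noteq> 0" "O.qcomms x cs y = \<gamma> \<odot>\<^bsub>U\<^esub> U.qcomms x (map inverse cs) y" by auto
    have *: "c * \<gamma> * inverse c = \<gamma>" using Cons.prems by simp
    show ?case using Cons.prems \<gamma> assms
      by (intro exI[of _ "- c * \<gamma>"]) (simp add: O.qcomm_def U.qcomm_def U.smult_mult_left
          U.smult_mult_right U.smult_smult U.smult_r_distr U.a_comm *)
  qed
qed

lemma zero_notin_qpowers: "v \<noteq> 0 \<Longrightarrow> r \<noteq> 0 \<Longrightarrow> 0 \<notin> set (qpowers v r n)"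
  by (induction n) auto

text \<open>Passing to the opposite algebra inverts all parameters; reversing their order then
  restores the ratio v and replaces 1/s by r. Serre elements of the opposite algebra thus become
  ordinary ones with q_ij and q_ji exchanged.\<close>

lemma qcomms_transpose:
  assumes "K_algebra U" "x \<in> carrier U" "y \<in> carrier U" "v ^ N * r * s = 1" "v \<noteq> 0"
  shows "\<exists>\<gamma>. \<gamma> \<noteq> 0 \<and> K_algebra.qcomms (opp_algebra U) x (qpowers v s (Suc N)) y
    = \<gamma> \<odot>\<^bsub>U\<^esub> K_algebra.qcomms U x (qpowers v r (Suc N)) y"
proof -
  interpret U: K_algebra U by fact
  have "s \<noteq> 0" using assms(4) by auto
  then have "0 \<notin> set (qpowers v s (Suc N))" using assms(5) by (intro zero_notin_qpowers)
  from qcomms_opp[OF assms(1-3) this] show ?thesis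
    unfolding map_inverse_qpowers by (simp only: U.qcomms_qpowers_reverse[OF assms(4,2,3)])
qed

subsection \<open>Serre elements as iterated q-commutators\<close>

text \<open>The division-free Gaussian binomial. Of the two Pascal recursions this is the one
  produced by adding an outermost commutator with parameter v^n r; where n - k is truncated the
  other factor is 0.\<close>

fun gauss_binomial :: "'k::field \<Rightarrow> nat \<Rightarrow> nat \<Rightarrow> 'k" where
  "gauss_binomial v n 0 = 1"
| "gauss_binomial v 0 (Suc k) = 0"
| "gauss_binomial v (Suc n) (Suc k) = gauss_binomial v n (Suc k) + v ^ (n - k) * gauss_binomial v n k"

lemma gauss_binomial_eq_0: "n < k \<Longrightarrow> gauss_binomial v n k = 0"
  by (induction v n k rule: gauss_binomial.induct) auto

lemma gauss_binomial_self: "gauss_binomial v n n = 1"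
  by (induction n) (simp_all add: gauss_binomial_eq_0)

lemma qfact_Suc: "qfact v (Suc n) = qnum v (Suc n) * qfact v n"
  by (simp add: qfact_def mult.commute)

lemma gauss_binomial_qfact:
  assumes "v \<noteq> 1" "k \<le> n"
  shows "gauss_binomial v n k * (qfact v k * qfact v (n - k)) = qfact v n"
  using assms
proof (induction v n k rule: gauss_binomial.induct)
  case (1 v n)
  then show ?case by (simp add: qfact_def)
next
  case (3 v n k)
  show ?case
  proof (cases "k = n")
    case True
    then show ?thesis using 3 by (simp only: gauss_binomial_self) (simp add: qfact_def)
  next
    case False
    then obtain d where d: "n = k + Suc d" using 3 less_imp_Suc_add[of k n] by auto
    have "gauss_binomial v (Suc n) (Suc k) * (qfact v (Suc k) * qfact v (Suc n - Suc k))
      = (gauss_binomial v n (Suc k) * (qfact v (Suc k) * qfact v (n - Suc k))) * qnum v (Suc d)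
       + v ^ (Suc d) * qnum v (Suc k) * (gauss_binomial v n k * (qfact v k * qfact v (n - k)))"
      by (simp add: d qfact_Suc algebra_simps)
    also have "\<dots> = (qnum v (Suc d) + v ^ Suc d * qnum v (Suc k)) * qfact v n"
      using 3 d by (simp add: algebra_simps)
    also have "qnum v (Suc d) + v ^ Suc d * qnum v (Suc k) = qnum v (Suc n)"
      by (simp add: qnum_def d add_divide_distrib[symmetric] algebra_simps power_add)
    finally show ?thesis by (simp add: qfact_Suc)
  qed
qed simp

text \<open>No positive power of v is 1, so all q-factorials are nonzero and the quotient defining
  \<open>qbinom\<close> can be cleared.\<close>

lemma qbinom_eq_gauss_binomial:
  assumes "\<And>m. m > 0 \<Longrightarrow> v ^ m \<noteq> 1" "k \<le> n"
  shows "qbinom v n k = gauss_binomial v n k"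
proof -
  have v: "v \<noteq> 1" using assms(1)[of 1] by simp
  have "qfact v m \<noteq> 0" for m
    using assms(1) v by (induction m) (simp_all add: qfact_Suc qnum_def qfact_def[of v 0] del: power_Suc)
  then show ?thesis
    using gauss_binomial_qfact[OF v assms(2)] by (simp add: qbinom_def field_simps)
qed

text \<open>By the q-binomial theorem, the coefficient of L^(n-k) R^k in the product of L - v^t r R
  over t < n, for commuting L and R. At n = 1 - a_ij these are the Serre coefficients.\<close>

definition qcomms_coeff :: "'k::field \<Rightarrow> 'k \<Rightarrow> nat \<Rightarrow> nat \<Rightarrow> 'k" where
  "qcomms_coeff v r n k = (-1) ^ k * gauss_binomial v n k * v ^ (k * (k - 1) div 2) * r ^ k"

lemma qcomms_coeff_Suc:
  "qcomms_coeff v r (Suc n) (Suc k) = qcomms_coeff v r n (Suc k) - v ^ n * r * qcomms_coeff v r n k"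
proof (cases "k \<le> n")
  case True
  have "Suc k * (Suc k - 1) div 2 = k * (k - 1) div 2 + k"
    by (cases k) (simp_all add: algebra_simps)
  moreover have "v ^ n = v ^ (n - k) * v ^ k" using True by (simp flip: power_add)
  ultimately show ?thesis by (simp add: qcomms_coeff_def power_add algebra_simps)
qed (simp add: qcomms_coeff_def gauss_binomial_eq_0)

text \<open>L and R stand for left and right multiplication by the generator, or for the reverse in
  the opposite algebra; W a k is the word after a applications of L and k of R. One computation thus
  serves both kinds of Serre elements.\<close>

lemma qcomms_coeff_sum:
  fixes W :: "nat \<Rightarrow> nat \<Rightarrow> 'g list" and v r :: "'k::field"
  defines "T \<equiv> \<lambda>n. \<Sum>k\<le>n. word (qcomms_coeff v r n k) (W (n - k) k)"
  assumes L: "\<And>p p'. L (p + p') = L p + L p'" "\<And>c a k. L (word c (W a k)) = word c (W (Suc a) k)"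
    and R: "\<And>p p'. R (p + p') = R p + R p'" "\<And>c a k. R (word c (W a k)) = word c (W a (Suc k))"
  shows "T (Suc n) = L (T n) + scale (- (v ^ n * r)) (R (T n))"
proof -
  have L_sum: "L (\<Sum>k\<le>m. word (c k) (W (n - k) k)) = (\<Sum>k\<le>m. word (c k) (W (Suc (n - k)) k))" for m c
    by (induction m) (simp_all add: L)
  have R_sum: "R (\<Sum>k\<le>m. word (c k) (W (n - k) k)) = (\<Sum>k\<le>m. word (c k) (W (n - k) (Suc k)))" for m c
    by (induction m) (simp_all add: R)
  have scale_sum: "scale d (\<Sum>k\<le>m. f k) = (\<Sum>k\<le>m. scale d (f k))" for d m and f :: "nat \<Rightarrow> 'g list \<Rightarrow>\<^sub>0 'k"
    by (induction m) (simp_all add: scale_add)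
  let ?C = "qcomms_coeff v r"
  have C0: "?C n (Suc n) = 0" by (simp add: qcomms_coeff_def gauss_binomial_eq_0)
  have "T (Suc n) = word (?C (Suc n) 0) (W (Suc n) 0) + (\<Sum>k\<le>n. word (?C (Suc n) (Suc k)) (W (n - k) (Suc k)))"
    unfolding T_def by (subst sum.atMost_Suc_shift) simp
  also have "\<dots> = (word (?C n 0) (W (Suc n) 0) + (\<Sum>k\<le>n. word (?C n (Suc k)) (W (n - k) (Suc k))))
      + (\<Sum>k\<le>n. word (- (v ^ n * r) * ?C n k) (W (n - k) (Suc k)))"
    by (simp add: qcomms_coeff_Suc single_diff single_uminus sum_subtractf sum_negf qcomms_coeff_def[of _ _ _ 0])
  also have "word (?C n 0) (W (Suc n) 0) + (\<Sum>k\<le>n. word (?C n (Suc k)) (W (n - k) (Suc k)))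
      = (\<Sum>k\<le>Suc n. word (?C n k) (W (Suc n - k) k))"
    by (subst sum.atMost_Suc_shift) simp
  also have "\<dots> = (\<Sum>k\<le>n. word (?C n k) (W (Suc (n - k)) k))"
    by (simp add: C0 Suc_diff_le)
  finally show ?thesis by (simp add: T_def L_sum R_sum scale_sum)
qed

lemma qcomms_free:
  "(\<Sum>k\<le>n. word (qcomms_coeff v r n k) (replicate (n - k) g @ [h] @ replicate k g))
    = FA.qcomms (word 1 [g]) (qpowers v r n) (word 1 [h])"
proof (induction n)
  case 0
  then show ?case by (simp add: qcomms_coeff_def)
next
  case (Suc n)
  show ?case
    by (subst qcomms_coeff_sum[where W="\<lambda>a k. replicate a g @ [h] @ replicate k g"
          and L="\<lambda>p. word 1 [g] \<otimes>\<^bsub>free_algebra\<^esub> p" and R="\<lambda>p. p \<otimes>\<^bsub>free_algebra\<^esub> word 1 [g]"])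
      (use Suc in \<open>simp_all add: free_mult_add FA.qcomm_def replicate_append_same\<close>)
qed

lemma K_algebra_free_opp: "K_algebra (opp_algebra free_algebra)"
  by (rule K_algebra_opp) (rule FA.K_algebra_axioms)

global_interpretation FO: K_algebra "opp_algebra free_algebra :: ('k::field, 'g list \<Rightarrow>\<^sub>0 'k) module"
  by (rule K_algebra_free_opp)

lemma qcomms_free_opp:
  "(\<Sum>k\<le>n. word (qcomms_coeff v r n k) (replicate k g @ [h] @ replicate (n - k) g))
    = FO.qcomms (word 1 [g]) (qpowers v r n) (word 1 [h])"
proof (induction n)
  case 0
  then show ?case by (simp add: qcomms_coeff_def)
next
  case (Suc n)
  show ?case
    by (subst qcomms_coeff_sum[where W="\<lambda>a k. replicate k g @ [h] @ replicate a g"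
          and L="\<lambda>p. p \<otimes>\<^bsub>free_algebra\<^esub> word 1 [g]" and R="\<lambda>p. word 1 [g] \<otimes>\<^bsub>free_algebra\<^esub> p"])
      (use Suc in \<open>simp_all add: free_mult_add FO.qcomm_def replicate_append_same\<close>)
qed

section \<open>The quantum group\<close>

lemma Uq_relators_intros:
  "g \<in> torus_gens \<Longrightarrow> h \<in> torus_gens \<Longrightarrow> word 1 [g, h] - word 1 [h, g] \<in> Uq_relators A q"
  "word 1 [Om i, OmInv i] - word 1 [] \<in> Uq_relators A q"
  "word 1 [Om' i, OmInv' i] - word 1 [] \<in> Uq_relators A q"
  "word 1 [Om i, E j, OmInv i] - word (q i j) [E j] \<in> Uq_relators A q"
  "word 1 [Om' i, E j, OmInv' i] - word (inverse (q j i)) [E j] \<in> Uq_relators A q"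
  "word 1 [Om i, F j, OmInv i] - word (inverse (q i j)) [F j] \<in> Uq_relators A q"
  "word 1 [Om' i, F j, OmInv' i] - word (q j i) [F j] \<in> Uq_relators A q"
  "word 1 [E i, F j] - word 1 [F j, E i]
    - (if i = j then word (q i i / (q i i - 1)) [Om i] - word (q i i / (q i i - 1)) [Om' i] else 0) \<in> Uq_relators A q"
  "i \<noteq> j \<Longrightarrow> serre_E A q i j \<in> Uq_relators A q"
  "i \<noteq> j \<Longrightarrow> serre_F A q i j \<in> Uq_relators A q"
  unfolding Uq_relators_def by (simp only: Un_iff mem_Collect_eq; blast)+

text \<open>The conditions are invariant under transposing q with A kept fixed, so everything proved
  here also applies to the transposed parameters.\<close>

locale quantum_parameters =
  fixes A :: "'i::finite \<Rightarrow> 'i \<Rightarrow> int" and q :: "'i \<Rightarrow> 'i \<Rightarrow> 'k::field"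
  assumes q_nonzero [simp]: "q i j \<noteq> 0"
    and q_mult_q: "q i j * q j i = q i i powi A i j"
    and A_nonpos: "i \<noteq> j \<Longrightarrow> A i j \<le> 0"
    and q_not_root: "m > 0 \<Longrightarrow> q i i ^ m \<noteq> 1"
begin

definition serre_degree :: "'i \<Rightarrow> 'i \<Rightarrow> nat" where
  "serre_degree i j = nat (- A i j)"

definition serre_powers :: "'i \<Rightarrow> 'i \<Rightarrow> 'k list" where
  "serre_powers i j = qpowers (q i i) (q i j) (Suc (serre_degree i j))"

text \<open>The hypothesis v^N r s = 1 of the reversal lemmas for v = q_ii, r = q_ij, s = q_ji,
  obtained from q_ij q_ji = q_ii^a_ij.\<close>

lemma q_serre_degree: "i \<noteq> j \<Longrightarrow> q i i ^ serre_degree i j * q i j * q j i = 1"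
  using A_nonpos[of i j] q_mult_q[of i j]
  by (simp add: serre_degree_def mult.assoc power_int_def power_inverse)

context
  fixes i j :: 'i
  assumes ij: "i \<noteq> j"
begin

lemma nat_one_minus_A: "nat (1 - A i j) = Suc (serre_degree i j)"
  using A_nonpos[OF ij] by (simp add: serre_degree_def Suc_nat_eq_nat_zadd1)

lemma serre_coeff_eq:
  "k \<le> Suc (serre_degree i j) \<Longrightarrow> serre_coeff A q i j k = qcomms_coeff (q i i) (q i j) (Suc (serre_degree i j)) k"
  using q_not_root by (simp add: serre_coeff_def qcomms_coeff_def nat_one_minus_A qbinom_eq_gauss_binomial)

lemma serre_E_eq: "serre_E A q i j = FA.qcomms (word 1 [E i]) (serre_powers i j) (word 1 [E j])"
  unfolding serre_E_def Let_def nat_one_minus_A serre_powers_def qcomms_free[symmetric]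
  by (rule sum.cong) (simp_all add: serre_coeff_eq)

lemma serre_F_eq: "serre_F A q i j = FO.qcomms (word 1 [F i]) (serre_powers i j) (word 1 [F j])"
  unfolding serre_F_def Let_def nat_one_minus_A serre_powers_def qcomms_free_opp[symmetric]
  by (rule sum.cong) (simp_all add: serre_coeff_eq)

end

definition serre_relators :: "('i gen list \<Rightarrow>\<^sub>0 'k) set" where
  "serre_relators = {serre_E A q i j | i j. i \<noteq> j} \<union> {serre_F A q i j | i j. i \<noteq> j}"

definition cartan :: "'i \<Rightarrow> 'k" where
  "cartan i = q i i / (q i i - 1)"

text \<open>The scalar by which conjugation with a torus generator acts on \<open>E j\<close>; it acts on \<open>F j\<close> by the inverse.\<close>

fun torus_weight :: "'i gen \<Rightarrow> 'i \<Rightarrow> 'k" where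
  "torus_weight (Om i) j = q i j"
| "torus_weight (OmInv i) j = inverse (q i j)"
| "torus_weight (Om' i) j = inverse (q j i)"
| "torus_weight (OmInv' i) j = q j i"
| "torus_weight _ j = 1"

lemma torus_weight_nonzero [simp]: "torus_weight g j \<noteq> 0"
  by (cases g) simp_all

end

lemma torus_gens_simps [simp]:
  "Om i \<in> torus_gens" "OmInv i \<in> torus_gens" "Om' i \<in> torus_gens" "OmInv' i \<in> torus_gens"
  "E i \<notin> torus_gens" "F i \<notin> torus_gens"
  by (auto simp: torus_gens_def)

text \<open>Images of the generators that satisfy all relations except the Serre relations, with
  conjugation rewritten as commutation up to a scalar. The instances are U_q itself, the coproduct,
  the antipode, the operators of the module and the exchange of the halves; the Serre relations are
  treated separately in each.\<close>

locale uq_images = quantum_parameters A q + B: K_algebra B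
  for A :: "'i::finite \<Rightarrow> 'i \<Rightarrow> int" and q :: "'i \<Rightarrow> 'i \<Rightarrow> 'k::field" and B :: "('k, 'u) module" (structure) +
  fixes \<phi> :: "'i gen \<Rightarrow> 'u"
  assumes closed [simp]: "\<phi> g \<in> carrier B"
    and torus_comm: "g \<in> torus_gens \<Longrightarrow> h \<in> torus_gens \<Longrightarrow> \<phi> g \<otimes> \<phi> h = \<phi> h \<otimes> \<phi> g"
    and Om_OmInv: "\<phi> (Om i) \<otimes> \<phi> (OmInv i) = \<one>"
    and Om'_OmInv': "\<phi> (Om' i) \<otimes> \<phi> (OmInv' i) = \<one>"
    and Om_E: "\<phi> (Om i) \<otimes> \<phi> (E j) = q i j \<odot> (\<phi> (E j) \<otimes> \<phi> (Om i))"
    and Om'_E: "\<phi> (Om' i) \<otimes> \<phi> (E j) = inverse (q j i) \<odot> (\<phi> (E j) \<otimes> \<phi> (Om' i))"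
    and Om_F: "\<phi> (Om i) \<otimes> \<phi> (F j) = inverse (q i j) \<odot> (\<phi> (F j) \<otimes> \<phi> (Om i))"
    and Om'_F: "\<phi> (Om' i) \<otimes> \<phi> (F j) = q j i \<odot> (\<phi> (F j) \<otimes> \<phi> (Om' i))"
    and E_F: "\<phi> (E i) \<otimes> \<phi> (F j) = \<phi> (F j) \<otimes> \<phi> (E i) \<oplus>
      (if i = j then cartan i \<odot> \<phi> (Om i) \<oplus> (- cartan i) \<odot> \<phi> (Om' i) else \<zero>)"
begin

lemmas hom = B.alg_hom_free_lift[of \<phi>, OF closed]

lemma word_eq: "free_lift B \<phi> (word c w) = c \<odot> B.word_image \<phi> w"
  by (rule B.free_lift_word) simp

lemma word_image_simps [simp]:
  "B.word_image \<phi> [] = \<one>" "B.word_image \<phi> (g # w) = \<phi> g \<otimes> B.word_image \<phi> w"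
  by (simp_all add: B.word_image_def)

lemma free_lift_diff: "free_lift B \<phi> (p - r) = free_lift B \<phi> p \<ominus> free_lift B \<phi> r"
proof -
  have c: "free_lift B \<phi> p \<in> carrier B" for p by (simp add: B.free_lift_closed)
  have "p = (p - r) + r" by simp
  then have "free_lift B \<phi> p = free_lift B \<phi> (p - r) \<oplus> free_lift B \<phi> r"
    using B.free_lift_add[of \<phi> "p - r" r] by simp
  then show ?thesis using c by (simp add: B.minus_eq B.a_assoc B.r_neg)
qed

lemma free_lift_diff_eq_zero: "free_lift B \<phi> p = free_lift B \<phi> r \<Longrightarrow> free_lift B \<phi> (p - r) = \<zero>"
  by (simp add: free_lift_diff B.free_lift_closed)

lemma conj: "x \<otimes> y = c \<odot> (y \<otimes> x) \<Longrightarrow> x \<otimes> z = \<one> \<Longrightarrow> x \<in> carrier B \<Longrightarrow> y \<in> carrier B \<Longrightarrow> z \<in> carrier B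
   \<Longrightarrow> x \<otimes> (y \<otimes> z) = c \<odot> y"
  by (simp add: B.m_assoc[symmetric] B.smult_mult_left) (simp add: B.m_assoc)

lemma kills_relators:
  assumes "p \<in> Uq_relators A q" "p \<notin> serre_relators"
  shows "free_lift B \<phi> p = \<zero>"
proof -
  have EF: "free_lift B \<phi> (word 1 [E i, F j] - word 1 [F j, E i]
        - (if i = j then word (q i i / (q i i - 1)) [Om i] - word (q i i / (q i i - 1)) [Om' i] else 0)) = \<zero>" for i j
  proof (cases "i = j")
    case True
    have "free_lift B \<phi> (word 1 [E i, F i]) = free_lift B \<phi> (word 1 [F i, E i] + word (cartan i) [Om i]
        + word (- cartan i) [Om' i])"
      by (simp add: B.free_lift_add word_eq E_F B.a_assoc)
    moreover have "a - b - (x - y) = a - (b + x + - y)" for a b x y :: "'i gen list \<Rightarrow>\<^sub>0 'k"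
      by (simp add: diff_diff_eq)
    ultimately show ?thesis
      using True free_lift_diff_eq_zero by (simp only: cartan_def single_uminus simp_thms if_True)
  qed (auto intro!: free_lift_diff_eq_zero simp: word_eq E_F)
  have tt: "g \<in> torus_gens \<Longrightarrow> h \<in> torus_gens \<Longrightarrow> free_lift B \<phi> (word 1 [g, h] - word 1 [h, g]) = \<zero>" for g h
    by (intro free_lift_diff_eq_zero) (simp add: word_eq torus_comm)
  have inv: "free_lift B \<phi> (word 1 [Om i, OmInv i] - word 1 []) = \<zero>"
    "free_lift B \<phi> (word 1 [Om' i, OmInv' i] - word 1 []) = \<zero>" for i
    by (intro free_lift_diff_eq_zero; simp add: word_eq Om_OmInv Om'_OmInv')+
  have cj: "free_lift B \<phi> (word 1 [Om i, E j, OmInv i] - word (q i j) [E j]) = \<zero>"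
    "free_lift B \<phi> (word 1 [Om' i, E j, OmInv' i] - word (inverse (q j i)) [E j]) = \<zero>"
    "free_lift B \<phi> (word 1 [Om i, F j, OmInv i] - word (inverse (q i j)) [F j]) = \<zero>"
    "free_lift B \<phi> (word 1 [Om' i, F j, OmInv' i] - word (q j i) [F j]) = \<zero>" for i j
    by (intro free_lift_diff_eq_zero; simp add: word_eq conj[OF Om_E Om_OmInv] conj[OF Om'_E Om'_OmInv']
        conj[OF Om_F Om_OmInv] conj[OF Om'_F Om'_OmInv'])+
  have serre: "i \<noteq> j \<Longrightarrow> serre_E A q i j \<in> serre_relators" "i \<noteq> j \<Longrightarrow> serre_F A q i j \<in> serre_relators" for i j
    unfolding serre_relators_def by blast+
  have "Uq_relators A q \<subseteq> serre_relators \<union> {p. free_lift B \<phi> p = \<zero>}"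
    unfolding Uq_relators_def
    by (intro Un_least subsetI; elim CollectE exE conjE;
        simp only: Un_iff mem_Collect_eq tt inv cj EF serre simp_thms not_False_eq_True)
  then show ?thesis using assms by blast
qed

lemma OmInv_Om: "\<phi> (OmInv i) \<otimes> \<phi> (Om i) = \<one>" and OmInv'_Om': "\<phi> (OmInv' i) \<otimes> \<phi> (Om' i) = \<one>"
  using torus_comm[of "OmInv i" "Om i"] torus_comm[of "OmInv' i" "Om' i"] by (simp_all add: Om_OmInv Om'_OmInv')

lemma inverse_qcommute:
  assumes "x \<otimes> y = c \<odot> (y \<otimes> x)" "x \<otimes> z = \<one>" "z \<otimes> x = \<one>" "c \<noteq> 0"
    and [simp]: "x \<in> carrier B" "y \<in> carrier B" "z \<in> carrier B"
  shows "z \<otimes> y = inverse c \<odot> (y \<otimes> z)"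
proof -
  have "y \<otimes> z = z \<otimes> (x \<otimes> y) \<otimes> z"
    using assms(3) by (simp add: B.m_assoc[symmetric])
  also have "\<dots> = c \<odot> (z \<otimes> y \<otimes> (x \<otimes> z))"
    unfolding assms(1) by (simp add: B.smult_mult_left B.smult_mult_right B.m_assoc)
  also have "\<dots> = c \<odot> (z \<otimes> y)" by (simp add: assms(2))
  finally show ?thesis using assms(4) by (simp add: B.smult_smult)
qed

lemma torus_E:
  assumes "g \<in> torus_gens"
  shows "\<phi> g \<otimes> \<phi> (E j) = torus_weight g j \<odot> (\<phi> (E j) \<otimes> \<phi> g)"
  using assms Om_E Om'_E inverse_qcommute[OF Om_E Om_OmInv OmInv_Om] inverse_qcommute[OF Om'_E Om'_OmInv' OmInv'_Om']
  by (auto simp: torus_gens_def)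

lemma torus_F:
  assumes "g \<in> torus_gens"
  shows "\<phi> g \<otimes> \<phi> (F j) = inverse (torus_weight g j) \<odot> (\<phi> (F j) \<otimes> \<phi> g)"
  using assms Om_F Om'_F inverse_qcommute[OF Om_F Om_OmInv OmInv_Om] inverse_qcommute[OF Om'_F Om'_OmInv' OmInv'_Om']
  by (auto simp: torus_gens_def)

lemma E_torus:
  assumes "g \<in> torus_gens"
  shows "\<phi> (E j) \<otimes> \<phi> g = inverse (torus_weight g j) \<odot> (\<phi> g \<otimes> \<phi> (E j))"
  by (simp add: torus_E[OF assms] B.smult_smult)

lemma F_torus:
  assumes "g \<in> torus_gens"
  shows "\<phi> (F j) \<otimes> \<phi> g = torus_weight g j \<odot> (\<phi> g \<otimes> \<phi> (F j))"
  by (simp add: torus_F[OF assms] B.smult_smult)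

lemma left_assoc:
  assumes "x \<otimes> y = c \<odot> (y \<otimes> x)" "x \<in> carrier B" "y \<in> carrier B" "z \<in> carrier B"
  shows "x \<otimes> (y \<otimes> z) = c \<odot> (y \<otimes> (x \<otimes> z))"
  using assms by (simp add: B.m_assoc[symmetric] B.smult_mult_left)

end

section \<open>The algebra U_q and its generators\<close>

context quantum_parameters
begin

abbreviation U :: "('k, ('i gen list \<Rightarrow>\<^sub>0 'k) set) module" where "U \<equiv> Uq A q"

abbreviation UU where "UU \<equiv> UqUq A q"

abbreviation T where "T \<equiv> utensor A q"

abbreviation u :: "'i gen \<Rightarrow> ('i gen list \<Rightarrow>\<^sub>0 'k) set" where "u \<equiv> ugen A q"

definition cl :: "('i gen list \<Rightarrow>\<^sub>0 'k) \<Rightarrow> ('i gen list \<Rightarrow>\<^sub>0 'k) set" where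
  "cl p = Uq_ideal A q +>\<^bsub>free_algebra\<^esub> p"

lemma ideal_Uq: "ideal (Uq_ideal A q) free_algebra"
  unfolding Uq_ideal_def by (rule FA.genideal_ideal) simp

sublocale U: K_algebra U
  unfolding Uq_def by (rule FA.K_algebra_quot_algebra[OF ideal_Uq])

sublocale UU: K_algebra_pair U U ..

sublocale UU: K_algebra UU
  by (rule UU.K_algebra_tensor)

lemma hom_cl: "alg_hom free_algebra U cl"
  unfolding Uq_def cl_def by (rule FA.alg_hom_coset[OF ideal_Uq])

lemma carrier_U: "carrier U = range cl"
  unfolding Uq_def cl_def by (subst FA.quot_algebra_carrier[OF ideal_Uq]) simp

lemma cl_closed [simp]: "cl p \<in> carrier U"
  by (simp add: carrier_U)

lemma cl_add: "cl (p + r) = cl p \<oplus>\<^bsub>U\<^esub> cl r"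
  using alg_homD(2)[OF hom_cl, of p r] by simp

lemma cl_scale: "cl (scale c p) = c \<odot>\<^bsub>U\<^esub> cl p"
  using alg_homD(5)[OF hom_cl, of p c] by simp

lemma cl_mult: "cl (p \<otimes>\<^bsub>free_algebra\<^esub> r) = cl p \<otimes>\<^bsub>U\<^esub> cl r"
  using alg_homD(3)[OF hom_cl, of p r] by simp

lemma cl_one: "cl (word 1 []) = \<one>\<^bsub>U\<^esub>"
  using alg_homD(4)[OF hom_cl] by simp

lemma cl_eq_iff: "cl p = cl r \<longleftrightarrow> p - r \<in> Uq_ideal A q"
  unfolding cl_def by (subst FA.coset_eq_iff[OF ideal_Uq]) (simp_all add: free_minus)

lemma cl_relator: "p - r \<in> Uq_relators A q \<Longrightarrow> cl p = cl r"
  unfolding cl_eq_iff Uq_ideal_def using FA.genideal_self[of "Uq_relators A q"] by auto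

lemma cl_zero: "cl 0 = \<zero>\<^bsub>U\<^esub>"
  using cl_scale[of 0 0] by simp

lemma u_eq: "u g = cl (word 1 [g])"
  by (simp add: ugen_def cl_def)

lemma u_closed [simp]: "u g \<in> carrier U"
  by (simp add: u_eq)

lemma cl_word_Cons: "cl (word 1 (g # w)) = u g \<otimes>\<^bsub>U\<^esub> cl (word 1 w)"
  using cl_mult[of "word 1 [g]" "word 1 w"] by (simp add: u_eq)

lemma cl_word_append: "cl (word 1 (v @ w)) = cl (word 1 v) \<otimes>\<^bsub>U\<^esub> cl (word 1 w)"
  using cl_mult[of "word 1 v" "word 1 w"] by simp

lemma cl_word: "cl (word c w) = c \<odot>\<^bsub>U\<^esub> cl (word 1 w)"
  using cl_scale[of c "word 1 w"] by simp

lemma linear_image_cl: "linear_image U cl"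
  by (simp add: linear_image_def carrier_U cl_add cl_scale)

sublocale uq_images A q U u
proof
  note simps = cl_word_Cons cl_one cl_word[where c="inverse x" for x] cl_word[where c="q i j" for i j]
  show comm: "u g \<otimes>\<^bsub>U\<^esub> u h = u h \<otimes>\<^bsub>U\<^esub> u g" if "g \<in> torus_gens" "h \<in> torus_gens" for g h
    using cl_relator[OF Uq_relators_intros(1)[OF that]] by (simp add: simps)
  have inv: "u (Om i) \<otimes>\<^bsub>U\<^esub> u (OmInv i) = \<one>\<^bsub>U\<^esub>" "u (Om' i) \<otimes>\<^bsub>U\<^esub> u (OmInv' i) = \<one>\<^bsub>U\<^esub>" for i
    using cl_relator[OF Uq_relators_intros(2)] cl_relator[OF Uq_relators_intros(3)] by (simp_all add: simps)
  then show "u (Om i) \<otimes>\<^bsub>U\<^esub> u (OmInv i) = \<one>\<^bsub>U\<^esub>" "u (Om' i) \<otimes>\<^bsub>U\<^esub> u (OmInv' i) = \<one>\<^bsub>U\<^esub>" for i by auto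
  \<comment> \<open>Multiplying the conjugation relation on the right by the torus generator removes
    its inverse.\<close>
  have unconj: "u g \<otimes>\<^bsub>U\<^esub> y = c \<odot>\<^bsub>U\<^esub> (y \<otimes>\<^bsub>U\<^esub> u g)"
    if "u g \<otimes>\<^bsub>U\<^esub> (y \<otimes>\<^bsub>U\<^esub> u h) = c \<odot>\<^bsub>U\<^esub> y" "u g \<otimes>\<^bsub>U\<^esub> u h = \<one>\<^bsub>U\<^esub>" "g \<in> torus_gens" "h \<in> torus_gens" "y \<in> carrier U" for g h c y
  proof -
    have hg: "u h \<otimes>\<^bsub>U\<^esub> u g = \<one>\<^bsub>U\<^esub>" using comm that by auto
    have "u g \<otimes>\<^bsub>U\<^esub> (y \<otimes>\<^bsub>U\<^esub> u h) \<otimes>\<^bsub>U\<^esub> u g = u g \<otimes>\<^bsub>U\<^esub> y"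
      using that(5) by (simp add: U.m_assoc hg)
    then show ?thesis using that by (simp add: U.smult_mult_left)
  qed
  show "u (Om i) \<otimes>\<^bsub>U\<^esub> u (E j) = q i j \<odot>\<^bsub>U\<^esub> (u (E j) \<otimes>\<^bsub>U\<^esub> u (Om i))" for i j
    by (rule unconj[of _ _ "OmInv i"], insert cl_relator[OF Uq_relators_intros(4)])
      (auto simp: simps inv)
  show "u (Om' i) \<otimes>\<^bsub>U\<^esub> u (E j) = inverse (q j i) \<odot>\<^bsub>U\<^esub> (u (E j) \<otimes>\<^bsub>U\<^esub> u (Om' i))" for i j
    by (rule unconj[of _ _ "OmInv' i"], insert cl_relator[OF Uq_relators_intros(5)])
      (auto simp: simps inv)
  show "u (Om i) \<otimes>\<^bsub>U\<^esub> u (F j) = inverse (q i j) \<odot>\<^bsub>U\<^esub> (u (F j) \<otimes>\<^bsub>U\<^esub> u (Om i))" for i j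
    by (rule unconj[of _ _ "OmInv i"], insert cl_relator[OF Uq_relators_intros(6)])
      (auto simp: simps inv)
  show "u (Om' i) \<otimes>\<^bsub>U\<^esub> u (F j) = q j i \<odot>\<^bsub>U\<^esub> (u (F j) \<otimes>\<^bsub>U\<^esub> u (Om' i))" for i j
    by (rule unconj[of _ _ "OmInv' i"], insert cl_relator[OF Uq_relators_intros(7)])
      (auto simp: simps inv)
  show "u (E i) \<otimes>\<^bsub>U\<^esub> u (F j) = u (F j) \<otimes>\<^bsub>U\<^esub> u (E i) \<oplus>\<^bsub>U\<^esub>
      (if i = j then cartan i \<odot>\<^bsub>U\<^esub> u (Om i) \<oplus>\<^bsub>U\<^esub> (- cartan i) \<odot>\<^bsub>U\<^esub> u (Om' i) else \<zero>\<^bsub>U\<^esub>)" for i j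
  proof -
    let ?r = "if i = j then word (cartan i) [Om i] - word (cartan i) [Om' i] else 0"
    have "word 1 [E i, F j] - word 1 [F j, E i] - ?r \<in> Uq_relators A q"
      unfolding cartan_def by (rule Uq_relators_intros)
    then have "cl (word 1 [E i, F j]) = cl (word 1 [F j, E i] + ?r)"
      by (intro cl_relator) (simp add: diff_diff_eq)
    moreover have "cl ?r = (if i = j then cartan i \<odot>\<^bsub>U\<^esub> u (Om i) \<oplus>\<^bsub>U\<^esub> (- cartan i) \<odot>\<^bsub>U\<^esub> u (Om' i) else \<zero>\<^bsub>U\<^esub>)"
    proof -
      have "word (cartan i) [Om i] - word (cartan i) [Om' i] = word (cartan i) [Om i] + word (- cartan i) [Om' i]"
        by (simp add: single_uminus)
      moreover have "cl (word (cartan i) [Om i] + word (- cartan i) [Om' i])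
          = cartan i \<odot>\<^bsub>U\<^esub> u (Om i) \<oplus>\<^bsub>U\<^esub> (- cartan i) \<odot>\<^bsub>U\<^esub> u (Om' i)"
        by (simp add: cl_add u_eq cl_word[where c="cartan i"] cl_word[where c="- cartan i"])
      ultimately have *: "cl (word (cartan i) [Om i] - word (cartan i) [Om' i])
          = cartan i \<odot>\<^bsub>U\<^esub> u (Om i) \<oplus>\<^bsub>U\<^esub> (- cartan i) \<odot>\<^bsub>U\<^esub> u (Om' i)" by (simp only:)
      show ?thesis
      proof (cases "i = j")
        case True
        show ?thesis unfolding if_P[OF True] by (rule *)
      qed (simp add: cl_zero)
    qed
    ultimately show ?thesis by (simp add: cl_add cl_word_Cons cl_one)
  qed
qed simp_all

lemma serre_zero:
  assumes "i \<noteq> j"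
  shows "U.qcomms (u (E i)) (serre_powers i j) (u (E j)) = \<zero>\<^bsub>U\<^esub>"
    and "K_algebra.qcomms (opp_algebra U) (u (F i)) (serre_powers i j) (u (F j)) = \<zero>\<^bsub>U\<^esub>"
proof -
  have "serre_E A q i j - 0 \<in> Uq_relators A q" "serre_F A q i j - 0 \<in> Uq_relators A q"
    using assms by (simp_all add: Uq_relators_intros)
  from this[THEN cl_relator] show "U.qcomms (u (E i)) (serre_powers i j) (u (E j)) = \<zero>\<^bsub>U\<^esub>"
    "K_algebra.qcomms (opp_algebra U) (u (F i)) (serre_powers i j) (u (F j)) = \<zero>\<^bsub>U\<^esub>"
    using qcomms_hom[OF FA.K_algebra_axioms U.K_algebra_axioms hom_cl]
      qcomms_hom[OF K_algebra_free_opp K_algebra_opp[OF U.K_algebra_axioms] alg_hom_opp[OF hom_cl]]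
    by (simp_all add: serre_E_eq[OF assms] serre_F_eq[OF assms] u_eq cl_zero)
qed

lemma the_elem_cl:
  assumes "K_algebra B" "alg_hom free_algebra B h" "\<And>p. p \<in> Uq_relators A q \<Longrightarrow> h p = \<zero>\<^bsub>B\<^esub>"
  shows "the_elem (h ` cl p) = h p"
  unfolding cl_def Uq_ideal_def using assms by (intro FA.the_elem_coset) auto

end

subsection \<open>The coproduct on words\<close>

text \<open>\<open>csum f w\<close> is the sum of \<open>f u v\<close> over the terms \<open>u \<otimes> v\<close> of the coproduct of the word \<open>w\<close>.\<close>

fun csum :: "('i gen list \<Rightarrow> 'i gen list \<Rightarrow> 'b::comm_monoid_add) \<Rightarrow> 'i gen list \<Rightarrow> 'b" where
  "csum f [] = f [] []"
| "csum f (E i # w) = csum (\<lambda>u v. f (E i # u) v) w + csum (\<lambda>u v. f (Om i # u) (E i # v)) w"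
| "csum f (F i # w) = csum (\<lambda>u v. f u (F i # v)) w + csum (\<lambda>u v. f (F i # u) (Om' i # v)) w"
| "csum f (g # w) = csum (\<lambda>u v. f (g # u) (g # v)) w"

lemma csum_torus: "g \<in> torus_gens \<Longrightarrow> csum f (g # w) = csum (\<lambda>u v. f (g # u) (g # v)) w"
  by (auto simp: torus_gens_def)

lemma gen_cases: "(\<And>i. g = E i \<Longrightarrow> P) \<Longrightarrow> (\<And>i. g = F i \<Longrightarrow> P) \<Longrightarrow> (g \<in> torus_gens \<Longrightarrow> P) \<Longrightarrow> P"
  by (cases g) auto

lemma csum_hom:
  assumes "\<And>x y. h (x + y) = h x + h y"
  shows "h (csum f w) = csum (\<lambda>u v. h (f u v)) w"
proof (induction w arbitrary: f)
  case (Cons g w)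
  then show ?case by (cases g rule: gen_cases) (simp_all add: assms csum_torus)
qed simp

lemma csum_add: "csum (\<lambda>u v. f u v + f' u v) w = csum f w + csum f' w"
proof (induction w arbitrary: f f')
  case (Cons g w)
  then show ?case by (cases g rule: gen_cases) (simp_all add: csum_torus ac_simps)
qed simp

lemma csum_append: "csum f (w @ w') = csum (\<lambda>u v. csum (\<lambda>u' v'. f (u @ u') (v @ v')) w') w"
proof (induction w arbitrary: f)
  case (Cons g w)
  then show ?case by (cases g rule: gen_cases) (simp_all add: csum_torus)
qed simp

text \<open>Coassociativity on words: for a leading e_i or f_i both sides split into the same three
  terms, for a torus generator there is only one.\<close>

lemma csum_coassoc:
  "csum (\<lambda>u v. csum (\<lambda>s t. f s t v) u) w = csum (\<lambda>u v. csum (\<lambda>s t. f u s t) v) w"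
proof (induction w arbitrary: f)
  case (Cons g w)
  then show ?case by (cases g rule: gen_cases) (simp_all add: csum_torus csum_add ac_simps)
qed simp

text \<open>The closure conditions on S ensure that all terms of the coproduct of a word over S are
  again words over S.\<close>

lemma csum_cong:
  assumes "\<And>i. E i \<in> S \<Longrightarrow> Om i \<in> S" "\<And>i. F i \<in> S \<Longrightarrow> Om' i \<in> S"
    and "\<And>u v. u \<in> lists S \<Longrightarrow> v \<in> lists S \<Longrightarrow> f u v = f' u v" "w \<in> lists S"
  shows "csum f w = csum f' w"
  using assms(4,3)
proof (induction w arbitrary: f f')
  case (Cons g w)
  have "csum (\<lambda>u v. f (a u) (b v)) w = csum (\<lambda>u v. f' (a u) (b v)) w"
    if "\<And>u. u \<in> lists S \<Longrightarrow> a u \<in> lists S" "\<And>u. u \<in> lists S \<Longrightarrow> b u \<in> lists S" for a b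
    by (rule Cons.IH) (rule Cons.prems; rule that; assumption)
  note IH = this
  have g: "g \<in> S" using Cons.hyps by simp
  show ?case
  proof (cases g rule: gen_cases)
    case (1 i)
    have "Om i \<in> S" using g 1 assms(1) by simp
    then show ?thesis using g IH[of "\<lambda>u. E i # u" "\<lambda>v. v"] IH[of "\<lambda>u. Om i # u" "\<lambda>v. E i # v"]
      unfolding 1 by (simp only: csum.simps lists.Cons)
  next
    case (2 i)
    have "Om' i \<in> S" using g 2 assms(2) by simp
    then show ?thesis using g IH[of "\<lambda>u. u" "\<lambda>v. F i # v"] IH[of "\<lambda>u. F i # u" "\<lambda>v. Om' i # v"]
      unfolding 2 by (simp only: csum.simps lists.Cons)
  next
    case 3
    then show ?thesis using g IH[of "\<lambda>u. g # u" "\<lambda>v. g # v"] by (simp only: csum_torus lists.Cons)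
  qed
qed simp

lemma csum_mult_left: "csum (\<lambda>u v. c * f u v) w = c * csum f w" for c :: "'a::semiring_0"
  by (rule csum_hom[symmetric]) (simp add: distrib_left)

lemma csum_mult_right: "csum (\<lambda>u v. f u v * c) w = csum f w * c" for c :: "'a::semiring_0"
  by (rule csum_hom[where h="\<lambda>x. x * c", symmetric]) (simp add: distrib_right)

lemma csum_swap: "csum (\<lambda>u v. csum (\<lambda>s t. f u v s t) w') w = csum (\<lambda>s t. csum (\<lambda>u v. f u v s t) w) w'"
proof (induction w arbitrary: f)
  case (Cons g w)
  then show ?case by (cases g rule: gen_cases) (simp_all add: csum_torus csum_add)
qed simp

lemma keys_csum:
  assumes "\<And>i. E i \<in> S \<Longrightarrow> Om i \<in> S" "\<And>i. F i \<in> S \<Longrightarrow> Om' i \<in> S"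
    and "\<And>u v. u \<in> lists S \<Longrightarrow> v \<in> lists S \<Longrightarrow> Poly_Mapping.keys (f u v) \<subseteq> K" "w \<in> lists S"
  shows "Poly_Mapping.keys (csum f w) \<subseteq> K"
  using assms(4,3)
proof (induction w arbitrary: f)
  case (Cons g w)
  have "Poly_Mapping.keys (csum (\<lambda>u v. f (a u) (b v)) w) \<subseteq> K"
    if "\<And>u. u \<in> lists S \<Longrightarrow> a u \<in> lists S" "\<And>u. u \<in> lists S \<Longrightarrow> b u \<in> lists S" for a b
    by (rule Cons.IH) (rule Cons.prems; rule that; assumption)
  note IH = this
  have g: "g \<in> S" using Cons.hyps by simp
  show ?case
  proof (cases g rule: gen_cases)
    case (1 i)
    have "Om i \<in> S" using g 1 assms(1) by simp
    then show ?thesis using g IH[of "\<lambda>u. E i # u" "\<lambda>v. v"] IH[of "\<lambda>u. Om i # u" "\<lambda>v. E i # v"]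
      unfolding 1 by (simp only: csum.simps lists.Cons keys_add_subset)
  next
    case (2 i)
    have "Om' i \<in> S" using g 2 assms(2) by simp
    then show ?thesis using g IH[of "\<lambda>u. u" "\<lambda>v. F i # v"] IH[of "\<lambda>u. F i # u" "\<lambda>v. Om' i # v"]
      unfolding 2 by (simp only: csum.simps lists.Cons keys_add_subset)
  next
    case 3
    then show ?thesis using g IH[of "\<lambda>u. g # u" "\<lambda>v. g # v"] by (simp only: csum_torus lists.Cons)
  qed
qed simp

subsection \<open>The coproduct is well defined\<close>

context K_algebra
begin

text \<open>The shape of the product of the coproducts of e_i and f_i: x is the class of omega_i
  tensor omega'_i, which arises from both middle products with opposite signs.\<close>

lemma cancel_mixed_terms:
  assumes [simp]: "p \<in> carrier U" "a \<in> carrier U" "b \<in> carrier U" "d \<in> carrier U"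
    "x \<in> carrier U" "z \<in> carrier U" "w \<in> carrier U"
  shows "p \<oplus> (a \<oplus> (c \<odot> x \<oplus> (- c) \<odot> w)) \<oplus> ((b \<oplus> (c \<odot> z \<oplus> (- c) \<odot> x)) \<oplus> d)
    = (p \<oplus> b \<oplus> (a \<oplus> d)) \<oplus> (c \<odot> z \<oplus> (- c) \<odot> w)"
proof -
  have "p \<oplus> (a \<oplus> (c \<odot> x \<oplus> (- c) \<odot> w)) \<oplus> ((b \<oplus> (c \<odot> z \<oplus> (- c) \<odot> x)) \<oplus> d)
    = ((p \<oplus> b \<oplus> (a \<oplus> d)) \<oplus> (c \<odot> z \<oplus> (- c) \<odot> w)) \<oplus> (c \<odot> x \<oplus> (- c) \<odot> x)"
    by (simp add: a_ac del: smult_add_cancel)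
  then show ?thesis by simp
qed

end

context quantum_parameters
begin

lemmas T_mult = UU.pure_tensor_mult
lemmas T_linear = UU.pure_tensor_add_left UU.pure_tensor_add_right UU.pure_tensor_smult_left
    UU.pure_tensor_smult_right

lemma T_closed [simp]: "x \<in> carrier U \<Longrightarrow> y \<in> carrier U \<Longrightarrow> T x y \<in> carrier UU"
  by (rule UU.pure_tensor_closed)

lemma hom_T_left: "alg_hom U UU (\<lambda>x. T x \<one>\<^bsub>U\<^esub>)" and hom_T_right: "alg_hom U UU (T \<one>\<^bsub>U\<^esub>)"
  by (auto simp: alg_hom_def T_mult T_linear UU.one_tensor intro!: ring_hom_memI)

lemma comult_gen_torus: "g \<in> torus_gens \<Longrightarrow> comult_gen A q g = T (u g) (u g)"
  by (auto simp: torus_gens_def)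

sublocale comult: uq_images A q UU "comult_gen A q"
proof
  show "comult_gen A q g \<in> carrier UU" for g
    by (cases g) (simp_all add: UU.add.m_closed)
  note simps = T_mult T_linear UU.l_distr UU.r_distr UU.smult_r_distr U.smult_mult_left U.smult_mult_right
  show "comult_gen A q g \<otimes>\<^bsub>UU\<^esub> comult_gen A q h = comult_gen A q h \<otimes>\<^bsub>UU\<^esub> comult_gen A q g"
    if "g \<in> torus_gens" "h \<in> torus_gens" for g h
    using that torus_comm[OF that] by (simp add: comult_gen_torus T_mult)
  show "comult_gen A q (Om i) \<otimes>\<^bsub>UU\<^esub> comult_gen A q (OmInv i) = \<one>\<^bsub>UU\<^esub>"
    "comult_gen A q (Om' i) \<otimes>\<^bsub>UU\<^esub> comult_gen A q (OmInv' i) = \<one>\<^bsub>UU\<^esub>" for i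
    by (simp_all add: T_mult Om_OmInv Om'_OmInv' UU.one_tensor)
  show "comult_gen A q (Om i) \<otimes>\<^bsub>UU\<^esub> comult_gen A q (E j) = q i j \<odot>\<^bsub>UU\<^esub> (comult_gen A q (E j) \<otimes>\<^bsub>UU\<^esub> comult_gen A q
      (Om i))" for i j
    using torus_comm[of "Om i" "Om j"] by (simp add: simps Om_E)
  show "comult_gen A q (Om' i) \<otimes>\<^bsub>UU\<^esub> comult_gen A q (E j) = inverse (q j i) \<odot>\<^bsub>UU\<^esub> (comult_gen A q (E j) \<otimes>\<^bsub>UU\<^esub> comult_gen A q
      (Om' i))" for i j
    using torus_comm[of "Om' i" "Om j"] by (simp add: simps Om'_E)
  show "comult_gen A q (Om i) \<otimes>\<^bsub>UU\<^esub> comult_gen A q (F j) = inverse (q i j) \<odot>\<^bsub>UU\<^esub> (comult_gen A q (F j) \<otimes>\<^bsub>UU\<^esub> comult_gen A q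
      (Om i))" for i j
    using torus_comm[of "Om i" "Om' j"] by (simp add: simps Om_F)
  show "comult_gen A q (Om' i) \<otimes>\<^bsub>UU\<^esub> comult_gen A q (F j) = q j i \<odot>\<^bsub>UU\<^esub> (comult_gen A q (F j) \<otimes>\<^bsub>UU\<^esub> comult_gen A q (Om' i))"
      for i j
    using torus_comm[of "Om' i" "Om' j"] by (simp add: simps Om'_F)
  show "comult_gen A q (E i) \<otimes>\<^bsub>UU\<^esub> comult_gen A q (F j) = comult_gen A q (F j) \<otimes>\<^bsub>UU\<^esub> comult_gen A q (E i) \<oplus>\<^bsub>UU\<^esub>
      (if i = j then cartan i \<odot>\<^bsub>UU\<^esub> comult_gen A q (Om i) \<oplus>\<^bsub>UU\<^esub> (- cartan i) \<odot>\<^bsub>UU\<^esub> comult_gen A q (Om' i) else \<zero>\<^bsub>UU\<^esub>)" for i j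
  proof -
    \<comment> \<open>With coefficient 0 for distinct indices both cases of the relation become a
      single computation.\<close>
    let ?c = "if i = j then cartan i else 0"
    have EF: "u (E i) \<otimes>\<^bsub>U\<^esub> u (F j) = u (F j) \<otimes>\<^bsub>U\<^esub> u (E i) \<oplus>\<^bsub>U\<^esub> (?c \<odot>\<^bsub>U\<^esub> u (Om i) \<oplus>\<^bsub>U\<^esub> (- ?c) \<odot>\<^bsub>U\<^esub> u (Om' j))"
      by (simp add: E_F)
    \<comment> \<open>Reordering omega_i f_j in the left factor and omega'_j e_i in the right factor
      costs the same scalar 1/q_ij.\<close>
    have cross: "T (u (Om i) \<otimes>\<^bsub>U\<^esub> u (F j)) (u (E i) \<otimes>\<^bsub>U\<^esub> u (Om' j)) = T (u (F j) \<otimes>\<^bsub>U\<^esub> u (Om i)) (u (Om' j) \<otimes>\<^bsub>U\<^esub> u (E i))"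
      by (simp add: Om_F Om'_E T_linear)
    have "comult_gen A q (E i) \<otimes>\<^bsub>UU\<^esub> comult_gen A q (F j)
      = T (u (E i)) (u (F j)) \<oplus>\<^bsub>UU\<^esub> (T (u (Om i)) (u (F j) \<otimes>\<^bsub>U\<^esub> u (E i)) \<oplus>\<^bsub>UU\<^esub>
          (?c \<odot>\<^bsub>UU\<^esub> T (u (Om i)) (u (Om i)) \<oplus>\<^bsub>UU\<^esub> (- ?c) \<odot>\<^bsub>UU\<^esub> T (u (Om i)) (u (Om' j)))) \<oplus>\<^bsub>UU\<^esub>
        ((T (u (F j) \<otimes>\<^bsub>U\<^esub> u (E i)) (u (Om' j)) \<oplus>\<^bsub>UU\<^esub>
          (?c \<odot>\<^bsub>UU\<^esub> T (u (Om i)) (u (Om' j)) \<oplus>\<^bsub>UU\<^esub> (- ?c) \<odot>\<^bsub>UU\<^esub> T (u (Om' j)) (u (Om' j)))) \<oplus>\<^bsub>UU\<^esub>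
         T (u (F j) \<otimes>\<^bsub>U\<^esub> u (Om i)) (u (Om' j) \<otimes>\<^bsub>U\<^esub> u (E i)))"
      by (simp only: comult_gen.simps UU.l_distr UU.r_distr T_mult T_closed u_closed U.one_closed UU.add.m_closed
          U.l_one U.r_one EF cross T_linear U.m_closed U.smult_closed U.add.m_closed)
    also have "\<dots> = T (u (E i)) (u (F j)) \<oplus>\<^bsub>UU\<^esub> (T (u (F j) \<otimes>\<^bsub>U\<^esub> u (E i)) (u (Om' j)) \<oplus>\<^bsub>UU\<^esub>
          (?c \<odot>\<^bsub>UU\<^esub> T (u (Om i)) (u (Om' j)) \<oplus>\<^bsub>UU\<^esub> (- ?c) \<odot>\<^bsub>UU\<^esub> T (u (Om' j)) (u (Om' j)))) \<oplus>\<^bsub>UU\<^esub>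
        ((T (u (Om i)) (u (F j) \<otimes>\<^bsub>U\<^esub> u (E i)) \<oplus>\<^bsub>UU\<^esub>
          (?c \<odot>\<^bsub>UU\<^esub> T (u (Om i)) (u (Om i)) \<oplus>\<^bsub>UU\<^esub> (- ?c) \<odot>\<^bsub>UU\<^esub> T (u (Om i)) (u (Om' j)))) \<oplus>\<^bsub>UU\<^esub>
         T (u (F j) \<otimes>\<^bsub>U\<^esub> u (Om i)) (u (Om' j) \<otimes>\<^bsub>U\<^esub> u (E i)))"
      by (simp add: UU.a_ac del: UU.smult_add_cancel)
    also have "\<dots> = (T (u (E i)) (u (F j)) \<oplus>\<^bsub>UU\<^esub> T (u (Om i)) (u (F j) \<otimes>\<^bsub>U\<^esub> u (E i)) \<oplus>\<^bsub>UU\<^esub>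
        (T (u (F j) \<otimes>\<^bsub>U\<^esub> u (E i)) (u (Om' j)) \<oplus>\<^bsub>UU\<^esub> T (u (F j) \<otimes>\<^bsub>U\<^esub> u (Om i)) (u (Om' j) \<otimes>\<^bsub>U\<^esub> u (E i))))
        \<oplus>\<^bsub>UU\<^esub> (?c \<odot>\<^bsub>UU\<^esub> T (u (Om i)) (u (Om i)) \<oplus>\<^bsub>UU\<^esub> (- ?c) \<odot>\<^bsub>UU\<^esub> T (u (Om' j)) (u (Om' j)))"
      by (rule UU.cancel_mixed_terms) simp_all
    also have "T (u (E i)) (u (F j)) \<oplus>\<^bsub>UU\<^esub> T (u (Om i)) (u (F j) \<otimes>\<^bsub>U\<^esub> u (E i)) \<oplus>\<^bsub>UU\<^esub>
        (T (u (F j) \<otimes>\<^bsub>U\<^esub> u (E i)) (u (Om' j)) \<oplus>\<^bsub>UU\<^esub> T (u (F j) \<otimes>\<^bsub>U\<^esub> u (Om i)) (u (Om' j) \<otimes>\<^bsub>U\<^esub> u (E i)))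
        = comult_gen A q (F j) \<otimes>\<^bsub>UU\<^esub> comult_gen A q (E i)"
      by (simp add: UU.l_distr UU.r_distr T_mult UU.a_ac)
    finally show ?thesis by simp
  qed
qed

text \<open>\<open>qcomms_sum\<close> separates the two summands of the coproduct. The first
  contributes the image of the Serre element under x -> x tensor 1. In the second, omega_i tensor 1
  commutes with 1 tensor e_j, so extracting it leaves the parameters unchanged and again a Serre
  element appears.\<close>

lemma comult_serre_E:
  assumes "i \<noteq> j"
  shows "UU.qcomms (comult_gen A q (E i)) (serre_powers i j) (comult_gen A q (E j)) = \<zero>\<^bsub>UU\<^esub>"
proof -
  let ?cs = "serre_powers i j"
  have "UU.qcomms (T (u (E i)) \<one>\<^bsub>U\<^esub> \<oplus>\<^bsub>UU\<^esub> T (u (Om i)) (u (E i))) ?cs (T (u (E j)) \<one>\<^bsub>U\<^esub> \<oplus>\<^bsub>UU\<^esub> T (u (Om j)) (u (E j)))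
    = UU.qcomms (T (u (E i)) \<one>\<^bsub>U\<^esub>) ?cs (T (u (E j)) \<one>\<^bsub>U\<^esub>) \<oplus>\<^bsub>UU\<^esub> UU.qcomms (T (u (Om i)) (u (E i))) ?cs (T (u (Om j)) (u
        (E j)))"
    unfolding serre_powers_def using q_serre_degree[OF assms]
    by (intro UU.qcomms_sum[where s="q j i"]) (simp_all add: T_mult T_linear Om_E)
  moreover have "UU.qcomms (T (u (E i)) \<one>\<^bsub>U\<^esub>) ?cs (T (u (E j)) \<one>\<^bsub>U\<^esub>) = \<zero>\<^bsub>UU\<^esub>"
    using qcomms_hom[OF U.K_algebra_axioms UU.K_algebra_axioms hom_T_left, of "u (E i)" "u (E j)" ?cs]
      alg_hom_zero[OF U.K_algebra_axioms UU.K_algebra_axioms hom_T_left] serre_zero(1)[OF assms] by simp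
  moreover have "UU.qcomms (T (u (Om i)) (u (E i))) ?cs (T (u (Om j)) (u (E j))) = \<zero>\<^bsub>UU\<^esub>"
  proof -
    have "UU.qcomms (T \<one>\<^bsub>U\<^esub> (u (E i))) ?cs (T \<one>\<^bsub>U\<^esub> (u (E j))) = \<zero>\<^bsub>UU\<^esub>"
      using qcomms_hom[OF U.K_algebra_axioms UU.K_algebra_axioms hom_T_right, of "u (E i)" "u (E j)" ?cs]
        alg_hom_zero[OF U.K_algebra_axioms UU.K_algebra_axioms hom_T_right] serre_zero(1)[OF assms] by simp
    moreover have "\<exists>\<gamma>. \<exists>M\<in>carrier UU. UU.qcomms (T (u (Om i)) \<one>\<^bsub>U\<^esub> \<otimes>\<^bsub>UU\<^esub> T \<one>\<^bsub>U\<^esub> (u (E i))) ?cs (T (u (Om j)) \<one>\<^bsub>U\<^esub> \<otimes>\<^bsub>UU\<^esub> T \<one>\<^bsub>U\<^esub> (u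
        (E j)))
      = \<gamma> \<odot>\<^bsub>UU\<^esub> (M \<otimes>\<^bsub>UU\<^esub> UU.qcomms (T \<one>\<^bsub>U\<^esub> (u (E i))) (qpowers (q i i) (q i j * 1 / 1) (Suc (serre_degree i j))) (T \<one>\<^bsub>U\<^esub> (u
          (E j))))"
      unfolding serre_powers_def using torus_comm[of "Om i" "Om j"]
      by (intro UU.qcomms_twisted[where \<rho>=1]) (simp_all add: T_mult)
    ultimately show ?thesis by (auto simp: T_mult serre_powers_def)
  qed
  ultimately show ?thesis by simp
qed

text \<open>The same argument in the opposite algebra; there the summand carrying a torus factor,
  f_i tensor omega'_i, has to take the first place for the q-commutation to have the right
  direction.\<close>

lemma comult_serre_F:
  assumes "i \<noteq> j"
  shows "K_algebra.qcomms (opp_algebra UU) (comult_gen A q (F i)) (serre_powers i j) (comult_gen A q (F j)) = \<zero>\<^bsub>UU\<^esub>"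
proof -
  interpret O: K_algebra "opp_algebra UU" by (rule K_algebra_opp) (rule UU.K_algebra_axioms)
  have KO: "K_algebra (opp_algebra U)" by (rule K_algebra_opp) (rule U.K_algebra_axioms)
  let ?cs = "serre_powers i j"
  have "O.qcomms (T (u (F i)) (u (Om' i)) \<oplus>\<^bsub>opp_algebra UU\<^esub> T \<one>\<^bsub>U\<^esub> (u (F i))) ?cs (T (u (F j)) (u (Om' j))
      \<oplus>\<^bsub>opp_algebra UU\<^esub> T \<one>\<^bsub>U\<^esub> (u (F j)))
    = O.qcomms (T (u (F i)) (u (Om' i))) ?cs (T (u (F j)) (u (Om' j))) \<oplus>\<^bsub>opp_algebra UU\<^esub> O.qcomms (T \<one>\<^bsub>U\<^esub> (u (F i))) ?cs
        (T \<one>\<^bsub>U\<^esub> (u (F j)))"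
    unfolding serre_powers_def using q_serre_degree[OF assms]
    by (intro O.qcomms_sum[where s="q j i"]) (simp_all add: T_mult T_linear Om'_F)
  moreover have "O.qcomms (T \<one>\<^bsub>U\<^esub> (u (F i))) ?cs (T \<one>\<^bsub>U\<^esub> (u (F j))) = \<zero>\<^bsub>UU\<^esub>"
    using qcomms_hom[OF KO O.K_algebra_axioms alg_hom_opp[OF hom_T_right], of "u (F i)" "u (F j)" ?cs]
      alg_hom_zero[OF U.K_algebra_axioms UU.K_algebra_axioms hom_T_right] serre_zero(2)[OF assms] by simp
  moreover have "O.qcomms (T (u (F i)) (u (Om' i))) ?cs (T (u (F j)) (u (Om' j))) = \<zero>\<^bsub>UU\<^esub>"
  proof -
    have "O.qcomms (T (u (F i)) \<one>\<^bsub>U\<^esub>) ?cs (T (u (F j)) \<one>\<^bsub>U\<^esub>) = \<zero>\<^bsub>UU\<^esub>"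
      using qcomms_hom[OF KO O.K_algebra_axioms alg_hom_opp[OF hom_T_left], of "u (F i)" "u (F j)" ?cs]
        alg_hom_zero[OF U.K_algebra_axioms UU.K_algebra_axioms hom_T_left] serre_zero(2)[OF assms] by simp
    moreover have "\<exists>\<gamma>. \<exists>M\<in>carrier (opp_algebra UU). O.qcomms (T \<one>\<^bsub>U\<^esub> (u (Om' i)) \<otimes>\<^bsub>opp_algebra UU\<^esub> T (u (F i)) \<one>\<^bsub>U\<^esub>) ?cs
        (T \<one>\<^bsub>U\<^esub> (u (Om' j)) \<otimes>\<^bsub>opp_algebra UU\<^esub> T (u (F j)) \<one>\<^bsub>U\<^esub>)
      = \<gamma> \<odot>\<^bsub>opp_algebra UU\<^esub> (M \<otimes>\<^bsub>opp_algebra UU\<^esub> O.qcomms (T (u (F i)) \<one>\<^bsub>U\<^esub>) (qpowers (q i i) (q i j * 1 / 1) (Suc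
          (serre_degree i j))) (T (u (F j)) \<one>\<^bsub>U\<^esub>))"
      unfolding serre_powers_def using torus_comm[of "Om' i" "Om' j"]
      by (intro O.qcomms_twisted[where \<rho>=1]) (simp_all add: T_mult)
    ultimately show ?thesis by (auto simp: T_mult serre_powers_def)
  qed
  ultimately show ?thesis by (simp add: UU.a_comm)
qed

lemma free_lift_serre:
  assumes "K_algebra B" "\<And>g. \<phi> g \<in> carrier B" "i \<noteq> j"
  shows "free_lift B \<phi> (serre_E A q i j) = K_algebra.qcomms B (\<phi> (E i)) (serre_powers i j) (\<phi> (E j))"
    and "free_lift B \<phi> (serre_F A q i j) = K_algebra.qcomms (opp_algebra B) (\<phi> (F i)) (serre_powers i j) (\<phi> (F j))"
proof -
  interpret B: K_algebra B by fact
  have hom: "alg_hom free_algebra B (free_lift B \<phi>)" using assms(2) by (rule B.alg_hom_free_lift)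
  have gen: "free_lift B \<phi> (word 1 [g]) = \<phi> g" for g
    using B.free_lift_word[where \<phi>=\<phi> and c=1 and w="[g]"] assms(2) by (simp add: B.word_image_def)
  show "free_lift B \<phi> (serre_E A q i j) = B.qcomms (\<phi> (E i)) (serre_powers i j) (\<phi> (E j))"
    using qcomms_hom[OF FA.K_algebra_axioms assms(1) hom] by (simp add: serre_E_eq[OF assms(3)] gen)
  show "free_lift B \<phi> (serre_F A q i j) = K_algebra.qcomms (opp_algebra B) (\<phi> (F i)) (serre_powers i j) (\<phi> (F j))"
    using qcomms_hom[OF K_algebra_free_opp K_algebra_opp[OF assms(1)] alg_hom_opp[OF hom]]
    by (simp add: serre_F_eq[OF assms(3)] gen)
qed

lemma comult_cl: "comult A q (cl p) = free_lift UU (comult_gen A q) p"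
  unfolding comult_def
proof (rule the_elem_cl[OF UU.K_algebra_axioms comult.hom])
  fix p assume p: "p \<in> Uq_relators A q"
  show "free_lift UU (comult_gen A q) p = \<zero>\<^bsub>UU\<^esub>"
  proof (cases "p \<in> serre_relators")
    case True
    then show ?thesis
      using free_lift_serre[OF UU.K_algebra_axioms, of "comult_gen A q"] comult_serre_E comult_serre_F
      unfolding serre_relators_def by auto
  qed (use p comult.kills_relators in blast)
qed

text \<open>An explicit representative of the coproduct. Its support can be controlled, as
  \<open>tensor_sub\<close> and \<open>tensor_pairing\<close> demand of representatives.\<close>

definition word_coproduct :: "'i gen list \<Rightarrow> _ \<times> _ \<Rightarrow>\<^sub>0 'k" where
  "word_coproduct w = csum (\<lambda>u v. Poly_Mapping.single (cl (word 1 u), cl (word 1 v)) 1) w"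

definition coproduct :: "('i gen list \<Rightarrow>\<^sub>0 'k) \<Rightarrow> _ \<times> _ \<Rightarrow>\<^sub>0 'k" where
  "coproduct p = (\<Sum>w\<in>Poly_Mapping.keys p. scale (Poly_Mapping.lookup p w) (word_coproduct w))"

lemma coproduct_add: "coproduct (p + r) = coproduct p + coproduct r"
  unfolding coproduct_def
  by (rule sum_keys_add) (auto intro!: poly_mapping_eqI simp: lookup_add algebra_simps)

lemma coproduct_word: "coproduct (word c w) = scale c (word_coproduct w)"
proof -
  have "scale 0 r = 0" for r :: "('b \<Rightarrow>\<^sub>0 'k)" by (rule poly_mapping_eqI) simp
  then show ?thesis unfolding coproduct_def by (intro sum_keys_single)
qed

lemma keys_word_coproduct: "Poly_Mapping.keys (word_coproduct w) \<subseteq> carrier U \<times> carrier U"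
  unfolding word_coproduct_def by (rule keys_csum[where S=UNIV]) auto

lemma keys_coproduct: "Poly_Mapping.keys (coproduct p) \<subseteq> carrier U \<times> carrier U"
  unfolding coproduct_def
  by (rule keys_sum_subset) (rule order_trans[OF keys_scale keys_word_coproduct])

lemma hom_tensor_class: "alg_hom UU.pairs UU (tensor_class U U)"
  by (rule UU.alg_hom_tensor_class)

lemma word_coproduct_Cons:
  "tensor_class U U (word_coproduct (g # w)) = comult_gen A q g \<otimes>\<^bsub>UU\<^esub> tensor_class U U (word_coproduct w)"
proof -
  let ?s = "\<lambda>a b. Poly_Mapping.single (cl (word 1 a), cl (word 1 b)) (1 :: 'k)"
  have mult: "?s a b \<otimes>\<^bsub>UU.pairs\<^esub> word_coproduct w = csum (\<lambda>u v. ?s (a @ u) (b @ v)) w" for a b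
    unfolding word_coproduct_def
    by (subst csum_hom[where h="\<lambda>x. ?s a b \<otimes>\<^bsub>UU.pairs\<^esub> x"])
      (simp_all add: monoid_algebra_mult_add_right monoid_algebra_mult_single cl_word_append)
  have T: "T (cl (word 1 a)) (cl (word 1 b)) \<otimes>\<^bsub>UU\<^esub> tensor_class U U (word_coproduct w)
      = tensor_class U U (csum (\<lambda>u v. ?s (a @ u) (b @ v)) w)" for a b
    unfolding mult[symmetric] pure_tensor_def
    by (rule alg_homD(3)[OF hom_tensor_class, symmetric]) (use keys_word_coproduct in auto)
  have keys: "csum (\<lambda>u v. ?s (a @ u) (b @ v)) w \<in> carrier UU.pairs" for a b
    using keys_csum[where S=UNIV and f="\<lambda>u v. ?s (a @ u) (b @ v)" and w=w and K="carrier U \<times> carrier U"] by auto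
  have c: "tensor_class U U (word_coproduct w) \<in> carrier UU"
    by (rule alg_homD(1)[OF hom_tensor_class]) (use keys_word_coproduct in auto)
  show ?thesis
  proof (cases g rule: gen_cases)
    case (1 i)
    have "tensor_class U U (word_coproduct (g # w)) = tensor_class U U (csum (\<lambda>u v. ?s ([E i] @ u) ([] @ v)) w)
        \<oplus>\<^bsub>UU\<^esub> tensor_class U U (csum (\<lambda>u v. ?s ([Om i] @ u) ([E i] @ v)) w)"
      using alg_homD(2)[OF hom_tensor_class keys keys, of "[E i]" "[]" "[Om i]" "[E i]"]
      by (simp add: 1 word_coproduct_def[of "E i # w"])
    then show ?thesis using c by (simp only: T[symmetric]) (simp add: 1 UU.l_distr u_eq cl_one)
  next
    case (2 i)
    have "tensor_class U U (word_coproduct (g # w)) = tensor_class U U (csum (\<lambda>u v. ?s ([] @ u) ([F i] @ v)) w)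
        \<oplus>\<^bsub>UU\<^esub> tensor_class U U (csum (\<lambda>u v. ?s ([F i] @ u) ([Om' i] @ v)) w)"
      using alg_homD(2)[OF hom_tensor_class keys keys, of "[]" "[F i]" "[F i]" "[Om' i]"]
      by (simp add: 2 word_coproduct_def[of "F i # w"])
    then show ?thesis using c by (simp only: T[symmetric]) (simp add: 2 UU.l_distr u_eq cl_one)
  next
    case 3
    then show ?thesis using T[of "[g]" "[g]"]
      by (simp add: comult_gen_torus u_eq word_coproduct_def[of "g # w"] csum_torus)
  qed
qed

lemma comult_eq: "comult A q (cl p) = tensor_class U U (coproduct p)"
proof -
  have w: "tensor_class U U (word_coproduct w) = UU.word_image (comult_gen A q) w" for w
  proof (induction w)
    case Nil
    then show ?case by (simp add: word_coproduct_def UU.one_tensor pure_tensor_def cl_one)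
  qed (simp add: word_coproduct_Cons)
  have "free_lift UU (comult_gen A q) p = tensor_class U U (coproduct p)"
  proof (rule keys_induct[of p UNIV])
    show "free_lift UU (comult_gen A q) 0 = tensor_class U U (coproduct 0)"
      using alg_hom_zero[OF UU.pairs.K_algebra_axioms UU.K_algebra_axioms hom_tensor_class]
          UU.free_lift_zero[of "comult_gen A q"]
      by (simp add: coproduct_def)
  next
    fix k c p assume IH: "free_lift UU (comult_gen A q) p = tensor_class U U (coproduct p)"
    have "tensor_class U U (coproduct (word c k)) = c \<odot>\<^bsub>UU\<^esub> UU.word_image (comult_gen A q) k"
      using alg_homD(5)[OF hom_tensor_class, of "word_coproduct k" c] keys_word_coproduct
      by (simp add: coproduct_word w)
    then show "free_lift UU (comult_gen A q) (word c k + p) = tensor_class U U (coproduct (word c k + p))"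
      using alg_homD(2)[OF hom_tensor_class, of "coproduct (word c k)" "coproduct p"] keys_coproduct IH
        UU.free_lift_add[of "comult_gen A q" "word c k" p]
      by (simp add: coproduct_add comult.word_eq)
  qed simp
  then show ?thesis by (simp add: comult_cl)
qed

lemma lin_coproduct: "lin f (coproduct p) = lin (\<lambda>w. csum (\<lambda>u v. f (cl (word 1 u), cl (word 1 v))) w) p"
proof -
  have w: "lin f (word_coproduct w) = csum (\<lambda>u v. f (cl (word 1 u), cl (word 1 v))) w" for w
    unfolding word_coproduct_def by (subst csum_hom[where h="lin f"]) simp_all
  show ?thesis by (simp add: coproduct_def w) (simp add: lin_def)
qed

end

subsection \<open>The antipode is well defined\<close>

context quantum_parameters
begin

lemmas E_torus_assoc = left_assoc[OF E_torus] and F_torus_assoc = left_assoc[OF F_torus]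

lemma torus_comm_assoc:
  "g \<in> torus_gens \<Longrightarrow> h \<in> torus_gens \<Longrightarrow> z \<in> carrier U \<Longrightarrow>
    u g \<otimes>\<^bsub>U\<^esub> (u h \<otimes>\<^bsub>U\<^esub> z) = u h \<otimes>\<^bsub>U\<^esub> (u g \<otimes>\<^bsub>U\<^esub> z)"
  by (simp add: U.m_assoc[symmetric] torus_comm)

lemma antipode_gen_simps:
  "antipode_gen A q (E i) = (-1) \<odot>\<^bsub>U\<^esub> (u (OmInv i) \<otimes>\<^bsub>U\<^esub> u (E i))"
  "antipode_gen A q (F i) = (-1) \<odot>\<^bsub>U\<^esub> (u (F i) \<otimes>\<^bsub>U\<^esub> u (OmInv' i))"
  by (simp_all add: U.minus_eq_smult)

lemma antipode_gen_torus:
  assumes "g \<in> torus_gens"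
  shows "\<exists>g'\<in>torus_gens. antipode_gen A q g = u g'"
  using assms by (cases g; simp; metis torus_gens_simps)

sublocale UO: K_algebra "opp_algebra U"
  by (rule K_algebra_opp) (rule U.K_algebra_axioms)

text \<open>The antipode enters through the definition of the halves: the span of words must be
  recognised as a Hopf subalgebra, hence as closed under it.\<close>

sublocale antipode: uq_images A q "opp_algebra U" "antipode_gen A q"
proof (intro uq_images.intro uq_images_axioms.intro)
  show "K_algebra (opp_algebra U)" by (rule K_algebra_opp) (rule U.K_algebra_axioms)
  show "antipode_gen A q g \<in> carrier (opp_algebra U)" for g
    by (cases g) simp_all
  show "antipode_gen A q g \<otimes>\<^bsub>opp_algebra U\<^esub> antipode_gen A q h = antipode_gen A q h \<otimes>\<^bsub>opp_algebra U\<^esub> antipode_gen A q g"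
    if g: "g \<in> torus_gens" and h: "h \<in> torus_gens" for g h
    using antipode_gen_torus[OF g] antipode_gen_torus[OF h] torus_comm by auto
  show "antipode_gen A q (Om i) \<otimes>\<^bsub>opp_algebra U\<^esub> antipode_gen A q (OmInv i) = \<one>\<^bsub>opp_algebra U\<^esub>"
    "antipode_gen A q (Om' i) \<otimes>\<^bsub>opp_algebra U\<^esub> antipode_gen A q (OmInv' i) = \<one>\<^bsub>opp_algebra U\<^esub>" for i
    by (simp_all add: Om_OmInv Om'_OmInv')
  note simps = antipode_gen_simps U.smult_mult_left U.smult_mult_right U.m_assoc U.smult_smult E_torus F_torus
    E_torus_assoc F_torus_assoc mult_ac
  show "antipode_gen A q (Om i) \<otimes>\<^bsub>opp_algebra U\<^esub> antipode_gen A q (E j) = q i j \<odot>\<^bsub>opp_algebra U\<^esub> (antipode_gen A q (E j)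
      \<otimes>\<^bsub>opp_algebra U\<^esub> antipode_gen A q (Om i))" for i j
    by (simp add: simps torus_comm_assoc[of "OmInv i" "OmInv j"] del: antipode_gen.simps(1,2))
  show "antipode_gen A q (Om' i) \<otimes>\<^bsub>opp_algebra U\<^esub> antipode_gen A q (E j)
      = inverse (q j i) \<odot>\<^bsub>opp_algebra U\<^esub> (antipode_gen A q (E j) \<otimes>\<^bsub>opp_algebra U\<^esub> antipode_gen A q (Om' i))" for i j
    by (simp add: simps torus_comm_assoc[of "OmInv' i" "OmInv j"] del: antipode_gen.simps(1,2))
  show "antipode_gen A q (Om i) \<otimes>\<^bsub>opp_algebra U\<^esub> antipode_gen A q (F j)
      = inverse (q i j) \<odot>\<^bsub>opp_algebra U\<^esub> (antipode_gen A q (F j) \<otimes>\<^bsub>opp_algebra U\<^esub> antipode_gen A q (Om i))" for i j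
    by (simp add: simps torus_comm_assoc[of "OmInv i" "OmInv' j"] del: antipode_gen.simps(1,2))
  show "antipode_gen A q (Om' i) \<otimes>\<^bsub>opp_algebra U\<^esub> antipode_gen A q (F j) = q j i \<odot>\<^bsub>opp_algebra U\<^esub> (antipode_gen A q (F j)
      \<otimes>\<^bsub>opp_algebra U\<^esub> antipode_gen A q (Om' i))" for i j
    by (simp add: simps torus_comm_assoc[of "OmInv' i" "OmInv' j"] del: antipode_gen.simps(1,2))
  show "antipode_gen A q (E i) \<otimes>\<^bsub>opp_algebra U\<^esub> antipode_gen A q (F j)
      = antipode_gen A q (F j) \<otimes>\<^bsub>opp_algebra U\<^esub> antipode_gen A q (E i) \<oplus>\<^bsub>opp_algebra U\<^esub>
      (if i = j then cartan i \<odot>\<^bsub>opp_algebra U\<^esub> antipode_gen A q (Om i) \<oplus>\<^bsub>opp_algebra U\<^esub> (- cartan i) \<odot>\<^bsub>opp_algebra U\<^esub>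
          antipode_gen A q (Om' i) else \<zero>\<^bsub>opp_algebra U\<^esub>)" for i j
  proof -
    let ?c = "if i = j then cartan i else 0"
    have EF: "u (E i) \<otimes>\<^bsub>U\<^esub> u (F j) = u (F j) \<otimes>\<^bsub>U\<^esub> u (E i) \<oplus>\<^bsub>U\<^esub> (?c \<odot>\<^bsub>U\<^esub> u (Om i) \<oplus>\<^bsub>U\<^esub> (- ?c) \<odot>\<^bsub>U\<^esub> u (Om' j))"
      by (simp add: E_F)
    have 1: "u (OmInv i) \<otimes>\<^bsub>U\<^esub> (u (Om i) \<otimes>\<^bsub>U\<^esub> u (OmInv' j)) = u (OmInv' j)"
      by (simp add: U.m_assoc[symmetric] OmInv_Om)
    have 2: "u (OmInv i) \<otimes>\<^bsub>U\<^esub> (u (Om' j) \<otimes>\<^bsub>U\<^esub> u (OmInv' j)) = u (OmInv i)"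
      by (simp add: Om'_OmInv')
    have 3: "u (OmInv i) \<otimes>\<^bsub>U\<^esub> (u (F j) \<otimes>\<^bsub>U\<^esub> u (E i) \<otimes>\<^bsub>U\<^esub> u (OmInv' j)) = u (F j) \<otimes>\<^bsub>U\<^esub> u (OmInv' j) \<otimes>\<^bsub>U\<^esub> (u (OmInv i) \<otimes>\<^bsub>U\<^esub> u
        (E i))"
      by (simp add: simps torus_comm_assoc[of "OmInv i" "OmInv' j"])
    have "antipode_gen A q (F j) \<otimes>\<^bsub>opp_algebra U\<^esub> antipode_gen A q (E i)
      = u (OmInv i) \<otimes>\<^bsub>U\<^esub> (u (E i) \<otimes>\<^bsub>U\<^esub> u (F j) \<otimes>\<^bsub>U\<^esub> u (OmInv' j))"
      by (simp add: antipode_gen_simps U.smult_mult_left U.smult_mult_right U.smult_smult U.m_assoc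
          del: antipode_gen.simps)
    also have "\<dots> = u (F j) \<otimes>\<^bsub>U\<^esub> u (OmInv' j) \<otimes>\<^bsub>U\<^esub> (u (OmInv i) \<otimes>\<^bsub>U\<^esub> u (E i))
        \<oplus>\<^bsub>U\<^esub> (?c \<odot>\<^bsub>U\<^esub> u (OmInv' j) \<oplus>\<^bsub>U\<^esub> (- ?c) \<odot>\<^bsub>U\<^esub> u (OmInv i))"
      unfolding EF
      by (simp only: U.l_distr U.r_distr U.smult_mult_left U.smult_mult_right 1 2 3 U.m_closed U.smult_closed u_closed
          U.add.m_closed)
    also have "u (F j) \<otimes>\<^bsub>U\<^esub> u (OmInv' j) \<otimes>\<^bsub>U\<^esub> (u (OmInv i) \<otimes>\<^bsub>U\<^esub> u (E i))
       = antipode_gen A q (E i) \<otimes>\<^bsub>opp_algebra U\<^esub> antipode_gen A q (F j)"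
      by (simp add: antipode_gen_simps U.smult_mult_left U.smult_mult_right U.smult_smult del: antipode_gen.simps)
    finally have eq: "antipode_gen A q (F j) \<otimes>\<^bsub>opp_algebra U\<^esub> antipode_gen A q (E i)
      = antipode_gen A q (E i) \<otimes>\<^bsub>opp_algebra U\<^esub> antipode_gen A q (F j)
        \<oplus>\<^bsub>U\<^esub> (?c \<odot>\<^bsub>U\<^esub> u (OmInv' j) \<oplus>\<^bsub>U\<^esub> (- ?c) \<odot>\<^bsub>U\<^esub> u (OmInv i))" .
    have closed: "antipode_gen A q (E i) \<otimes>\<^bsub>opp_algebra U\<^esub> antipode_gen A q (F j) \<in> carrier U"
      by (simp add: antipode_gen_simps del: antipode_gen.simps)
    \<comment> \<open>The computation yields the relation solved for the other product; adding the
      opposite torus difference turns it around.\<close>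
    show ?thesis
      unfolding eq opp_algebra_simps(4)
      using U.cancel_opposite[OF closed, of "u (OmInv' j)" "u (OmInv i)" "?c"] closed
      by (simp del: opp_algebra_simps(6) antipode_gen.simps(1,2) split: if_splits)
  qed
qed (rule quantum_parameters_axioms)

text \<open>In the opposite algebra the antipode of e_s is a torus factor times e_s. Extracting the
  torus factors changes q_ij to q_ji, and with that parameter the Serre element of the opposite
  algebra is a multiple of the ordinary one.\<close>

lemma antipode_serre_E:
  assumes "i \<noteq> j"
  shows "K_algebra.qcomms (opp_algebra U) (antipode_gen A q (E i)) (serre_powers i j) (antipode_gen A q (E j)) = \<zero>\<^bsub>U\<^esub>"
proof -
  \<comment> \<open>The scalar 1/q_ss comes from moving the inverse of omega_s to the other side of
    e_s.\<close>
  define m where "m = (\<lambda>s. (- inverse (q s s)) \<odot>\<^bsub>U\<^esub> u (OmInv s))"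
  note simps = U.smult_mult_left U.smult_mult_right U.smult_smult
  have m [simp]: "m s \<in> carrier U" for s by (simp add: m_def)
  have eq: "antipode_gen A q (E s) = m s \<otimes>\<^bsub>opp_algebra U\<^esub> u (E s)" for s
    using E_torus[of "OmInv s" s] by (simp add: antipode_gen_simps m_def simps del: antipode_gen.simps)
  have "\<exists>\<gamma>. \<exists>M\<in>carrier (opp_algebra U). UO.qcomms (m i \<otimes>\<^bsub>opp_algebra U\<^esub> u (E i)) (serre_powers i j) (m j \<otimes>\<^bsub>opp_algebra U\<^esub>
      u (E j))
      = \<gamma> \<odot>\<^bsub>opp_algebra U\<^esub> (M \<otimes>\<^bsub>opp_algebra U\<^esub> UO.qcomms (u (E i)) (qpowers (q i i) (q i j * inverse (q i j) / inverse
          (q j i)) (Suc (serre_degree i j))) (u (E j)))"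
    unfolding serre_powers_def
    by (rule UO.qcomms_twisted[where \<rho>="inverse (q i i)"])
      (simp_all add: m_def simps torus_E torus_comm[of "OmInv i" "OmInv j"] mult_ac)
  moreover have "q i j * inverse (q i j) / inverse (q j i) = q j i" by (simp add: field_simps)
  moreover have "UO.qcomms (u (E i)) (qpowers (q i i) (q j i) (Suc (serre_degree i j))) (u (E j)) = \<zero>\<^bsub>U\<^esub>"
    using qcomms_transpose[OF U.K_algebra_axioms _ _ q_serre_degree[OF assms], of "u (E i)" "u (E j)"]
      serre_zero(1)[OF assms] by (auto simp: serre_powers_def simp del: qpowers.simps)
  ultimately show ?thesis unfolding eq by (auto simp del: qpowers.simps)
qed

lemma antipode_serre_F:
  assumes "i \<noteq> j"
  shows "U.qcomms (antipode_gen A q (F i)) (serre_powers i j) (antipode_gen A q (F j)) = \<zero>\<^bsub>U\<^esub>"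
proof -
  define m where "m = (\<lambda>s. (- q s s) \<odot>\<^bsub>U\<^esub> u (OmInv' s))"
  note simps = U.smult_mult_left U.smult_mult_right U.smult_smult
  have m [simp]: "m s \<in> carrier U" for s by (simp add: m_def)
  have eq: "antipode_gen A q (F s) = m s \<otimes>\<^bsub>U\<^esub> u (F s)" for s
    using F_torus[of "OmInv' s" s] by (simp add: antipode_gen_simps m_def simps del: antipode_gen.simps)
  have "\<exists>\<gamma>. \<exists>M\<in>carrier U. U.qcomms (m i \<otimes>\<^bsub>U\<^esub> u (F i)) (serre_powers i j) (m j \<otimes>\<^bsub>U\<^esub> u (F j))
      = \<gamma> \<odot>\<^bsub>U\<^esub> (M \<otimes>\<^bsub>U\<^esub> U.qcomms (u (F i)) (qpowers (q i i) (q i j * q j i / q i j) (Suc (serre_degree i j))) (u (F j)))"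
    unfolding serre_powers_def
    by (rule U.qcomms_twisted[where \<rho>="q i i"])
      (simp_all add: m_def simps F_torus torus_comm[of "OmInv' i" "OmInv' j"] mult_ac)
  moreover have "q i j * q j i / q i j = q j i" by simp
  moreover have "U.qcomms (u (F i)) (qpowers (q i i) (q j i) (Suc (serre_degree i j))) (u (F j)) = \<zero>\<^bsub>U\<^esub>"
    using qcomms_transpose[OF K_algebra_opp[OF U.K_algebra_axioms] _ _ q_serre_degree[OF assms], of "u (F i)" "u
        (F j)"]
      serre_zero(2)[OF assms] by (auto simp: serre_powers_def simp del: qpowers.simps)
  ultimately show ?thesis unfolding eq by (auto simp del: qpowers.simps)
qed

lemma antipode_cl: "antipode A q (cl p) = free_lift (opp_algebra U) (antipode_gen A q) p"
  unfolding antipode_def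
proof (rule the_elem_cl[OF K_algebra_opp[OF U.K_algebra_axioms] antipode.hom])
  fix p assume p: "p \<in> Uq_relators A q"
  show "free_lift (opp_algebra U) (antipode_gen A q) p = \<zero>\<^bsub>opp_algebra U\<^esub>"
  proof (cases "p \<in> serre_relators")
    case True
    then show ?thesis
      using free_lift_serre[OF K_algebra_opp[OF U.K_algebra_axioms] antipode.closed] antipode_serre_E antipode_serre_F
      unfolding serre_relators_def by auto
  qed (use p antipode.kills_relators in blast)
qed

subsection \<open>The nonnegative and the nonpositive part\<close>

lemma keys_free_mult:
  assumes "Poly_Mapping.keys p \<subseteq> lists S" "Poly_Mapping.keys r \<subseteq> lists S"
  shows "Poly_Mapping.keys (p \<otimes>\<^bsub>free_algebra\<^esub> r) \<subseteq> lists S"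
  unfolding monoid_algebra_mult using assms by (intro keys_sum_subset) (auto split: if_splits)

text \<open>The concrete form of the halves: formal combinations of words over S give both a
  spanning set and representatives with controlled support.\<close>

definition span_words :: "'i gen set \<Rightarrow> ('i gen list \<Rightarrow>\<^sub>0 'k) set set" where
  "span_words S = cl ` {p. Poly_Mapping.keys p \<subseteq> lists S}"

lemma span_wordsI: "Poly_Mapping.keys p \<subseteq> lists S \<Longrightarrow> cl p \<in> span_words S"
  by (simp add: span_words_def)

lemma cl_word_in_span: "w \<in> lists S \<Longrightarrow> cl (word c w) \<in> span_words S"
  by (rule span_wordsI) simp

lemma span_words_add:
  assumes "x \<in> span_words S" "y \<in> span_words S" shows "x \<oplus>\<^bsub>U\<^esub> y \<in> span_words S"
proof -
  obtain p r where *: "x = cl p" "y = cl r" "Poly_Mapping.keys p \<subseteq> lists S" "Poly_Mapping.keys r \<subseteq> lists S"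
    using assms unfolding span_words_def by blast
  then show ?thesis using span_wordsI[OF keys_add_subset[OF *(3,4)]] by (simp add: cl_add)
qed

lemma span_words_smult:
  assumes "x \<in> span_words S" shows "c \<odot>\<^bsub>U\<^esub> x \<in> span_words S"
proof -
  obtain p where *: "x = cl p" "Poly_Mapping.keys p \<subseteq> lists S"
    using assms unfolding span_words_def by blast
  then show ?thesis using span_wordsI[OF order_trans[OF keys_scale *(2)]] by (simp add: cl_scale)
qed

lemma span_words_mult:
  assumes "x \<in> span_words S" "y \<in> span_words S" shows "x \<otimes>\<^bsub>U\<^esub> y \<in> span_words S"
proof -
  obtain p r where *: "x = cl p" "y = cl r" "Poly_Mapping.keys p \<subseteq> lists S" "Poly_Mapping.keys r \<subseteq> lists S"
    using assms unfolding span_words_def by blast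
  then have "Poly_Mapping.keys (p \<otimes>\<^bsub>free_algebra\<^esub> r) \<subseteq> lists S"
    by (intro keys_free_mult)
  then show ?thesis using * by (auto simp: cl_mult[symmetric] intro: span_wordsI)
qed

lemma span_words_carrier: "span_words S \<subseteq> carrier U"
  by (auto simp: span_words_def)

lemma subspace_span_words: "subspace_of U (span_words S)"
  using span_words_carrier span_words_add span_words_smult span_wordsI[of 0 S]
  by (auto simp: subspace_of_def cl_zero)

lemma keys_coproduct_span:
  assumes S: "\<And>i. E i \<in> S \<Longrightarrow> Om i \<in> S" "\<And>i. F i \<in> S \<Longrightarrow> Om' i \<in> S"
    and p: "Poly_Mapping.keys p \<subseteq> lists S"
  shows "Poly_Mapping.keys (coproduct p) \<subseteq> span_words S \<times> span_words S"
proof -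
  have "Poly_Mapping.keys (word_coproduct w) \<subseteq> span_words S \<times> span_words S" if "w \<in> lists S" for w
    unfolding word_coproduct_def
    by (rule keys_csum[where S=S, OF S _ that]) (auto intro: cl_word_in_span)
  then show ?thesis
    unfolding coproduct_def using p by (intro keys_sum_subset order_trans[OF keys_scale]) auto
qed

lemma hopf_subalgebra_span_words:
  assumes S: "\<And>i. E i \<in> S \<Longrightarrow> Om i \<in> S" "\<And>i. F i \<in> S \<Longrightarrow> Om' i \<in> S"
    and antipode: "\<And>g. g \<in> S \<Longrightarrow> antipode_gen A q g \<in> span_words S"
  shows "hopf_subalgebra A q (span_words S)"
proof -
  have one: "\<one>\<^bsub>U\<^esub> \<in> span_words S" using cl_word_in_span[of "[]" S 1] by (simp add: cl_one)
  have "subring (span_words S) U"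
    using span_words_carrier span_words_add span_words_mult one span_words_smult[of _ S "-1"]
    by (intro U.subringI) (auto simp: U.minus_eq_smult subset_iff)
  moreover have "comult A q x \<in> tensor_sub U U (span_words S) (span_words S)" if x: "x \<in> span_words S" for x
  proof -
    obtain p where p: "x = cl p" "Poly_Mapping.keys p \<subseteq> lists S" using x unfolding span_words_def by blast
    have "Poly_Mapping.keys (coproduct p) \<subseteq> span_words S \<times> span_words S"
      using S p(2) by (rule keys_coproduct_span)
    then show ?thesis by (simp add: p comult_eq tensor_sub_def)
  qed
  moreover have "antipode A q x \<in> span_words S" if x: "x \<in> span_words S" for x
  proof -
      obtain p where p: "x = cl p" "Poly_Mapping.keys p \<subseteq> lists S" using x unfolding span_words_def by blast
    have w: "UO.word_image (antipode_gen A q) w \<in> span_words S" if "w \<in> lists S" for w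
      using that
    proof (induction w)
      case Nil
      show ?case using one by simp
    next
      case (Cons g w)
      then show ?case using antipode span_words_mult by simp
    qed
    have "free_lift (opp_algebra U) (antipode_gen A q) p \<in> span_words S"
      using p(2)
    proof (induction rule: keys_induct)
      case zero
      then show ?case using UO.free_lift_zero[of "antipode_gen A q"] subspace_span_words antipode.closed
        by (simp add: subspace_of_def)
    next
      case (add k c p)
      then show ?case using UO.free_lift_add[of "antipode_gen A q" "word c k" p] w[of k] antipode.closed
        by (simp add: antipode.word_eq span_words_add span_words_smult)
    qed
    then show ?thesis by (simp add: p antipode_cl)
  qed
  ultimately show ?thesis
    by (auto simp: hopf_subalgebra_def span_words_smult)
qed

lemma span_words_subset:
  assumes "hopf_subalgebra A q H" "u ` S \<subseteq> H"
  shows "span_words S \<subseteq> H"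
proof -
  have H: "subring H U" "\<And>c x. x \<in> H \<Longrightarrow> c \<odot>\<^bsub>U\<^esub> x \<in> H" using assms(1) by (auto simp: hopf_subalgebra_def)
  have w: "cl (word 1 w) \<in> H" if "w \<in> lists S" for w
    using that
  proof (induction w)
    case Nil
    then show ?case using subringE(3)[OF H(1)] by (simp add: cl_one)
  next
    case (Cons g w)
    then show ?case using subringE(6)[OF H(1)] assms(2) by (auto simp: cl_word_Cons)
  qed
  have "cl p \<in> H" if "Poly_Mapping.keys p \<subseteq> lists S" for p
    using that
  proof (induction rule: keys_induct)
    case zero
    then show ?case using subringE(2)[OF H(1)] by (simp add: cl_zero)
  next
    case (add k c p)
    then show ?case using subringE(7)[OF H(1)] H(2) w by (simp add: cl_add cl_word[where c=c])
  qed
  then show ?thesis by (auto simp: span_words_def)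
qed

definition pos_gens :: "'i gen set" where
  "pos_gens = range E \<union> range Om \<union> range OmInv"

definition neg_gens :: "'i gen set" where
  "neg_gens = range F \<union> range Om' \<union> range OmInv'"

lemma u_in_span: "g \<in> S \<Longrightarrow> u g \<in> span_words S"
  using cl_word_in_span[of "[g]" S 1] by (simp add: u_eq)

text \<open>The span of the words is itself a competitor in the intersection, and every competitor
  contains all products of the generators.\<close>

lemma Uq_nonneg_eq: "Uq_nonneg A q = span_words pos_gens"
proof
  have "hopf_subalgebra A q (span_words pos_gens)"
    by (rule hopf_subalgebra_span_words)
      (auto simp: pos_gens_def antipode_gen_simps simp del: antipode_gen.simps(1,2)
        intro!: u_in_span span_words_mult span_words_smult)
  then show "Uq_nonneg A q \<subseteq> span_words pos_gens"
    unfolding Uq_nonneg_def by (intro Inter_lower) (auto intro!: u_in_span simp: pos_gens_def)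
  show "span_words pos_gens \<subseteq> Uq_nonneg A q"
    unfolding Uq_nonneg_def
    by (rule Inter_greatest, rule span_words_subset) (auto simp: pos_gens_def)
qed

lemma Uq_nonpos_eq: "Uq_nonpos A q = span_words neg_gens"
proof
  have "hopf_subalgebra A q (span_words neg_gens)"
    by (rule hopf_subalgebra_span_words)
      (auto simp: neg_gens_def antipode_gen_simps simp del: antipode_gen.simps(1,2)
        intro!: u_in_span span_words_mult span_words_smult)
  then show "Uq_nonpos A q \<subseteq> span_words neg_gens"
    unfolding Uq_nonpos_def by (intro Inter_lower) (auto intro!: u_in_span simp: neg_gens_def)
  show "span_words neg_gens \<subseteq> Uq_nonpos A q"
    unfolding Uq_nonpos_def
    by (rule Inter_greatest, rule span_words_subset) (auto simp: neg_gens_def)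
qed

end

section \<open>A module detecting the generators\<close>

text \<open>
  The Drinfeld double acts on the nonpositive part, the nonpositive part itself acting by the adjoint
  action and the nonnegative part by skew derivations.  In the dual of this module the torus weight
  splits off, and what remains are functions on the words in the \<open>f\<^sub>i\<close>, on which the generators act
  from the right.
\<close>

subsection \<open>Linear operators on function spaces\<close>

text \<open>Functions on 'b form the full dual of the free vector space on 'b. Transposition
  reverses products, which is why the opposite algebra accompanies this one.\<close>

definition lin_ops :: "('k::field, ('b \<Rightarrow> 'k) \<Rightarrow> 'b \<Rightarrow> 'k) module" where
  "lin_ops =
     \<lparr>carrier = {h. (\<forall>\<phi> \<psi>. h (\<lambda>w. \<phi> w + \<psi> w) = (\<lambda>w. h \<phi> w + h \<psi> w)) \<and> (\<forall>c \<phi>. h (\<lambda>w. c * \<phi> w) = (\<lambda>w. c * h \<phi> w))},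
      mult = (\<lambda>g h. \<lambda>\<phi>. g (h \<phi>)), one = (\<lambda>\<phi>. \<phi>), zero = (\<lambda>\<phi> w. 0), add = (\<lambda>g h \<phi> w. g \<phi> w + h \<phi> w),
      smult = (\<lambda>c h \<phi> w. c * h \<phi> w)\<rparr>"

lemma lin_ops_simps [simp]:
  "g \<otimes>\<^bsub>lin_ops\<^esub> h = (\<lambda>\<phi>. g (h \<phi>))" "\<one>\<^bsub>lin_ops\<^esub> = (\<lambda>\<phi>. \<phi>)" "\<zero>\<^bsub>lin_ops\<^esub> = (\<lambda>\<phi> w. 0)"
  "g \<oplus>\<^bsub>lin_ops\<^esub> h = (\<lambda>\<phi> w. g \<phi> w + h \<phi> w)" "c \<odot>\<^bsub>lin_ops\<^esub> h = (\<lambda>\<phi> w. c * h \<phi> w)"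
  by (simp_all add: lin_ops_def)

lemma lin_opsI:
  assumes "\<And>\<phi> \<psi> w. h (\<lambda>w. \<phi> w + \<psi> w) w = h \<phi> w + h \<psi> w" "\<And>c \<phi> w. h (\<lambda>w. c * \<phi> w) w = c * h \<phi> w"
  shows "h \<in> carrier lin_ops"
  using assms by (auto simp: lin_ops_def)

lemma lin_opsD:
  assumes "h \<in> carrier lin_ops"
  shows "h (\<lambda>w. \<phi> w + \<psi> w) = (\<lambda>w. h \<phi> w + h \<psi> w)" "h (\<lambda>w. c * \<phi> w) = (\<lambda>w. c * h \<phi> w)"
  using assms by (auto simp: lin_ops_def)

lemma lin_ops_zero: "h \<in> carrier lin_ops \<Longrightarrow> h (\<lambda>w. 0) = (\<lambda>w. 0)"
  using lin_opsD(2)[of h 0 "\<lambda>w. 0"] by simp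

lemma K_algebra_lin_ops: "K_algebra lin_ops"
  by (rule K_algebraI) (auto simp: lin_opsD fun_eq_iff algebra_simps intro!: lin_opsI)

global_interpretation LO: K_algebra lin_ops
  by (rule K_algebra_lin_ops)

global_interpretation OO: K_algebra "opp_algebra lin_ops"
  by (rule K_algebra_opp) (rule K_algebra_lin_ops)

context quantum_parameters
begin

text \<open>The x_s satisfy a skew Leibniz rule against L_m, with error K_m exactly for s = m. For m
  = i the error sits at the repeated factor and cancels when the parameters are applied in
  descending order; for m = j it sits at the inner factor and is cancelled by the first parameter
  q_ij; for other m there is none.\<close>

lemma serre_commute:
  assumes B: "K_algebra B"
    and [simp]: "\<And>s. x s \<in> carrier B" "\<And>s. L s \<in> carrier B" "\<And>s. K s \<in> carrier B"
    and xL: "\<And>s m. x s \<otimes>\<^bsub>B\<^esub> L m = L m \<otimes>\<^bsub>B\<^esub> x s \<oplus>\<^bsub>B\<^esub> (if s = m then K m else \<zero>\<^bsub>B\<^esub>)"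
    and xK: "\<And>s m. x s \<otimes>\<^bsub>B\<^esub> K m = q s m \<odot>\<^bsub>B\<^esub> (K m \<otimes>\<^bsub>B\<^esub> x s)"
    and "i \<noteq> j"
  shows "K_algebra.qcomms B (x i) (serre_powers i j) (x j) \<otimes>\<^bsub>B\<^esub> L m = L m \<otimes>\<^bsub>B\<^esub> K_algebra.qcomms B (x i) (serre_powers i j)
      (x j)"
proof -
  interpret B: K_algebra B by fact
  have Kx: "K m \<otimes>\<^bsub>B\<^esub> x s = inverse (q s m) \<odot>\<^bsub>B\<^esub> (x s \<otimes>\<^bsub>B\<^esub> K m)" for s m
    by (simp add: xK B.smult_smult)
  show ?thesis
  proof (cases "m = i")
    case True
    then show ?thesis
      using B.qcomms_derivation_left[of "x i" "x j" "L m" "K m" "inverse (q i i)" "inverse (q j i)" "Suc (serre_degree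
          i j)"]
        xL[of i m] xL[of j m] Kx[of m i] Kx[of m j] \<open>i \<noteq> j\<close>
        B.qcomms_qpowers_reverse[OF q_serre_degree[OF \<open>i \<noteq> j\<close>], of "x i" "x j"]
      by (simp add: serre_powers_def del: qpowers.simps)
  next
    case False
    then show ?thesis
      using B.qcomms_derivation_right[of "x i" "x j" "L m" "if j = m then K m else \<zero>\<^bsub>B\<^esub>" "q i j" "qpowers (q i i)
          (q i i * q i j) (serre_degree i j)"]
        xL[of i m] xL[of j m] xK[of i m]
      unfolding serre_powers_def qpowers_snoc by (simp del: qpowers.simps split: if_splits)
  qed
qed

subsection \<open>The action of the generators\<close>

definition right_char :: "'i \<Rightarrow> 'i list \<Rightarrow> 'k" where
  "right_char i w = prod_list (map (\<lambda>l. q l i) w)"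

text \<open>The weight of omega_i on a word in the letters f_l, where z i is its weight on the empty
  word. No such freedom is given to omega'_i, whose weight on the empty word is 1.\<close>

definition left_char :: "('i \<Rightarrow> 'k) \<Rightarrow> 'i \<Rightarrow> 'i list \<Rightarrow> 'k" where
  "left_char z i w = z i * prod_list (map (\<lambda>l. inverse (q i l)) w)"

definition mult_op :: "('i list \<Rightarrow> 'k) \<Rightarrow> ('i list \<Rightarrow> 'k) \<Rightarrow> 'i list \<Rightarrow> 'k" where
  "mult_op \<chi> \<phi> w = \<chi> w * \<phi> w"

definition cons_op :: "'i \<Rightarrow> ('i list \<Rightarrow> 'k) \<Rightarrow> 'i list \<Rightarrow> 'k" where
  "cons_op i \<phi> w = \<phi> (i # w)"

definition snoc_op :: "'i \<Rightarrow> ('i list \<Rightarrow> 'k) \<Rightarrow> 'i list \<Rightarrow> 'k" where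
  "snoc_op i \<phi> w = \<phi> (w @ [i])"

definition fe_value :: "'i \<Rightarrow> 'k" where
  "fe_value i = q i i / (1 - q i i)"

lemma fe_value_eq: "fe_value i = - cartan i"
  by (simp add: fe_value_def cartan_def divide_minus_right[symmetric] del: divide_minus_right)

text \<open>The transpose of the skew derivation attached to e_i: each occurrence of the letter i is
  deleted in turn, weighted by \<open>fe_value\<close> and by the character of omega'_i on the
  letters to its right.\<close>

fun skew_op :: "'i \<Rightarrow> ('i list \<Rightarrow> 'k) \<Rightarrow> 'i list \<Rightarrow> 'k" where
  "skew_op i \<phi> [] = 0"
| "skew_op i \<phi> (j # w) = (if i = j then fe_value i * right_char i w * \<phi> w else 0) + skew_op i (\<lambda>w. \<phi> (j # w)) w"

text \<open>F i acts by the transpose of the q-commutator sending a word w to f_i w minus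
  \<open>left_char z i w\<close> times w f_i. Being transposes, the operators compose in the
  opposite algebra.\<close>

fun act :: "('i \<Rightarrow> 'k) \<Rightarrow> 'i gen \<Rightarrow> ('i list \<Rightarrow> 'k) \<Rightarrow> 'i list \<Rightarrow> 'k" where
  "act z (E i) = skew_op i"
| "act z (F i) = (\<lambda>\<phi> w. cons_op i \<phi> w + mult_op (\<lambda>w. - left_char z i w) (snoc_op i \<phi>) w)"
| "act z (Om i) = mult_op (left_char z i)"
| "act z (OmInv i) = mult_op (\<lambda>w. inverse (left_char z i w))"
| "act z (Om' i) = mult_op (right_char i)"
| "act z (OmInv' i) = mult_op (\<lambda>w. inverse (right_char i w))"

lemma skew_op_add: "skew_op i (\<lambda>w. \<phi> w + \<psi> w) w = skew_op i \<phi> w + skew_op i \<psi> w"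
  by (induction w arbitrary: \<phi> \<psi>) (simp_all add: algebra_simps)

lemma skew_op_scale: "skew_op i (\<lambda>w. c * \<phi> w) w = c * skew_op i \<phi> w"
  by (induction w arbitrary: \<phi>) (simp_all add: algebra_simps)

lemma skew_op_zero: "skew_op i (\<lambda>w. 0) w = 0"
  using skew_op_scale[of i 0 "\<lambda>w. 0"] by simp

lemma ops_closed [simp]:
  "skew_op i \<in> carrier lin_ops" "mult_op \<chi> \<in> carrier lin_ops" "cons_op i \<in> carrier lin_ops"
  "snoc_op i \<in> carrier lin_ops" "act z g \<in> carrier lin_ops"
proof -
  show 1: "skew_op i \<in> carrier lin_ops" "mult_op \<chi> \<in> carrier lin_ops" "cons_op i \<in> carrier lin_ops"
    "snoc_op i \<in> carrier lin_ops" for i \<chi>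
    by (auto intro!: lin_opsI simp: skew_op_add skew_op_scale mult_op_def cons_op_def snoc_op_def algebra_simps)
  then show "act z g \<in> carrier lin_ops"
    using LO.add.m_closed[OF 1(3) LO.m_closed[OF 1(2,4)]] by (cases g) simp_all
qed

lemma char_simps [simp]:
  "right_char i [] = 1" "right_char i (l # w) = q l i * right_char i w"
  "right_char i (w @ w') = right_char i w * right_char i w'"
  "left_char z i [] = z i" "left_char z i (l # w) = inverse (q i l) * left_char z i w"
  "left_char z i (w @ [l]) = left_char z i w * inverse (q i l)"
  by (simp_all add: right_char_def left_char_def)

lemma right_char_nonzero [simp]: "right_char i w \<noteq> 0"
  by (induction w) simp_all

lemma left_char_nonzero [simp]: "z i \<noteq> 0 \<Longrightarrow> left_char z i w \<noteq> 0"
  by (induction w) simp_all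

lemma skew_op_mult_op:
  assumes "\<And>l w. \<chi> (l # w) = s l * \<chi> w"
  shows "s i * skew_op i (mult_op \<chi> \<phi>) w = \<chi> w * skew_op i \<phi> w"
proof (induction w arbitrary: \<phi>)
  case (Cons l w)
  have "(\<lambda>w. mult_op \<chi> \<phi> (l # w)) = (\<lambda>w. s l * mult_op \<chi> (\<lambda>w. \<phi> (l # w)) w)"
    by (simp add: mult_op_def assms mult_ac)
  then have "s i * skew_op i (\<lambda>w. mult_op \<chi> \<phi> (l # w)) w = s l * (\<chi> w * skew_op i (\<lambda>w. \<phi> (l # w)) w)"
    using Cons by (simp add: skew_op_scale mult.left_commute)
  then show ?case by (simp add: assms mult_op_def algebra_simps)
qed simp

lemma skew_op_right_char: "right_char m w * skew_op i \<phi> w = q i m * skew_op i (mult_op (right_char m) \<phi>) w"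
  by (rule skew_op_mult_op[symmetric]) simp

lemma skew_op_left_char: "skew_op i (mult_op (left_char z m) \<phi>) w = q m i * (left_char z m w * skew_op i \<phi> w)"
  using skew_op_mult_op[of "left_char z m" "\<lambda>l. inverse (q m l)" i \<phi> w] by (simp add: field_simps)

text \<open>Deleting the appended letter carries no character; every earlier deletion now has one
  more letter on its right, which costs q_ji.\<close>

lemma skew_op_snoc: "skew_op i \<phi> (w @ [j]) = q j i * skew_op i (snoc_op j \<phi>) w + (if i
    = j then fe_value i * \<phi> w else 0)"
proof (induction w arbitrary: \<phi>)
  case (Cons l w)
  have "snoc_op j (\<lambda>w. \<phi> (l # w)) = (\<lambda>w. snoc_op j \<phi> (l # w))" by (rule ext) (simp add: snoc_op_def)
  then show ?case using Cons[of "\<lambda>w. \<phi> (l # w)"] by (simp add: algebra_simps) (simp add: snoc_op_def)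
qed (simp add: skew_op_zero)

text \<open>In the commutator of e_i and f_i only the deletion of the newly added letter survives:
  at the front it leaves \<open>right_char\<close>, the action of omega'_i, and at the end
  \<open>left_char\<close>, the action of omega_i. The sign comes from \<open>fe_value\<close> = -
  \<open>cartan\<close>.\<close>

lemma uq_images_act:
  assumes z: "\<And>i. z i \<noteq> 0"
  shows "uq_images A q (opp_algebra lin_ops) (act z)"
proof (intro uq_images.intro uq_images_axioms.intro)
  show "quantum_parameters A q" by (rule quantum_parameters_axioms)
  show "K_algebra (opp_algebra lin_ops :: ('k, ('i list \<Rightarrow> 'k) \<Rightarrow> 'i list \<Rightarrow> 'k) module)" by (rule OO.K_algebra_axioms)
  have inv: "skew_op i (mult_op (\<lambda>w. inverse (\<chi> w)) \<phi>) w = x * (inverse (\<chi> w) * skew_op i \<phi> w)"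
    if "\<And>\<phi> w. skew_op i (mult_op \<chi> \<phi>) w = inverse x * (\<chi> w * skew_op i \<phi> w)" "\<And>w. \<chi> w \<noteq> 0" "x \<noteq> 0" for \<chi> i x \<phi> w
    using that(1)[of "mult_op (\<lambda>w. inverse (\<chi> w)) \<phi>" w] that(2,3)
    by (simp add: mult_op_def[abs_def] field_simps)
  show "act z (E i) \<otimes>\<^bsub>opp_algebra lin_ops\<^esub> act z (F j) = act z (F j) \<otimes>\<^bsub>opp_algebra lin_ops\<^esub> act z (E i)
      \<oplus>\<^bsub>opp_algebra lin_ops\<^esub>
      (if i = j then cartan i \<odot>\<^bsub>opp_algebra lin_ops\<^esub> act z (Om i) \<oplus>\<^bsub>opp_algebra lin_ops\<^esub> (- cartan i) \<odot>\<^bsub>opp_algebra lin_ops\<^esub>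
          act z (Om' i) else \<zero>\<^bsub>opp_algebra lin_ops\<^esub>)" for i j
  proof -
    have neg: "skew_op i (mult_op (\<lambda>w. - left_char z j w) \<psi>) w = - q j i * (left_char z j w * skew_op i \<psi> w)" for \<psi> w
      using skew_op_left_char[of i z j \<psi> w] skew_op_scale[of i "-1" "mult_op (left_char z j) \<psi>" w]
      by (simp add: mult_op_def[abs_def])
    have 1: "skew_op i (act z (F j) \<phi>) w = skew_op i (cons_op j \<phi>) w - q j i * (left_char z j w * skew_op i (snoc_op j
        \<phi>) w)" for \<phi> w
      by (simp add: skew_op_add neg)
    have 2: "act z (F j) (skew_op i \<phi>) w = (if i = j then fe_value i * right_char i w * \<phi> w else 0)
        + skew_op i (cons_op j \<phi>) w
        - left_char z j w * (q j i * skew_op i (snoc_op j \<phi>) w + (if i = j then fe_value i * \<phi> w else 0))" for \<phi> w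
      by (simp add: cons_op_def mult_op_def snoc_op_def[of _ "skew_op _ _"] skew_op_snoc)
          (simp add: cons_op_def[abs_def])
    have "act z (F j) (skew_op i \<phi>) w = skew_op i (act z (F j) \<phi>) w
        + (if i = j then cartan i * act z (Om i) \<phi> w + - cartan i * act z (Om' i) \<phi> w else 0)" for \<phi> w
      unfolding 1 2 by (simp add: mult_op_def fe_value_eq algebra_simps)
    then show ?thesis by (auto simp: fun_eq_iff simp del: act.simps(2))
  qed
qed (use z in \<open>auto simp: fun_eq_iff mult_op_def[of _ "mult_op _ _"] mult_op_def[of _ "skew_op _ _"] cons_op_def
    snoc_op_def skew_op_left_char
     skew_op_right_char torus_gens_def\<close>, auto simp: mult_op_def snoc_op_def field_simps)

end

subsection \<open>Functions vanishing on the Serre ideal\<close>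

lemma lin_free_mult: "lin f (p \<otimes>\<^bsub>free_algebra\<^esub> r) = lin (\<lambda>u. lin (\<lambda>v. f (u @ v)) r) p"
proof -
  have 1: "lin f (word a u \<otimes>\<^bsub>free_algebra\<^esub> r) = a * lin (\<lambda>v. f (u @ v)) r" for a u
    by (rule keys_induct[of r UNIV]) (simp_all add: monoid_algebra_mult_add_right algebra_simps)
  show ?thesis
    by (rule keys_induct[of p UNIV]) (simp_all add: monoid_algebra_mult_add_left 1)
qed

lemma lin_swap: "lin (\<lambda>u. lin (\<lambda>v. f u v) p) r = lin (\<lambda>v. lin (\<lambda>u. f u v) r) p"
proof -
  have "lin (\<lambda>u. lin (\<lambda>v. f u v) p) r
      = (\<Sum>u\<in>Poly_Mapping.keys r. \<Sum>v\<in>Poly_Mapping.keys p. Poly_Mapping.lookup p v * (Poly_Mapping.lookup r u * f u v))"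
    by (simp add: lin_def sum_distrib_left mult.left_commute)
  then show ?thesis by (subst (asm) sum.swap) (simp add: lin_def sum_distrib_left)
qed

definition prefix_op :: "('a list \<Rightarrow>\<^sub>0 'k::field) \<Rightarrow> ('a list \<Rightarrow> 'k) \<Rightarrow> 'a list \<Rightarrow> 'k" where
  "prefix_op p \<phi> w = lin (\<lambda>m. \<phi> (m @ w)) p"

definition suffix_op :: "('a list \<Rightarrow>\<^sub>0 'k::field) \<Rightarrow> ('a list \<Rightarrow> 'k) \<Rightarrow> 'a list \<Rightarrow> 'k" where
  "suffix_op p \<phi> w = lin (\<lambda>m. \<phi> (w @ m)) p"

lemma alg_hom_prefix_op: "alg_hom (opp_algebra free_algebra) lin_ops prefix_op"
  by (auto simp: alg_hom_def prefix_op_def fun_eq_iff lin_add_fun lin_mult_fun lin_free_mult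
      intro!: ring_hom_memI lin_opsI intro: lin_swap)

lemma alg_hom_suffix_op: "alg_hom free_algebra lin_ops suffix_op"
  by (auto simp: alg_hom_def suffix_op_def fun_eq_iff lin_add_fun lin_mult_fun lin_free_mult
      intro!: ring_hom_memI lin_opsI)

context quantum_parameters
begin

definition serre_word :: "'i \<Rightarrow> 'i \<Rightarrow> 'i list \<Rightarrow>\<^sub>0 'k" where
  "serre_word i j = FO.qcomms (word 1 [i]) (serre_powers i j) (word 1 [j])"

lemma serre_word_eq: "serre_word i j = (\<Sum>k\<le>Suc (serre_degree i j).
    word (qcomms_coeff (q i i) (q i j) (Suc (serre_degree i j)) k) (replicate k i @ [j] @ replicate (Suc (serre_degree
        i j) - k) i))"
  unfolding serre_word_def serre_powers_def qcomms_free_opp ..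

lemma qcomms_cons_op: "LO.qcomms (cons_op i) (serre_powers i j) (cons_op j) = prefix_op (serre_word i j)"
proof -
  have "prefix_op (word 1 [i]) = cons_op i" for i :: 'i
    by (simp add: fun_eq_iff prefix_op_def cons_op_def)
  then show ?thesis
    using qcomms_hom[OF K_algebra_free_opp K_algebra_lin_ops alg_hom_prefix_op, of "word 1 [i]" "word 1 [j]"
        "serre_powers i j"]
    by (simp add: serre_word_def)
qed

text \<open>Unlike prefixing, appending does not reverse products, while \<open>serre_word\<close>
  lives in the opposite free algebra. \<open>qcomms_transpose\<close> bridges the two, which
  explains the parameter q_ji and the scalar.\<close>

lemma qcomms_snoc_op:
  assumes "i \<noteq> j"
  shows "\<exists>\<gamma>. LO.qcomms (snoc_op i) (qpowers (q i i) (q j i) (Suc (serre_degree i j))) (snoc_op j)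
      = (\<lambda>\<phi> w. \<gamma> * suffix_op (serre_word i j) \<phi> w)"
proof -
  let ?p = "FA.qcomms (word 1 [i]) (qpowers (q i i) (q j i) (Suc (serre_degree i j))) (word 1 [j])"
  have c: "q i i ^ serre_degree i j * q j i * q i j = 1"
    using q_serre_degree[OF assms] by (simp add: mult_ac)
  obtain \<gamma> where "\<gamma> \<noteq> 0" "serre_word i j = scale \<gamma> ?p"
    using qcomms_transpose[OF FA.K_algebra_axioms _ _ c, of "word 1 [i]" "word 1 [j]"]
    by (auto simp: serre_word_def serre_powers_def simp del: qpowers.simps)
  then have "?p = scale (inverse \<gamma>) (serre_word i j)"
    by (intro poly_mapping_eqI) simp
  moreover have "suffix_op (word 1 [i]) = snoc_op i" for i :: 'i
    by (simp add: fun_eq_iff suffix_op_def snoc_op_def)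
  then have "LO.qcomms (snoc_op i) (qpowers (q i i) (q j i) (Suc (serre_degree i j))) (snoc_op j) = suffix_op ?p"
    using qcomms_hom[OF FA.K_algebra_axioms K_algebra_lin_ops alg_hom_suffix_op, of "word (1 :: 'k) [i]" "word 1 [j]"]
    by (simp del: qpowers.simps)
  ultimately show ?thesis
    by (intro exI[of _ "inverse \<gamma>"]) (simp add: suffix_op_def fun_eq_iff)
qed

text \<open>All words of a Serre element consist of the same letters, N + 1 times i and once j, so a
  multiplicative character is constant on them.\<close>

lemma lin_serre_word_char:
  "lin (\<lambda>m. prod_list (map s m) * f m) (serre_word i j) = s i ^ Suc (serre_degree i j) * s j * lin f (serre_word i j)"
proof -
  have "s i ^ k * s i ^ (Suc (serre_degree i j) - k) = s i ^ Suc (serre_degree i j)" if "k \<le> Suc (serre_degree i j)"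
      for k
    using that by (simp flip: power_add)
  then have "prod_list (map s (replicate k i @ [j] @ replicate (Suc (serre_degree i j) - k) i))
      = s i ^ Suc (serre_degree i j) * s j"
    if "k \<le> Suc (serre_degree i j)" for k
    using that by (simp add: map_replicate prod_list_replicate mult_ac)
  then show ?thesis
    unfolding serre_word_eq lin_sum sum_distrib_left
    by (intro sum.cong) (simp_all add: mult_ac del: map_append)
qed

text \<open>The dual of the free algebra on the f_i modulo its Serre ideal; the Serre relations for
  the operators of the f_i are verified on this subspace.\<close>

definition serre_annihilator :: "('i list \<Rightarrow> 'k) set" where
  "serre_annihilator = {\<phi>. \<forall>i j u v. i \<noteq> j \<longrightarrow> lin (\<lambda>m. \<phi> (u @ m @ v)) (serre_word i j) = 0}"

lemma annihilator_lin:
  assumes "\<phi> \<in> serre_annihilator" "\<psi> \<in> serre_annihilator"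
  shows "(\<lambda>w. \<phi> w + \<psi> w) \<in> serre_annihilator" "(\<lambda>w. c * \<phi> w) \<in> serre_annihilator"
  using assms by (simp_all add: serre_annihilator_def lin_add_fun lin_mult_fun)

lemma annihilatorD: "\<phi> \<in> serre_annihilator \<Longrightarrow> i \<noteq> j \<Longrightarrow> lin (\<lambda>m. \<phi> (x @ m @ y)) (serre_word i j) = 0"
  unfolding serre_annihilator_def by blast

lemma annihilatorI: "(\<And>i j u v. i \<noteq> j \<Longrightarrow> lin (\<lambda>m. \<phi> (u @ m @ v)) (serre_word i j) = 0) \<Longrightarrow> \<phi> \<in> serre_annihilator"
  unfolding serre_annihilator_def by blast

lemma annihilator_cons_op: "\<phi> \<in> serre_annihilator \<Longrightarrow> cons_op i \<phi> \<in> serre_annihilator"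
  using annihilatorD[of \<phi> _ _ "i # _"] by (intro annihilatorI) (simp add: cons_op_def)

lemma annihilator_snoc_op: "\<phi> \<in> serre_annihilator \<Longrightarrow> snoc_op i \<phi> \<in> serre_annihilator"
  using annihilatorD[of \<phi> _ _ _ "_ @ [i]"] by (intro annihilatorI) (simp add: snoc_op_def)

lemma annihilator_mult_op:
  assumes "\<phi> \<in> serre_annihilator" and \<chi>: "\<And>w. \<chi> w = c * prod_list (map s w)"
  shows "mult_op \<chi> \<phi> \<in> serre_annihilator"
proof -
  have "lin (\<lambda>m. mult_op \<chi> \<phi> (u @ m @ v)) (serre_word i j) = 0" if "i \<noteq> j" for i j u v
  proof -
    have "lin (\<lambda>m. mult_op \<chi> \<phi> (u @ m @ v)) (serre_word i j)
      = c * prod_list (map s u) * prod_list (map s v) * lin (\<lambda>m. prod_list (map s m) * \<phi> (u @ m @ v)) (serre_word i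
          j)"
      unfolding lin_mult_fun[symmetric] by (rule lin_cong) (simp add: mult_op_def \<chi> mult_ac)
    then show ?thesis using assms(1) that
      unfolding lin_serre_word_char by (simp add: serre_annihilator_def)
  qed
  then show ?thesis by (rule annihilatorI)
qed

lemma cons_op_skew_op:
  "cons_op j (skew_op i \<phi>) w = skew_op i (cons_op j \<phi>) w + (if j = i then fe_value i * right_char i w * \<phi> w else 0)"
  by (simp add: cons_op_def[abs_def])

text \<open>With nothing in front, \<open>serre_commute\<close> lets the skew derivation pass the
  Serre element, so the result is 0. A prefix u is removed letter by letter; deleting a letter of u
  leaves a character times \<phi>, which vanishes because the character is constant on the Serre
  element.\<close>

lemma annihilator_skew_op:
  assumes "\<phi> \<in> serre_annihilator"
  shows "skew_op m \<phi> \<in> serre_annihilator"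
proof -
  have "prefix_op (serre_word i j) (\<lambda>w. skew_op m \<phi> (u @ w)) = (\<lambda>w. 0)" if "i \<noteq> j" for i j u
    using assms
  proof (induction u arbitrary: \<phi>)
    case Nil
    have "LO.qcomms (cons_op i) (serre_powers i j) (cons_op j) \<otimes>\<^bsub>lin_ops\<^esub> skew_op m
        = skew_op m \<otimes>\<^bsub>lin_ops\<^esub> LO.qcomms (cons_op i) (serre_powers i j) (cons_op j)"
    proof (rule serre_commute[OF K_algebra_lin_ops, where K="\<lambda>m. mult_op (\<lambda>w. fe_value m * right_char m w)"])
      show "i \<noteq> j" by fact
    qed (auto simp: fun_eq_iff cons_op_skew_op cons_op_def[of _ "mult_op _ _"], auto simp: mult_op_def cons_op_def)
    then have "prefix_op (serre_word i j) (skew_op m \<phi>) = skew_op m (prefix_op (serre_word i j) \<phi>)"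
      unfolding qcomms_cons_op by (simp add: fun_eq_iff)
    moreover have "prefix_op (serre_word i j) \<phi> = (\<lambda>w. 0)"
      using annihilatorD[OF Nil \<open>i \<noteq> j\<close>, of "[]"] by (simp add: prefix_op_def fun_eq_iff)
    ultimately show ?case by (simp add: fun_eq_iff skew_op_zero)
  next
    case (Cons l u)
    let ?c = "if m = l then fe_value m * right_char m u else 0"
    \<comment> \<open>The first summand is identically 0. The second is the deletion of the leading
      letter l, with \<open>right_char\<close> split over u and w; the third collects the deletions
      further to the right.\<close>
    have eq: "(\<lambda>w. skew_op m \<phi> ((l # u) @ w)) = (\<lambda>w. ?c * mult_op (right_char m) \<phi> w * 0 + ?c * (right_char m w * \<phi>
        (u @ w)) + skew_op m (cons_op l \<phi>) (u @ w))"
      by (simp add: fun_eq_iff cons_op_def[abs_def])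
    have "lin (\<lambda>w. right_char m (w @ v) * \<phi> (u @ w @ v)) (serre_word i j) = 0" for v
    proof -
      have "lin (\<lambda>w. right_char m (w @ v) * \<phi> (u @ w @ v)) (serre_word i j)
        = right_char m v * lin (\<lambda>w. prod_list (map (\<lambda>l. q l m) w) * \<phi> (u @ w @ v)) (serre_word i j)"
        unfolding lin_mult_fun[symmetric] by (rule lin_cong) (simp add: right_char_def mult_ac)
      then show ?thesis using Cons.prems \<open>i \<noteq> j\<close>
        unfolding lin_serre_word_char by (simp add: serre_annihilator_def)
    qed
    moreover have "prefix_op (serre_word i j) (\<lambda>w. skew_op m (cons_op l \<phi>) (u @ w)) = (\<lambda>w. 0)"
      using Cons annihilator_cons_op by blast
    ultimately show ?case
      unfolding eq by (simp add: prefix_op_def fun_eq_iff lin_add_fun lin_mult_fun)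
  qed
  then have "prefix_op (serre_word i j) (\<lambda>w. skew_op m \<phi> (u @ w)) v = 0" if "i \<noteq> j" for i j u v
    using that by simp
  then show ?thesis by (intro annihilatorI) (simp add: prefix_op_def)
qed

lemma annihilator_act:
  assumes "\<phi> \<in> serre_annihilator"
  shows "act z g \<phi> \<in> serre_annihilator"
proof (cases g)
  case (E i)
  then show ?thesis using annihilator_skew_op assms by simp
next
  case (F i)
  have "mult_op (\<lambda>w. - left_char z i w) (snoc_op i \<phi>) \<in> serre_annihilator"
    by (rule annihilator_mult_op[OF annihilator_snoc_op[OF assms], where c="- z i"
        and s="\<lambda>l. inverse (q i l)"]) (simp add: left_char_def)
  then show ?thesis using annihilator_lin(1) annihilator_cons_op assms F by simp
next
  case (Om i)
  then show ?thesis using annihilator_mult_op[OF assms, where \<chi>="left_char z i" and c="z i"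
      and s="\<lambda>l. inverse (q i l)"] by (simp add: left_char_def)
next
  case (OmInv i)
  have "inverse (prod_list (map (\<lambda>l. inverse (q i l)) w)) = prod_list (map (\<lambda>l. q i l) w)" for w
    by (induction w) simp_all
  then show ?thesis using annihilator_mult_op[OF assms, where \<chi>="\<lambda>w. inverse (left_char z i w)" and c="inverse (z i)"
      and s="\<lambda>l. q i l"] OmInv
    by (simp add: left_char_def)
next
  case (Om' i)
  then show ?thesis using annihilator_mult_op[OF assms, where \<chi>="right_char i" and c=1 and s="\<lambda>l. q l i"]
      by (simp add: right_char_def)
next
  case (OmInv' i)
  have "inverse (prod_list (map (\<lambda>l. q l i) w)) = prod_list (map (\<lambda>l. inverse (q l i)) w)" for w
    by (induction w) simp_all
  then show ?thesis using annihilator_mult_op[OF assms, where \<chi>="\<lambda>w. inverse (right_char i w)" and c=1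
      and s="\<lambda>l. inverse (q l i)"] OmInv'
    by (simp add: right_char_def)
qed

subsection \<open>The Serre relations in the module\<close>

text \<open>By \<open>serre_commute\<close> the Serre operator commutes with every
  \<open>cons_op\<close>, and its values at the empty word are 0. Induction on the word then gives 0
  on all functions, not only on the annihilator.\<close>

lemma act_serre_E:
  assumes "i \<noteq> j"
  shows "OO.qcomms (skew_op i) (serre_powers i j) (skew_op j) = (\<lambda>\<phi> w. 0)"
proof -
  let ?S = "OO.qcomms (skew_op i) (serre_powers i j) (skew_op j)"
  have Nil: "OO.qcomms (skew_op i) cs (skew_op j) \<phi> [] = 0" for cs \<phi>
    by (induction cs arbitrary: \<phi>) (simp_all add: OO.qcomm_def)
  have comm: "?S \<otimes>\<^bsub>opp_algebra lin_ops\<^esub> cons_op m = cons_op m \<otimes>\<^bsub>opp_algebra lin_ops\<^esub> ?S" for m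
  proof (rule serre_commute[OF OO.K_algebra_axioms, where K="\<lambda>m. mult_op (\<lambda>w. fe_value m * right_char m w)"])
    show "i \<noteq> j" by fact
    show "skew_op s \<otimes>\<^bsub>opp_algebra lin_ops\<^esub> mult_op (\<lambda>w. fe_value m * right_char m w) =
        q s m \<odot>\<^bsub>opp_algebra lin_ops\<^esub> (mult_op (\<lambda>w. fe_value m * right_char m w) \<otimes>\<^bsub>opp_algebra lin_ops\<^esub> skew_op s)" for s m
      using skew_op_scale[of s "fe_value m" "mult_op (right_char m) _"] skew_op_right_char[of m _ s]
      by (simp add: fun_eq_iff mult_op_def[abs_def] mult_ac)
  qed (auto simp: fun_eq_iff cons_op_skew_op cons_op_def[of _ "mult_op _ _"], auto simp: mult_op_def cons_op_def)
  have "?S \<phi> w = 0" for \<phi> w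
  proof (induction w arbitrary: \<phi>)
    case (Cons m w)
    have "?S \<phi> (m # w) = ?S (cons_op m \<phi>) w"
      using fun_cong[OF fun_cong[OF comm[of m], of \<phi>], of w] by (simp add: cons_op_def[of _ "?S \<phi>"])
    then show ?case using Cons by simp
  qed (rule Nil)
  then show ?thesis by (simp add: fun_eq_iff)
qed

text \<open>The two summands of the action of f_i give no mixed terms. What remains is the Serre
  element placed in front of the word and, up to a scalar and a further operator, behind it; both
  evaluate to 0 on the annihilator.\<close>

lemma act_serre_F:
  assumes "i \<noteq> j" "\<phi> \<in> serre_annihilator"
  shows "LO.qcomms (act z (F i)) (serre_powers i j) (act z (F j)) \<phi> = (\<lambda>w. 0)"
proof -
  define m where "m = (\<lambda>i. mult_op (\<lambda>w. - left_char z i w))"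
  have m [simp]: "m i \<in> carrier lin_ops" for i by (simp add: m_def)
  have eq: "act z (F i) = cons_op i \<oplus>\<^bsub>lin_ops\<^esub> m i \<otimes>\<^bsub>lin_ops\<^esub> snoc_op i" for i
    by (simp add: fun_eq_iff m_def)
  have "LO.qcomms (cons_op i \<oplus>\<^bsub>lin_ops\<^esub> m i \<otimes>\<^bsub>lin_ops\<^esub> snoc_op i) (serre_powers i j) (cons_op j
      \<oplus>\<^bsub>lin_ops\<^esub> m j \<otimes>\<^bsub>lin_ops\<^esub> snoc_op j)
    = LO.qcomms (cons_op i) (serre_powers i j) (cons_op j) \<oplus>\<^bsub>lin_ops\<^esub> LO.qcomms (m i \<otimes>\<^bsub>lin_ops\<^esub> snoc_op i) (serre_powers i
        j) (m j \<otimes>\<^bsub>lin_ops\<^esub> snoc_op j)"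
    unfolding serre_powers_def
    by (rule LO.qcomms_sum[OF _ _ _ _ _ _ _ q_serre_degree[OF assms(1)]])
      (simp_all del: lin_ops_simps, simp_all add: fun_eq_iff m_def mult_op_def cons_op_def snoc_op_def)
  moreover have "LO.qcomms (cons_op i) (serre_powers i j) (cons_op j) \<phi> = (\<lambda>w. 0)"
    using annihilatorD[OF assms(2,1), of "[]"] unfolding qcomms_cons_op
    by (simp add: prefix_op_def fun_eq_iff)
  moreover have "LO.qcomms (m i \<otimes>\<^bsub>lin_ops\<^esub> snoc_op i) (serre_powers i j) (m j \<otimes>\<^bsub>lin_ops\<^esub> snoc_op j) \<phi> = (\<lambda>w. 0)"
  proof -
    have r: "q i j * inverse (q i j) / inverse (q j i) = q j i" by (simp add: field_simps)
    have "\<exists>\<gamma>. \<exists>M\<in>carrier lin_ops. LO.qcomms (m i \<otimes>\<^bsub>lin_ops\<^esub> snoc_op i) (serre_powers i j) (m j \<otimes>\<^bsub>lin_ops\<^esub> snoc_op j)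
      = \<gamma> \<odot>\<^bsub>lin_ops\<^esub> (M \<otimes>\<^bsub>lin_ops\<^esub> LO.qcomms (snoc_op i) (qpowers (q i i) (q i j * inverse (q i j) / inverse (q j i)) (Suc
          (serre_degree i j))) (snoc_op j))"
      unfolding serre_powers_def
      by (rule LO.qcomms_twisted[where \<rho>="inverse (q i i)"])
        (simp_all add: fun_eq_iff m_def mult_op_def snoc_op_def mult_ac)
    then obtain \<gamma> M where M: "M \<in> carrier lin_ops"
      "LO.qcomms (m i \<otimes>\<^bsub>lin_ops\<^esub> snoc_op i) (serre_powers i j) (m j \<otimes>\<^bsub>lin_ops\<^esub> snoc_op j)
      = \<gamma> \<odot>\<^bsub>lin_ops\<^esub> (M \<otimes>\<^bsub>lin_ops\<^esub> LO.qcomms (snoc_op i) (qpowers (q i i) (q j i) (Suc (serre_degree i j))) (snoc_op j))"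
      unfolding r by blast
    obtain \<gamma>' where \<gamma>': "LO.qcomms (snoc_op i) (qpowers (q i i) (q j i) (Suc (serre_degree i j))) (snoc_op j)
        = (\<lambda>\<phi> w. \<gamma>' * suffix_op (serre_word i j) \<phi> w)"
      using qcomms_snoc_op[OF assms(1)] by blast
    have "suffix_op (serre_word i j) \<phi> = (\<lambda>w. 0)"
    proof
      fix w
      show "suffix_op (serre_word i j) \<phi> w = 0"
        using annihilatorD[OF assms(2,1), of w "[]"] by (simp add: suffix_op_def)
    qed
    then show ?thesis using lin_ops_zero[OF M(1)] unfolding M(2) \<gamma>' by simp
  qed
  ultimately show ?thesis unfolding eq by simp
qed

section \<open>The representation of U_q on the annihilator of the Serre ideal\<close>

definition rep :: "('i \<Rightarrow> 'k) \<Rightarrow> ('i gen list \<Rightarrow>\<^sub>0 'k) \<Rightarrow> ('i list \<Rightarrow> 'k) \<Rightarrow> 'i list \<Rightarrow> 'k" where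
  "rep z = free_lift (opp_algebra lin_ops) (act z)"

fun act_word :: "('i \<Rightarrow> 'k) \<Rightarrow> 'i gen list \<Rightarrow> ('i list \<Rightarrow> 'k) \<Rightarrow> 'i list \<Rightarrow> 'k" where
  "act_word z [] \<phi> = \<phi>"
| "act_word z (g # w) \<phi> = act_word z w (act z g \<phi>)"

lemma act_closed': "act z g \<in> carrier (opp_algebra lin_ops)"
  by simp

lemma hom_rep: "alg_hom free_algebra (opp_algebra lin_ops) (rep z)"
  unfolding rep_def by (rule OO.alg_hom_free_lift) (rule act_closed')

lemma rep_eq: "rep z p \<phi> w = lin (\<lambda>x. act_word z x \<phi> w) p"
proof -
  have word: "OO.word_image (act z) x = act_word z x" for x
    by (induction x) (simp_all add: OO.word_image_def fun_eq_iff)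
  show ?thesis
    by (rule keys_induct[of p UNIV])
      (simp_all add: rep_def OO.free_lift_zero[OF act_closed'] OO.free_lift_add[OF act_closed']
          OO.free_lift_word[OF act_closed'] word)
qed

lemma annihilator_act_word: "\<phi> \<in> serre_annihilator \<Longrightarrow> act_word z x \<phi> \<in> serre_annihilator"
  by (induction x arbitrary: \<phi>) (simp_all add: annihilator_act)

lemma annihilator_rep:
  assumes "\<phi> \<in> serre_annihilator" shows "rep z p \<phi> \<in> serre_annihilator"
proof (rule keys_induct[of p UNIV])
  have "rep z 0 \<phi> = (\<lambda>w. 0 * \<phi> w)" by (simp add: fun_eq_iff rep_eq)
  then show "rep z 0 \<phi> \<in> serre_annihilator" using annihilator_lin(2)[OF assms assms, of 0] by simp
next
  fix k c p assume "rep z p \<phi> \<in> serre_annihilator"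
  moreover have "rep z (word c k + p) \<phi> = (\<lambda>w. c * act_word z k \<phi> w + rep z p \<phi> w)"
    by (simp add: fun_eq_iff rep_eq)
  ultimately show "rep z (word c k + p) \<phi> \<in> serre_annihilator"
    using annihilator_lin annihilator_act_word[OF assms] by simp
qed simp

text \<open>The elements acting as 0 on the annihilator form a two-sided ideal because the
  annihilator is stable under the action; every relator belongs to it.\<close>

lemma rep_zero:
  assumes z: "\<And>i. z i \<noteq> 0" and p: "p \<in> Uq_ideal A q" and \<phi>: "\<phi> \<in> serre_annihilator"
  shows "rep z p \<phi> = (\<lambda>w. 0)"
proof -
  interpret act: uq_images A q "opp_algebra lin_ops" "act z"
    using z by (rule uq_images_act)
  define Z where "Z = {p. \<forall>\<phi>\<in>serre_annihilator. rep z p \<phi> = (\<lambda>w. 0)}"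
  have closed: "rep z p \<in> carrier lin_ops" for p
    using alg_homD(1)[OF hom_rep, of p z] by simp
  have mult: "rep z (p \<otimes>\<^bsub>free_algebra\<^esub> r) \<phi> = rep z r (rep z p \<phi>)" for p r \<phi>
    using alg_homD(3)[OF hom_rep, of p r z] by simp
  have "ideal Z free_algebra"
  proof (rule idealI[OF FA.ring_axioms])
    show "subgroup Z (add_monoid free_algebra)"
    proof (rule group.subgroupI[OF FA.a_group])
      have "0 \<in> Z" by (simp add: Z_def rep_eq fun_eq_iff)
      then show "Z \<noteq> {}" by blast
    next
      fix r assume "r \<in> Z"
      then have "\<ominus>\<^bsub>free_algebra\<^esub> r \<in> Z"
        unfolding free_uminus using lin_minus[of _ 0 r] by (simp add: Z_def rep_eq fun_eq_iff)
      then show "inv\<^bsub>add_monoid free_algebra\<^esub> r \<in> Z" unfolding a_inv_def .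
    qed (simp_all add: Z_def rep_eq fun_eq_iff)
  next
    show "p \<otimes>\<^bsub>free_algebra\<^esub> r \<in> Z" if "r \<in> Z" for p r
      using that annihilator_rep by (simp add: Z_def mult)
    show "r \<otimes>\<^bsub>free_algebra\<^esub> p \<in> Z" if "r \<in> Z" for p r
      using that lin_ops_zero[OF closed] by (simp add: Z_def mult)
  qed
  moreover have "Uq_relators A q \<subseteq> Z"
  proof
    fix p assume p: "p \<in> Uq_relators A q"
    show "p \<in> Z"
    proof (cases "p \<in> serre_relators")
      case True
      then show ?thesis
        using free_lift_serre[where \<phi>="act z", OF OO.K_algebra_axioms act_closed'] act_serre_E act_serre_F
        unfolding serre_relators_def Z_def rep_def by auto
    next
      case False
      then show ?thesis using act.kills_relators[OF p] by (simp add: Z_def rep_def)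
    qed
  qed
  ultimately have "Uq_ideal A q \<subseteq> Z"
    unfolding Uq_ideal_def by (rule FA.genideal_minimal)
  then show ?thesis using p \<phi> by (auto simp: Z_def)
qed

definition vacuum :: "'i list \<Rightarrow> 'k" where
  "vacuum w = (if w = [] then 1 else 0)"

text \<open>Every word occurring in a Serre element is nonempty.\<close>

lemma vacuum_annihilator: "vacuum \<in> serre_annihilator"
  by (rule annihilatorI) (simp add: serre_word_eq vacuum_def del: sum.atMost_Suc)

end

section \<open>The pairing on words\<close>

fun counit :: "'i gen list \<Rightarrow> 'k::field" where
  "counit [] = 1"
| "counit (g # w) = (if g \<in> torus_gens then counit w else 0)"

lemma counit_append: "counit (x @ y) = counit x * counit y"
  by (induction x) simp_all

lemma csum_zero [simp]: "csum (\<lambda>s t. 0) w = 0"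
proof (induction w)
  case (Cons g w)
  then show ?case by (cases g rule: gen_cases) (simp_all add: csum_torus)
qed simp

lemma csum_counit_left: "csum (\<lambda>s t. counit s * f t) w = f w"
proof (induction w arbitrary: f)
  case (Cons g w)
  then show ?case by (cases g rule: gen_cases) (simp_all add: csum_torus)
qed simp

lemma csum_counit_right: "csum (\<lambda>s t. f s * counit t) w = f w"
proof (induction w arbitrary: f)
  case (Cons g w)
  then show ?case by (cases g rule: gen_cases) (simp_all add: csum_torus)
qed simp

lemma lin_csum: "lin (\<lambda>v. csum (\<lambda>s t. f v s t) w) p = csum (\<lambda>s t. lin (\<lambda>v. f v s t) p) w"
proof (induction w arbitrary: f)
  case (Cons g w)
  then show ?case by (cases g rule: gen_cases) (simp_all add: csum_torus lin_add_fun)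
qed simp

context quantum_parameters
begin

lemma pos_gens_cases:
  assumes "g \<in> pos_gens"
  obtains i where "g = E i" | i where "g = Om i" | i where "g = OmInv i"
  using assms by (auto simp: pos_gens_def)

lemma neg_gens_cases:
  assumes "g \<in> neg_gens"
  obtains i where "g = F i" | i where "g = Om' i" | i where "g = OmInv' i"
  using assms by (auto simp: neg_gens_def)

lemma gens_simps [simp]:
  "E i \<in> pos_gens" "Om i \<in> pos_gens" "OmInv i \<in> pos_gens" "F i \<notin> pos_gens" "Om' i \<notin> pos_gens" "OmInv' i \<notin> pos_gens"
  "F i \<in> neg_gens" "Om' i \<in> neg_gens" "OmInv' i \<in> neg_gens" "E i \<notin> neg_gens" "Om i \<notin> neg_gens" "OmInv i \<notin> neg_gens"
  by (auto simp: pos_gens_def neg_gens_def)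

lemma csum_cong_pos:
  "(\<And>s t. s \<in> lists pos_gens \<Longrightarrow> t \<in> lists pos_gens \<Longrightarrow> f s t = f' s t) \<Longrightarrow> w \<in> lists pos_gens \<Longrightarrow> csum f w = csum f' w"
  by (rule csum_cong[where S=pos_gens]) simp_all

lemma csum_cong_neg:
  "(\<And>s t. s \<in> lists neg_gens \<Longrightarrow> t \<in> lists neg_gens \<Longrightarrow> f s t = f' s t) \<Longrightarrow> w \<in> lists neg_gens \<Longrightarrow> csum f w = csum f' w"
  by (rule csum_cong[where S=neg_gens]) simp_all

definition hopf_pairing :: "('i gen list \<Rightarrow> 'i gen list \<Rightarrow> 'k) \<Rightarrow> bool" where
  "hopf_pairing p \<longleftrightarrow>
     (\<forall>y\<in>lists neg_gens. \<forall>y'\<in>lists neg_gens. \<forall>x\<in>lists pos_gens. p (y @ y') x = csum (\<lambda>s t. p y s * p y' t) x) \<and>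
     (\<forall>y\<in>lists neg_gens. \<forall>x\<in>lists pos_gens. \<forall>x'\<in>lists pos_gens. p y (x @ x') = csum (\<lambda>s t. p s x' * p t x) y)"

lemma hopf_pairingD:
  assumes "hopf_pairing p" "y \<in> lists neg_gens" "x \<in> lists pos_gens"
  shows "y' \<in> lists neg_gens \<Longrightarrow> p (y @ y') x = csum (\<lambda>s t. p y s * p y' t) x"
    and "x' \<in> lists pos_gens \<Longrightarrow> p y (x @ x') = csum (\<lambda>s t. p s x' * p t x) y"
  using assms unfolding hopf_pairing_def by blast+

text \<open>While y has length at most 1, x is shortened letter by letter: the terms of the
  coproduct of a single letter again have length at most 1. Then y is shortened for arbitrary
  x.\<close>

lemma hopf_pairing_unique:
  assumes p: "hopf_pairing p" and p': "hopf_pairing p'"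
    and eq: "\<And>y x. y \<in> lists neg_gens \<Longrightarrow> x \<in> lists pos_gens \<Longrightarrow> length y \<le> 1 \<Longrightarrow> length x \<le> 1 \<Longrightarrow> p y x = p' y x"
    and y: "y \<in> lists neg_gens" and x: "x \<in> lists pos_gens"
  shows "p y x = p' y x"
proof -
  have short: "p y x = p' y x" if "x \<in> lists pos_gens" "y \<in> lists neg_gens" "length y \<le> 1" for x y
    using that
  proof (induction x arbitrary: y)
    case Nil
    then show ?case by (intro eq) simp_all
  next
    case (Cons h x)
    have IH: "p s x = p' s x" "p s [h] = p' s [h]" if "s \<in> lists neg_gens" "length s \<le> 1" for s
      using Cons that by (auto intro: eq)
    have exp: "r y ([h] @ x) = csum (\<lambda>s t. r s x * r t [h]) y" if "hopf_pairing r" for r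
      using Cons by (intro hopf_pairingD(2)[OF that]) auto
    have "csum (\<lambda>s t. p s x * p t [h]) y = csum (\<lambda>s t. p' s x * p' t [h]) y"
    proof (cases y)
      case (Cons g y')
      then have "g \<in> neg_gens" "y' = []" using \<open>y \<in> lists neg_gens\<close> \<open>length y \<le> 1\<close> by auto
      then show ?thesis using Cons by (elim neg_gens_cases) (simp_all add: IH)
    qed (simp add: IH)
    then show ?case using exp[OF p] exp[OF p'] by simp
  qed
  show ?thesis using y x
  proof (induction y arbitrary: x)
    case Nil
    then show ?case by (intro short) simp_all
  next
    case (Cons g y)
    have exp: "r ([g] @ y) x = csum (\<lambda>s t. r [g] s * r y t) x" if "hopf_pairing r" for r
      using Cons by (intro hopf_pairingD(1)[OF that]) auto
    have "csum (\<lambda>s t. p [g] s * p y t) x = csum (\<lambda>s t. p' [g] s * p' y t) x"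
      by (rule csum_cong_pos) (use Cons short[of _ "[g]"] in auto)
    then show ?case using exp[OF p] exp[OF p'] by simp
  qed
qed

text \<open>The weight q_ji is the prescribed value of omega'_i on omega_j. With it omega_j acts at
  the word [i] by q_ji / q_ji = 1, so that the coefficients at [i] and [] obey the coproduct of
  f_i.\<close>

fun pair_gen :: "'i gen \<Rightarrow> 'i gen list \<Rightarrow> 'k" where
  "pair_gen (F i) x = act_word (\<lambda>j. q j i) x vacuum [i]"
| "pair_gen (Om' i) x = act_word (\<lambda>j. q j i) x vacuum []"
| "pair_gen (OmInv' i) x = act_word (\<lambda>j. inverse (q j i)) x vacuum []"
| "pair_gen _ x = 0"

fun pair :: "'i gen list \<Rightarrow> 'i gen list \<Rightarrow> 'k" where
  "pair [] x = counit x"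
| "pair (g # y) x = csum (\<lambda>s t. pair_gen g s * pair y t) x"

lemma vacuum_simps [simp]: "vacuum [] = 1" "vacuum (l # w) = 0"
  by (simp_all add: vacuum_def)

lemma act_word_append: "act_word z (x @ y) \<phi> = act_word z y (act_word z x \<phi>)"
  by (induction x arbitrary: \<phi>) simp_all

text \<open>For trivial weight the coefficient at the empty word is the counit on mixed words too:
  the two summands of the action of f_i cancel there.\<close>

lemma act_word_one: "act_word (\<lambda>_. 1) x \<phi> [] = counit x * \<phi> []"
proof (induction x arbitrary: \<phi>)
  case (Cons g x)
  then show ?case by (cases g) (simp_all add: mult_op_def cons_op_def snoc_op_def)
qed simp

lemma act_word_Nil:
  assumes "x \<in> lists pos_gens"
  shows "act_word z x \<phi> [] = \<phi> [] * act_word z x vacuum []"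
  using assms
proof (induction x arbitrary: \<phi>)
  case Nil
  then show ?case by simp
next
  case (Cons g x)
  have "act_word z x (act z g \<phi>) [] = act z g \<phi> [] * act_word z x vacuum []"
    "act_word z x (act z g vacuum) [] = act z g vacuum [] * act_word z x vacuum []"
    using Cons by blast+
  then show ?case using Cons.hyps(1) by (elim pos_gens_cases) (simp_all add: mult_op_def)
qed

text \<open>At a one-letter word only the values of \<phi> at [] and [i] enter. Torus generators act
  at [i] by 1 thanks to the choice of z, whence the counit; e_i feeds the value at [] into the one
  at [i].\<close>

lemma act_word_single:
  fixes i :: 'i
  assumes "x \<in> lists pos_gens"
  defines "z \<equiv> \<lambda>j. q j i"
  shows "act_word z x \<phi> [i] = counit x * \<phi> [i] + \<phi> [] * act_word z x vacuum [i]"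
  using assms(1)
proof (induction x arbitrary: \<phi>)
  case Nil
  then show ?case by simp
next
  case (Cons g x)
  have "act_word z x (act z g \<phi>) [i] = counit x * act z g \<phi> [i] + act z g \<phi> [] * act_word z x vacuum [i]"
    "act_word z x (act z g vacuum) [i] = counit x * act z g vacuum [i] + act z g vacuum [] * act_word z x vacuum [i]"
    using Cons by blast+
  then show ?case using Cons.hyps(1)
    by (elim pos_gens_cases) (simp_all add: mult_op_def z_def)
qed

text \<open>These identities are the coproducts of f_i, omega'_i and its inverse seen through the
  pairing, with the unit pairing as the counit and the second variable reversed.\<close>

lemma pair_gen_append:
  assumes "x \<in> lists pos_gens" "x' \<in> lists pos_gens"
  shows "pair_gen (F i) (x @ x') = counit x' * pair_gen (F i) x + pair_gen (Om' i) x * pair_gen (F i) x'"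
    "pair_gen (Om' i) (x @ x') = pair_gen (Om' i) x * pair_gen (Om' i) x'"
    "pair_gen (OmInv' i) (x @ x') = pair_gen (OmInv' i) x * pair_gen (OmInv' i) x'"
  using act_word_single[OF assms(2), of i "act_word (\<lambda>j. q j i) x vacuum"]
    act_word_Nil[OF assms(2), of _ "act_word _ x vacuum"]
  by (simp_all add: act_word_append)

lemma pair_append: "pair (y @ y') x = csum (\<lambda>s t. pair y s * pair y' t) x"
proof (induction y arbitrary: x)
  case Nil
  then show ?case by (simp add: csum_counit_left)
next
  case (Cons g y)
  have "pair ((g # y) @ y') x = csum (\<lambda>s t. csum (\<lambda>a b. pair_gen g s * (pair y a * pair y' b)) t) x"
    using Cons by (simp add: csum_mult_left)
  also have "\<dots> = csum (\<lambda>s t. csum (\<lambda>a b. pair_gen g a * (pair y b * pair y' t)) s) x"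
    by (rule csum_coassoc[symmetric])
  also have "\<dots> = csum (\<lambda>s t. pair (g # y) s * pair y' t) x"
    by (simp add: csum_mult_right mult.assoc[symmetric])
  finally show ?case .
qed

lemma pair_single: "pair [g] x = pair_gen g x"
  by (simp add: csum_counit_right)

text \<open>Both sides are the same triple sum over the coproducts of x, x' and y, with the order of
  summation changed.\<close>

lemma csum_exchange:
  "csum (\<lambda>s t. csum (\<lambda>s' t'. (h s * k s') * csum (\<lambda>a b. f a t' * f b t) y) x') x
    = csum (\<lambda>a b. csum (\<lambda>s' t'. k s' * f a t') x' * csum (\<lambda>s t. h s * f b t) x) y"
  for f :: "'i gen list \<Rightarrow> 'i gen list \<Rightarrow> 'k"
proof -
  have "csum (\<lambda>s t. csum (\<lambda>s' t'. (h s * k s') * csum (\<lambda>a b. f a t' * f b t) y) x') x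
    = csum (\<lambda>s t. csum (\<lambda>s' t'. csum (\<lambda>a b. (k s' * f a t') * (h s * f b t)) y) x') x"
    by (simp add: csum_mult_left[symmetric] mult_ac)
  also have "\<dots> = csum (\<lambda>s t. csum (\<lambda>a b. csum (\<lambda>s' t'. (k s' * f a t') * (h s * f b t)) x') y) x"
    by (simp only: csum_swap[of _ y x'])
  also have "\<dots> = csum (\<lambda>a b. csum (\<lambda>s t. csum (\<lambda>s' t'. k s' * f a t') x' * (h s * f b t)) x) y"
    by (subst csum_swap) (simp add: csum_mult_right)
  finally show ?thesis by (simp add: csum_mult_left)
qed

text \<open>The coproduct is multiplicative, so x x' is distributed over the letter g and the rest
  y. The functional of g then splits by \<open>pair_gen_append\<close>, that of y by induction, and
  \<open>csum_exchange\<close> regroups the sums.\<close>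

lemma pair_append_right:
  assumes "y \<in> lists neg_gens" "x \<in> lists pos_gens" "x' \<in> lists pos_gens"
  shows "pair y (x @ x') = csum (\<lambda>s t. pair s x' * pair t x) y"
  using assms
proof (induction y arbitrary: x x')
  case Nil
  then show ?case by (simp add: counit_append mult.commute)
next
  case (Cons g y)
  have exp: "pair (g # y) (x @ x') = csum (\<lambda>s t. csum (\<lambda>s' t'. r s s' * csum (\<lambda>a b. pair a t' * pair b t) y) x') x"
    if "\<And>s s'. s \<in> lists pos_gens \<Longrightarrow> s' \<in> lists pos_gens \<Longrightarrow> pair_gen g (s @ s') = r s s'" for r
  proof -
    have "pair (g # y) (x @ x') = csum (\<lambda>s t. csum (\<lambda>s' t'. pair_gen g (s @ s') * pair y (t @ t')) x') x"
      by (simp add: csum_append)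
    also have "\<dots> = csum (\<lambda>s t. csum (\<lambda>s' t'. r s s' * csum (\<lambda>a b. pair a t' * pair b t) y) x') x"
      by (intro csum_cong_pos) (use Cons that in auto)
    finally show ?thesis .
  qed
  from Cons.hyps(1) show ?case
  proof (cases rule: neg_gens_cases)
    case (1 i)
    have "pair_gen g (s @ s') = pair_gen (F i) s * counit s' + pair_gen (Om' i) s * pair_gen (F i) s'"
      if "s \<in> lists pos_gens" "s' \<in> lists pos_gens" for s s'
      unfolding 1 pair_gen_append(1)[OF that] by (simp only: mult.commute)
    from exp[OF this] have "pair (g # y) (x @ x') = csum (\<lambda>s t. csum (\<lambda>s' t'.
        (pair_gen (F i) s * counit s' + pair_gen (Om' i) s * pair_gen (F i) s') * csum (\<lambda>a b. pair a t' * pair b t) y)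
            x') x" .
    then show ?thesis
      unfolding distrib_right csum_add csum_exchange by (simp add: 1 csum_counit_left)
  next
    case (2 i)
    have "pair_gen g (s @ s') = pair_gen g s * pair_gen g s'"
      if "s \<in> lists pos_gens" "s' \<in> lists pos_gens" for s s'
      unfolding 2 by (rule pair_gen_append(2)[OF that])
    from exp[OF this] have "pair (g # y) (x @ x') = csum (\<lambda>s t. csum (\<lambda>s' t'.
        (pair_gen g s * pair_gen g s') * csum (\<lambda>a b. pair a t' * pair b t) y) x') x" .
    then show ?thesis unfolding csum_exchange by (simp add: 2)
  next
    case (3 i)
    have "pair_gen g (s @ s') = pair_gen g s * pair_gen g s'"
      if "s \<in> lists pos_gens" "s' \<in> lists pos_gens" for s s'
      unfolding 3 by (rule pair_gen_append(3)[OF that])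
    from exp[OF this] have "pair (g # y) (x @ x') = csum (\<lambda>s t. csum (\<lambda>s' t'.
        (pair_gen g s * pair_gen g s') * csum (\<lambda>a b. pair a t' * pair b t) y) x') x" .
    then show ?thesis unfolding csum_exchange by (simp add: 3)
  qed
qed

lemma hopf_pairing_pair: "hopf_pairing pair"
  unfolding hopf_pairing_def using pair_append pair_append_right by blast

lemma pair_gens:
  "pair [F i] [E j] = (if i = j then fe_value i else 0)" "pair [F i] [Om j] = 0" "pair [F i] [OmInv j] = 0"
  "pair [Om' i] [E j] = 0" "pair [Om' i] [Om j] = q j i" "pair [Om' i] [OmInv j] = inverse (q j i)"
  "pair [OmInv' i] [E j] = 0" "pair [OmInv' i] [Om j] = inverse (q j i)" "pair [OmInv' i] [OmInv j] = q j i"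
  "pair [F i] [] = 0" "pair [Om' i] [] = 1" "pair [OmInv' i] [] = 1"
  by (auto simp: pair_single mult_op_def simp del: pair.simps)

subsection \<open>Functionals on the quantum group\<close>

definition kills_ideal :: "('i gen list \<Rightarrow> 'k) \<Rightarrow> bool" where
  "kills_ideal f \<longleftrightarrow> (\<forall>p\<in>Uq_ideal A q. lin f p = 0)"

definition functional :: "('i gen list \<Rightarrow> 'k) \<Rightarrow> ('i gen list \<Rightarrow>\<^sub>0 'k) set \<Rightarrow> 'k" where
  "functional f X = lin f (SOME p. cl p = X)"

lemma functional_cl:
  assumes "kills_ideal f"
  shows "functional f (cl p) = lin f p"
proof -
  have "cl (SOME r. cl r = cl p) = cl p" by (rule someI) (rule refl)
  then have "lin f ((SOME r. cl r = cl p) - p) = 0"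
    using assms by (auto simp: kills_ideal_def cl_eq_iff)
  then show ?thesis by (simp add: functional_def)
qed

lemma functional_add:
  assumes f: "kills_ideal f" and "X \<in> carrier U" "Y \<in> carrier U"
  shows "functional f (X \<oplus>\<^bsub>U\<^esub> Y) = functional f X + functional f Y"
proof -
  obtain p r where "X = cl p" "Y = cl r" using assms by (auto simp: carrier_U)
  then show ?thesis by (simp add: functional_cl[OF f] cl_add[symmetric])
qed

lemma functional_smult:
  assumes f: "kills_ideal f" and "X \<in> carrier U"
  shows "functional f (c \<odot>\<^bsub>U\<^esub> X) = c * functional f X"
proof -
  obtain p where "X = cl p" using assms by (auto simp: carrier_U)
  then show ?thesis by (simp add: functional_cl[OF f] cl_scale[symmetric])
qed

lemmas functional_linear = functional_add functional_smult

text \<open>The product of functionals dual to the coproduct; this is where the well-definedness of the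
  coproduct enters the construction of the pairing.\<close>

lemma kills_ideal_convolution:
  assumes f: "kills_ideal f" and g: "kills_ideal g"
  shows "kills_ideal (\<lambda>x. csum (\<lambda>s t. f s * g t) x)"
  unfolding kills_ideal_def
proof
  fix p assume p: "p \<in> Uq_ideal A q"
  have "cl p = cl 0" using p by (simp add: cl_eq_iff)
  then have "tensor_class U U (coproduct p) = tensor_class U U (coproduct 0)" by (simp flip: comult_eq)
  moreover have "coproduct 0 = 0" by (simp add: coproduct_def)
  ultimately have "coproduct p \<in> tensor_ideal U U"
    using UU.tensor_class_eq_iff[of "coproduct p" 0] keys_coproduct by simp
  moreover have "bilin U U (\<lambda>X Y. functional f X * functional g Y)"
    by (simp add: bilin_def functional_linear[OF f] functional_linear[OF g] algebra_simps)
  ultimately have "lin (\<lambda>(X, Y). functional f X * functional g Y) (coproduct p) = 0"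
    by (rule UU.lin_tensor_ideal)
  then show "lin (\<lambda>x. csum (\<lambda>s t. f s * g t) x) p = 0"
    by (simp add: lin_coproduct functional_cl[OF f] functional_cl[OF g])
qed

lemma kills_ideal_act_word:
  assumes "\<And>i. z i \<noteq> 0"
  shows "kills_ideal (\<lambda>x. act_word z x vacuum w)"
  unfolding kills_ideal_def rep_eq[symmetric] using rep_zero[OF assms _ vacuum_annihilator] by simp

text \<open>The empty word gives the counit, a matrix coefficient of trivial weight; each further
  letter is one convolution with a matrix coefficient.\<close>

lemma kills_ideal_pair: "y \<in> lists neg_gens \<Longrightarrow> kills_ideal (pair y)"
proof (induction y)
  case Nil
  have "pair [] = (\<lambda>x. act_word (\<lambda>_. 1) x vacuum [])"
    by (simp add: fun_eq_iff act_word_one)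
  then show ?case using kills_ideal_act_word[where z="\<lambda>_. 1" and w="[]"] by simp
next
  case (Cons g y)
  have "g \<in> neg_gens" using Cons.prems by simp
  then have "kills_ideal (pair_gen g)"
  proof (cases rule: neg_gens_cases)
    case (1 i)
    have "pair_gen g = (\<lambda>x. act_word (\<lambda>j. q j i) x vacuum [i])" by (simp add: 1 fun_eq_iff)
    then show ?thesis by (simp add: kills_ideal_act_word)
  next
    case (2 i)
    have "pair_gen g = (\<lambda>x. act_word (\<lambda>j. q j i) x vacuum [])" by (simp add: 2 fun_eq_iff)
    then show ?thesis by (simp add: kills_ideal_act_word)
  next
    case (3 i)
    have "pair_gen g = (\<lambda>x. act_word (\<lambda>j. inverse (q j i)) x vacuum [])" by (simp add: 3 fun_eq_iff)
    then show ?thesis by (simp add: kills_ideal_act_word)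
  qed
  moreover have "pair (g # y) = (\<lambda>x. csum (\<lambda>s t. pair_gen g s * pair y t) x)" by (simp add: fun_eq_iff)
  ultimately show ?case using kills_ideal_convolution[of "pair_gen g" "pair y"] Cons by simp
qed

end

subsection \<open>Exchanging the two halves\<close>

fun swap_gen :: "'i gen \<Rightarrow> 'i gen" where
  "swap_gen (E i) = F i"
| "swap_gen (F i) = E i"
| "swap_gen (Om i) = Om' i"
| "swap_gen (OmInv i) = OmInv' i"
| "swap_gen (Om' i) = Om i"
| "swap_gen (OmInv' i) = OmInv i"

lemma swap_gen_torus [simp]: "swap_gen g \<in> torus_gens \<longleftrightarrow> g \<in> torus_gens"
  by (cases g) simp_all

lemma csum_map_swap_gen:
  "csum f (map swap_gen w) = csum (\<lambda>s t. f (map swap_gen t) (map swap_gen s)) w"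
proof (induction w arbitrary: f)
  case (Cons g w)
  then show ?case by (cases g rule: gen_cases) (simp_all add: csum_torus)
qed simp

context quantum_parameters
begin

lemma swap_gen_gens [simp]: "swap_gen g \<in> pos_gens \<longleftrightarrow> g \<in> neg_gens" "swap_gen g \<in> neg_gens \<longleftrightarrow> g \<in> pos_gens"
  by (cases g; simp)+

lemma map_swap_gen_lists [simp]:
  "map swap_gen w \<in> lists pos_gens \<longleftrightarrow> w \<in> lists neg_gens" "map swap_gen w \<in> lists neg_gens \<longleftrightarrow> w \<in> lists pos_gens"
  by (induction w) simp_all

lemma quantum_parameters_transpose: "quantum_parameters A (\<lambda>i j. q j i)"
  using q_mult_q A_nonpos q_not_root by unfold_locales (simp_all add: mult.commute)

text \<open>Exchanging \<open>e\<^sub>i\<close> with \<open>f\<^sub>i\<close> and \<open>\<omega>\<^sub>i\<close> with \<open>\<omega>'\<^sub>i\<close> is an isomorphism onto the quantum group of the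
  transposed parameters that reverses the coproduct.  It turns the argument for the second variable of
  the pairing into the one for the first.\<close>

lemma lin_pair_left_zero:
  assumes p: "p \<in> Uq_ideal A q" "Poly_Mapping.keys p \<subseteq> lists neg_gens" and x: "x \<in> lists pos_gens"
  shows "lin (\<lambda>y. pair y x) p = 0"
proof -
  interpret Tr: quantum_parameters A "\<lambda>i j. q j i" by (rule quantum_parameters_transpose)
  interpret sw: uq_images A q Tr.U "\<lambda>g. Tr.u (swap_gen g)"
  proof
    show "Tr.u (swap_gen g) \<otimes>\<^bsub>Tr.U\<^esub> Tr.u (swap_gen h) = Tr.u (swap_gen h) \<otimes>\<^bsub>Tr.U\<^esub> Tr.u (swap_gen g)"
      if "g \<in> torus_gens" "h \<in> torus_gens" for g h
      using that by (intro Tr.torus_comm) simp_all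
    show "Tr.u (swap_gen (E i)) \<otimes>\<^bsub>Tr.U\<^esub> Tr.u (swap_gen (F j)) = Tr.u (swap_gen (F j)) \<otimes>\<^bsub>Tr.U\<^esub> Tr.u (swap_gen (E i)) \<oplus>\<^bsub>Tr.U\<^esub>
      (if i = j then cartan i \<odot>\<^bsub>Tr.U\<^esub> Tr.u (swap_gen (Om i)) \<oplus>\<^bsub>Tr.U\<^esub> (- cartan i) \<odot>\<^bsub>Tr.U\<^esub> Tr.u (swap_gen (Om' i)) else
          \<zero>\<^bsub>Tr.U\<^esub>)" for i j
    proof -
      have "Tr.u (F i) \<otimes>\<^bsub>Tr.U\<^esub> Tr.u (E j) \<in> carrier Tr.U" by simp
      from Tr.U.cancel_opposite[OF this, of "Tr.u (Om i)" "Tr.u (Om' i)" "cartan i"] show ?thesis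
        by (cases "i = j") (simp_all add: Tr.E_F Tr.cartan_def cartan_def del: Tr.U.smult_add_cancel)
    qed
  qed (simp_all add: Tr.Om_OmInv Tr.Om'_OmInv' Tr.Om_E Tr.Om'_E Tr.Om_F Tr.Om'_F)
  \<comment> \<open>The pairing for the transposed parameters with its variables exchanged. It
    agrees with \<open>pair\<close> on short words, hence on all words of the halves by
    uniqueness.\<close>
  define p' where "p' = (\<lambda>y x. Tr.pair (map swap_gen x) (map swap_gen y))"
  have "hopf_pairing p'"
    unfolding hopf_pairing_def p'_def
    by (simp add: Tr.pair_append Tr.pair_append_right csum_map_swap_gen o_def mult.commute del: csum.simps)
  have kill: "Tr.kills_ideal (Tr.pair (map swap_gen x))"
    using x by (intro Tr.kills_ideal_pair) simp
  have serre: "free_lift Tr.U (\<lambda>g. Tr.u (swap_gen g)) (serre_E A q i j) = \<zero>\<^bsub>Tr.U\<^esub>"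
    "free_lift Tr.U (\<lambda>g. Tr.u (swap_gen g)) (serre_F A q i j) = \<zero>\<^bsub>Tr.U\<^esub>" if "i \<noteq> j" for i j
  proof -
    \<comment> \<open>The exchange sends a Serre element to one formed on the other side of the
      algebra with q_ij where the transposed algebra has q_ji; \<open>qcomms_transpose\<close>
      identifies the two up to a nonzero scalar.\<close>
    have c: "q i i ^ serre_degree i j * q i j * q j i = 1" "q i i ^ serre_degree i j * q j i * q i j = 1"
      using q_serre_degree[OF that] by (simp_all add: mult_ac)
    obtain \<gamma> where \<gamma>: "\<gamma> \<noteq> 0" "K_algebra.qcomms (opp_algebra Tr.U) (Tr.u (F i)) (Tr.serre_powers i j) (Tr.u (F j))
        = \<gamma> \<odot>\<^bsub>Tr.U\<^esub> Tr.U.qcomms (Tr.u (F i)) (serre_powers i j) (Tr.u (F j))"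
      using qcomms_transpose[OF Tr.U.K_algebra_axioms _ _ c(1), of "Tr.u (F i)" "Tr.u (F j)"]
      unfolding serre_powers_def Tr.serre_powers_def by (auto simp del: qpowers.simps)
    then have \<gamma>0: "\<gamma> \<odot>\<^bsub>Tr.U\<^esub> Tr.U.qcomms (Tr.u (F i)) (serre_powers i j) (Tr.u (F j)) = \<zero>\<^bsub>Tr.U\<^esub>"
      using Tr.serre_zero(2)[OF that] by metis
    have "Tr.U.qcomms (Tr.u (F i)) (serre_powers i j) (Tr.u (F j))
        = inverse \<gamma> \<odot>\<^bsub>Tr.U\<^esub> (\<gamma> \<odot>\<^bsub>Tr.U\<^esub> Tr.U.qcomms (Tr.u (F i)) (serre_powers i j) (Tr.u (F j)))"
      using \<gamma>(1) by (simp add: Tr.U.smult_smult)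
    also have "\<dots> = \<zero>\<^bsub>Tr.U\<^esub>"
      unfolding \<gamma>0 by simp
    finally have 1: "Tr.U.qcomms (Tr.u (F i)) (serre_powers i j) (Tr.u (F j)) = \<zero>\<^bsub>Tr.U\<^esub>" .
    have 2: "K_algebra.qcomms (opp_algebra Tr.U) (Tr.u (E i)) (serre_powers i j) (Tr.u (E j)) = \<zero>\<^bsub>Tr.U\<^esub>"
      using qcomms_transpose[OF Tr.U.K_algebra_axioms _ _ c(2), of "Tr.u (E i)" "Tr.u
          (E j)"] Tr.serre_zero(1)[OF that]
      unfolding serre_powers_def Tr.serre_powers_def by (auto simp del: qpowers.simps)
    show "free_lift Tr.U (\<lambda>g. Tr.u (swap_gen g)) (serre_E A q i j) = \<zero>\<^bsub>Tr.U\<^esub>"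
      "free_lift Tr.U (\<lambda>g. Tr.u (swap_gen g)) (serre_F A q i j) = \<zero>\<^bsub>Tr.U\<^esub>"
      using 1 2 free_lift_serre[where \<phi>="\<lambda>g. Tr.u (swap_gen g)", OF Tr.U.K_algebra_axioms _ that] by simp_all
  qed
  have "free_lift Tr.U (\<lambda>g. Tr.u (swap_gen g)) r = \<zero>\<^bsub>Tr.U\<^esub>" if r: "r \<in> Uq_relators A q" for r
  proof (cases "r \<in> serre_relators")
    case True
    then show ?thesis using serre unfolding serre_relators_def by auto
  qed (use r sw.kills_relators in blast)
  from the_elem_cl[OF Tr.U.K_algebra_axioms sw.hom this]
  have "free_lift Tr.U (\<lambda>g. Tr.u (swap_gen g)) p = free_lift Tr.U (\<lambda>g. Tr.u (swap_gen g)) 0"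
    using p(1) cl_eq_iff[of p 0] by (metis diff_zero)
  then have zero: "free_lift Tr.U (\<lambda>g. Tr.u (swap_gen g)) p = \<zero>\<^bsub>Tr.U\<^esub>"
    using Tr.U.free_lift_zero[where \<phi>="\<lambda>g. Tr.u (swap_gen g)"] by simp
  have word: "Tr.U.word_image (\<lambda>g. Tr.u (swap_gen g)) w = Tr.cl (word 1 (map swap_gen w))" for w
    by (induction w) (simp_all add: Tr.cl_one Tr.cl_word_Cons)
  have "Tr.functional (Tr.pair (map swap_gen x)) (free_lift Tr.U (\<lambda>g. Tr.u (swap_gen g)) r)
      = lin (\<lambda>y. p' y x) r" for r
  proof (rule keys_induct[of r UNIV])
    show "Tr.functional (Tr.pair (map swap_gen x)) (free_lift Tr.U (\<lambda>g. Tr.u (swap_gen g)) 0) = lin (\<lambda>y. p' y x) 0"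
      using Tr.U.free_lift_zero[where \<phi>="\<lambda>g. Tr.u (swap_gen g)"] Tr.functional_cl[OF kill, of 0]
          by (simp add: Tr.cl_zero)
  next
    fix k c r assume "Tr.functional (Tr.pair (map swap_gen x)) (free_lift Tr.U (\<lambda>g. Tr.u (swap_gen g)) r)
        = lin (\<lambda>y. p' y x) r"
    moreover have "Tr.functional (Tr.pair (map swap_gen x)) (Tr.cl (word 1 (map swap_gen k))) = p' k x"
      by (simp add: Tr.functional_cl[OF kill] p'_def)
    ultimately show "Tr.functional (Tr.pair (map swap_gen x)) (free_lift Tr.U (\<lambda>g. Tr.u (swap_gen g)) (word c k + r))
        = lin (\<lambda>y. p' y x) (word c k + r)"
      using Tr.U.free_lift_add[where \<phi>="\<lambda>g. Tr.u (swap_gen g)"] Tr.U.free_lift_closed[where \<phi>="\<lambda>g. Tr.u (swap_gen g)"]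
      by (simp add: sw.word_eq Tr.functional_linear[OF kill] word)
  qed simp
  from this[of p] have "lin (\<lambda>y. p' y x) p = 0"
    using Tr.functional_cl[OF kill, of 0] by (simp add: zero Tr.cl_zero)
  moreover have "pair y x = p' y x" if "y \<in> lists neg_gens" for y
    using hopf_pairing_pair \<open>hopf_pairing p'\<close> _ that x
  proof (rule hopf_pairing_unique)
    fix y x :: "'i gen list"
    assume yx: "y \<in> lists neg_gens" "x \<in> lists pos_gens" "length y \<le> 1" "length x \<le> 1"
    have "y = [] \<or> (\<exists>g\<in>neg_gens. y = [g])" using yx by (cases y) auto
    moreover have "x = [] \<or> (\<exists>h\<in>pos_gens. x = [h])" using yx by (cases x) auto
    moreover have "pair [g] [h] = p' [g] [h]" if "g \<in> neg_gens" "h \<in> pos_gens" for g h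
      using that by (elim neg_gens_cases pos_gens_cases)
        (simp_all add: p'_def pair_gens Tr.pair_gens fe_value_def Tr.fe_value_def del: pair.simps Tr.pair.simps)
    moreover have "pair [] [h] = p' [] [h]" if "h \<in> pos_gens" for h
      using that by (elim pos_gens_cases)
        (simp_all add: p'_def Tr.pair_gens del: Tr.pair.simps)
    moreover have "pair [g] [] = p' [g] []" if "g \<in> neg_gens" for g
      using that by (elim neg_gens_cases)
        (simp_all add: p'_def pair_gens del: pair.simps(2))
    moreover have "pair [] [] = p' [] []" by (simp add: p'_def)
    ultimately show "pair y x = p' y x" by blast
  qed
  ultimately show ?thesis using p(2) by (subst lin_cong[where g="\<lambda>y. p' y x"]) auto
qed

end

subsection \<open>Torus elements\<close>

text \<open>Commuting factors make the maps b -> f i b left-commutative, so the fold behind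
  \<open>finprod\<close> can be unfolded along any duplicate-free enumeration.\<close>

lemma (in monoid) finprod_commuting:
  assumes "distinct xs" "\<And>i. f i \<in> carrier G" "\<And>i j. f i \<otimes> f j = f j \<otimes> f i"
  shows "finprod G f (set xs) = foldr (\<lambda>i b. f i \<otimes> b) xs \<one>"
proof -
  interpret LCD UNIV "carrier G" "mult G \<circ> f"
    by unfold_locales (simp_all add: assms m_assoc[symmetric])
  show ?thesis
    using assms(1) by (induction xs) (simp_all add: finprod_def foldD_insert)
qed

definition power_word :: "'g \<Rightarrow> 'g \<Rightarrow> int \<Rightarrow> 'g list" where
  "power_word g g' n = (if n \<ge> 0 then replicate (nat n) g else replicate (nat (- n)) g')"

text \<open>A word needs an ordering of the factors: xs is meant to enumerate the index set without
  repetition.\<close>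

definition omega_word :: "'i list \<Rightarrow> ('i \<Rightarrow> int) \<Rightarrow> 'i gen list" where
  "omega_word xs \<mu> = concat (map (\<lambda>i. power_word (Om i) (OmInv i) (\<mu> i)) xs)"

definition omega'_word :: "'i list \<Rightarrow> ('i \<Rightarrow> int) \<Rightarrow> 'i gen list" where
  "omega'_word xs \<mu> = concat (map (\<lambda>i. power_word (Om' i) (OmInv' i) (\<mu> i)) xs)"

lemma power_word_lists: "g \<in> S \<Longrightarrow> g' \<in> S \<Longrightarrow> power_word g g' n \<in> lists S"
  by (auto simp: power_word_def)

lemma replicate_in_lists [simp]: "g \<in> S \<Longrightarrow> replicate n g \<in> lists S"
  by (induction n) simp_all

lemma csum_torus_word: "w \<in> lists torus_gens \<Longrightarrow> csum f w = f w w"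
proof (induction w arbitrary: f)
  case (Cons g w)
  then have "g \<in> torus_gens" by simp
  then show ?case using Cons by (simp add: csum_torus)
qed simp

context quantum_parameters
begin

lemma torus_words_commute:
  assumes "s \<in> lists torus_gens" "t \<in> lists torus_gens"
  shows "cl (word 1 s) \<otimes>\<^bsub>U\<^esub> cl (word 1 t) = cl (word 1 t) \<otimes>\<^bsub>U\<^esub> cl (word 1 s)"
  using assms(1)
proof (induction s)
  case Nil
  then show ?case by (simp add: cl_one)
next
  case (Cons g s)
  have ug: "u g \<otimes>\<^bsub>U\<^esub> cl (word 1 t) = cl (word 1 t) \<otimes>\<^bsub>U\<^esub> u g"
    using assms(2)
  proof (induction t)
    case Nil
    then show ?case by (simp add: cl_one)
  next
    case (Cons h t)
    have "u g \<otimes>\<^bsub>U\<^esub> u h = u h \<otimes>\<^bsub>U\<^esub> u g" using Cons \<open>g \<in> torus_gens\<close> by (intro torus_comm) auto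
    then have "u g \<otimes>\<^bsub>U\<^esub> cl (word 1 (h # t)) = u h \<otimes>\<^bsub>U\<^esub> (u g \<otimes>\<^bsub>U\<^esub> cl (word 1 t))"
      by (simp add: cl_word_Cons U.m_assoc[symmetric])
    then show ?case using Cons by (simp add: cl_word_Cons U.m_assoc)
  qed
  have "cl (word 1 (g # s)) \<otimes>\<^bsub>U\<^esub> cl (word 1 t) = u g \<otimes>\<^bsub>U\<^esub> cl (word 1 t) \<otimes>\<^bsub>U\<^esub> cl (word 1 s)"
    using Cons by (simp add: cl_word_Cons U.m_assoc)
  also have "\<dots> = cl (word 1 t) \<otimes>\<^bsub>U\<^esub> cl (word 1 (g # s))"
    using ug by (simp add: cl_word_Cons U.m_assoc[symmetric])
  finally show ?case .
qed

lemma int_pow_cl: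
  assumes gg': "u g \<otimes>\<^bsub>U\<^esub> u g' = \<one>\<^bsub>U\<^esub>" and "g \<in> torus_gens" "g' \<in> torus_gens"
  shows "u g [^]\<^bsub>U\<^esub> (n :: int) = cl (word 1 (power_word g g' n))"
proof -
  have pow: "u h [^]\<^bsub>U\<^esub> (k :: nat) = cl (word 1 (replicate k h))" for h k
  proof (induction k)
    case (Suc k)
    have "replicate (Suc k) h = replicate k h @ [h]" by (simp add: replicate_append_same)
    then show ?case using Suc by (simp only: U.nat_pow_Suc cl_word_append u_eq)
  qed (simp add: cl_one)
  have one: "cl (word 1 (replicate k g)) \<otimes>\<^bsub>U\<^esub> cl (word 1 (replicate k g')) = \<one>\<^bsub>U\<^esub>" for k
  proof (induction k)
    case (Suc k)
    have "cl (word 1 (replicate (Suc k) g)) = cl (word 1 (replicate k g)) \<otimes>\<^bsub>U\<^esub> u g"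
      unfolding u_eq cl_word_append[symmetric] by (simp add: replicate_append_same)
    moreover have "cl (word 1 (replicate (Suc k) g')) = u g' \<otimes>\<^bsub>U\<^esub> cl (word 1 (replicate k g'))"
      by (simp add: cl_word_Cons)
    moreover have "u g \<otimes>\<^bsub>U\<^esub> (u g' \<otimes>\<^bsub>U\<^esub> z) = z" if "z \<in> carrier U" for z
      using that by (simp add: U.m_assoc[symmetric] gg')
    ultimately show ?case using Suc by (simp add: U.m_assoc del: replicate_Suc)
  qed (simp add: cl_one)
  have inv: "inv\<^bsub>U\<^esub> (cl (word 1 (replicate k g))) = cl (word 1 (replicate k g'))" for k
    using one[of k] torus_words_commute[of "replicate k g" "replicate k g'"] assms(2,3)
    by (intro U.inv_char) auto
  show ?thesis by (auto simp: int_pow_def2 power_word_def pow inv)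
qed

lemma omega_word_torus: "omega_word xs \<mu> \<in> lists torus_gens" "omega'_word xs \<mu> \<in> lists torus_gens"
  and omega_word_gens: "omega_word xs \<mu> \<in> lists pos_gens" "omega'_word xs \<mu> \<in> lists neg_gens"
  by (induction xs) (simp_all add: omega_word_def omega'_word_def power_word_lists del: in_lists_conv_set)

lemma omega_eq:
  assumes "distinct xs" "set xs = UNIV"
  shows "omega A q \<mu> = cl (word 1 (omega_word xs \<mu>))" "omega' A q \<mu> = cl (word 1 (omega'_word xs \<mu>))"
proof -
  have foldr: "foldr (\<lambda>i b. cl (word 1 (f i)) \<otimes>\<^bsub>U\<^esub> b) xs \<one>\<^bsub>U\<^esub> = cl (word 1 (concat (map f xs)))" for f :: "'i \<Rightarrow> _"
    by (induction xs) (simp_all add: cl_one cl_word_append)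
  have pow: "u (Om i) [^]\<^bsub>U\<^esub> n = cl (word 1 (power_word (Om i) (OmInv i) n))"
    "u (Om' i) [^]\<^bsub>U\<^esub> n = cl (word 1 (power_word (Om' i) (OmInv' i) n))" for i and n :: int
    by (rule int_pow_cl; simp add: Om_OmInv Om'_OmInv')+
  show "omega A q \<mu> = cl (word 1 (omega_word xs \<mu>))"
    unfolding omega_def pow assms(2)[symmetric] omega_word_def foldr[symmetric]
    by (intro U.finprod_commuting assms(1) torus_words_commute power_word_lists) simp_all
  show "omega' A q \<mu> = cl (word 1 (omega'_word xs \<mu>))"
    unfolding omega'_def pow assms(2)[symmetric] omega'_word_def foldr[symmetric]
    by (intro U.finprod_commuting assms(1) torus_words_commute power_word_lists) simp_all
qed

lemma power_word_simps [simp]: "power_word g g' 0 = []" "power_word g g' 1 = [g]" "power_word g g' (-1) = [g']"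
  by (simp_all add: power_word_def)

lemma concat_single:
  "distinct xs \<Longrightarrow> concat (map (\<lambda>i. if i = j then v else []) xs) = (if j \<in> set xs then v else [])"
  by (induction xs) auto

text \<open>Since the unit and the inverse generators are torus elements of weight 0 and of negative
  simple weight, the values prescribed on torus elements cover every torus letter in the uniqueness
  argument.\<close>

lemma torus_gen_is_omega:
  shows "\<one>\<^bsub>U\<^esub> = omega A q (\<lambda>_. 0)" "\<one>\<^bsub>U\<^esub> = omega' A q (\<lambda>_. 0)"
    "u (Om i) = omega A q (\<lambda>j. if j = i then 1 else 0)" "u (OmInv i) = omega A q (\<lambda>j. if j = i then -1 else 0)"
    "u (Om' i) = omega' A q (\<lambda>j. if j = i then 1 else 0)" "u (OmInv' i) = omega' A q (\<lambda>j. if j = i then -1 else 0)"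
proof -
  obtain xs :: "'i list" where xs: "set xs = UNIV" "distinct xs"
      using finite_distinct_list[OF finite_class.finite_UNIV] by blast
  have zero: "concat (map (\<lambda>i. []) ys) = []" for ys :: "'i list" by simp
  have if_power: "power_word g g' (if b then n else 0) = (if b then power_word g g' n else [])" for g g' :: "'i gen"
      and b n
    by simp
  show "\<one>\<^bsub>U\<^esub> = omega A q (\<lambda>_. 0)" "\<one>\<^bsub>U\<^esub> = omega' A q (\<lambda>_. 0)"
    by (simp_all add: omega_eq[OF xs(2,1)] omega_word_def omega'_word_def cl_one zero)
  have c: "concat (map (\<lambda>j. if j = i then f j else []) xs) = f i" for f :: "'i \<Rightarrow> 'i gen list"
    using concat_single[OF xs(2), of i "f i"] xs(1) by (simp cong: if_cong)
  show "u (Om i) = omega A q (\<lambda>j. if j = i then 1 else 0)" "u (OmInv i) = omega A q (\<lambda>j. if j = i then -1 else 0)"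
    "u (Om' i) = omega' A q (\<lambda>j. if j = i then 1 else 0)" "u (OmInv' i) = omega' A q (\<lambda>j. if j = i then -1 else 0)"
    by (simp_all only: omega_eq[OF xs(2,1)] omega_word_def omega'_word_def if_power c power_word_simps u_eq)
qed

text \<open>A torus word is group-like: its coproduct has a single term.\<close>

lemma pair_torus_left: "x \<in> lists torus_gens \<Longrightarrow> pair (y @ y') x = pair y x * pair y' x"
  by (simp only: pair_append csum_torus_word)

lemma pair_torus_right:
  assumes "y \<in> lists torus_gens" "y \<in> lists neg_gens" "x \<in> lists pos_gens" "x' \<in> lists pos_gens"
  shows "pair y (x @ x') = pair y x * pair y x'"
  unfolding pair_append_right[OF assms(2-4)] using assms(1) by (simp add: csum_torus_word mult.commute)

lemma counit_torus: "x \<in> lists torus_gens \<Longrightarrow> counit x = 1"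
  by (induction x) simp_all

lemma pair_torus_Nil: "y \<in> lists torus_gens \<Longrightarrow> y \<in> lists neg_gens \<Longrightarrow> pair y [] = 1"
proof (induction y)
  case (Cons g y)
  then have "g \<in> neg_gens" "g \<in> torus_gens" by simp_all
  then show ?case using Cons by (elim neg_gens_cases) simp_all
qed simp

lemma pair_replicate:
  assumes "g \<in> torus_gens" "g \<in> neg_gens" "h \<in> torus_gens" "h \<in> pos_gens"
  shows "pair (replicate m g) (replicate n h) = pair [g] [h] ^ (m * n)"
proof -
  have 1: "pair [g] (replicate n h) = pair [g] [h] ^ n"
  proof (induction n)
    case 0
    then show ?case using pair_torus_Nil[of "[g]"] assms by (simp del: pair.simps)
  next
    case (Suc n)
    then show ?case using pair_torus_right[of "[g]" "[h]" "replicate n h"] assms by (simp del: pair.simps)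
  qed
  show ?thesis
  proof (induction m)
    case 0
    then show ?case using counit_torus[of "replicate n h"] assms by simp
  next
    case (Suc m)
    then show ?case using pair_torus_left[of "replicate n h" "[g]" "replicate m g"] assms 1
      by (simp add: power_add del: pair.simps)
  qed
qed

lemma pair_power_word:
  "pair (power_word (Om' i) (OmInv' i) m) (power_word (Om j) (OmInv j) n) = q j i powi (m * n)"
proof -
  have 1: "q j i powi (int a * int b) = q j i ^ (a * b)" for a b
    by (metis of_nat_mult power_int_of_nat)
  have *: "q j i powi (int a * int b) = q j i ^ (a * b)" "inverse (q j i) ^ (a * b)
      = q j i powi (- (int a * int b))" for a b
    by (simp_all add: power_int_minus power_inverse 1)
  show ?thesis
  proof (cases m rule: int_cases4; cases n rule: int_cases4)
  qed (simp_all add: power_word_def pair_replicate pair_gens * del: pair.simps)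
qed

lemma pair_omega_words:
  "pair (omega'_word xs \<mu>) (omega_word ys \<nu>) = (\<Prod>i\<leftarrow>xs. \<Prod>j\<leftarrow>ys. q j i powi (\<mu> i * \<nu> j))"
proof -
  have 1: "pair (power_word (Om' i) (OmInv' i) m) (omega_word ys \<nu>) = (\<Prod>j\<leftarrow>ys. q j i powi (m * \<nu> j))" for i m
  proof (induction ys)
    case Nil
    then show ?case by (simp add: omega_word_def pair_torus_Nil power_word_lists del: in_lists_conv_set)
  next
    case (Cons j ys)
    have "omega_word (j # ys) \<nu> = power_word (Om j) (OmInv j) (\<nu> j) @ omega_word ys \<nu>" by (simp add: omega_word_def)
    then show ?case using Cons
      by (simp add: pair_torus_right power_word_lists omega_word_gens pair_power_word del: in_lists_conv_set)
  qed
  show ?thesis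
  proof (induction xs)
    case Nil
    then show ?case by (simp add: omega'_word_def counit_torus omega_word_torus del: in_lists_conv_set)
  next
    case (Cons i xs)
    have "omega'_word (i # xs) \<mu> = power_word (Om' i) (OmInv' i) (\<mu> i) @ omega'_word xs \<mu>"
        by (simp add: omega'_word_def)
    then show ?case using Cons 1 by (simp add: pair_torus_left omega_word_torus del: in_lists_conv_set)
  qed
qed

end

section \<open>Existence and uniqueness of the pairing\<close>

lemma lin_mult_right: "lin (\<lambda>k. f k * c) p = lin f p * c"
  by (simp add: lin_def sum_distrib_right mult.assoc)

context quantum_parameters
begin

abbreviation nonneg where "nonneg \<equiv> span_words pos_gens"
abbreviation nonpos where "nonpos \<equiv> span_words neg_gens"

definition skew_hopf_pairing :: "(('i gen list \<Rightarrow>\<^sub>0 'k) set \<Rightarrow> ('i gen list \<Rightarrow>\<^sub>0 'k) set \<Rightarrow> 'k) \<Rightarrow> bool" where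
  "skew_hopf_pairing P \<longleftrightarrow>
    bilinear_on U nonpos nonneg P \<and>
    (\<forall>y\<in>nonpos. \<forall>x\<in>nonneg. \<forall>x'\<in>nonneg.
       P y (x \<otimes>\<^bsub>U\<^esub> x') = tensor_pairing nonpos nonneg P (comult A q y) (T x' x)) \<and>
    (\<forall>y\<in>nonpos. \<forall>y'\<in>nonpos. \<forall>x\<in>nonneg.
       P (y \<otimes>\<^bsub>U\<^esub> y') x = tensor_pairing nonpos nonneg P (T y y') (comult A q x)) \<and>
    (\<forall>i j. P (u (F i)) (u (E j)) = (if i = j then q i i / (1 - q i i) else 0)) \<and>
    (\<forall>\<mu> \<nu>. P (omega' A q \<mu>) (omega A q \<nu>) = q_lattice q \<nu> \<mu>) \<and>
    (\<forall>\<mu> i. P (omega' A q \<mu>) (u (E i)) = 0) \<and>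
    (\<forall>\<mu> i. P (u (F i)) (omega A q \<mu>) = 0)"

text \<open>Translates the multiplicativity clauses into sums over words: \<open>coproduct\<close>
  supplies a representative supported on the halves, to which \<open>tensor_pairing_eq\<close>
  applies.\<close>

lemma tensor_pairing_comult:
  assumes P: "bilinear_on U nonpos nonneg P"
  shows "Poly_Mapping.keys y \<subseteq> lists neg_gens \<Longrightarrow> X \<in> nonneg \<Longrightarrow> X' \<in> nonneg \<Longrightarrow>
      tensor_pairing nonpos nonneg P (comult A q (cl y)) (T X' X)
      = lin (\<lambda>w. csum (\<lambda>s t. P (cl (word 1 s)) X' * P (cl (word 1 t)) X) w) y"
    and "Poly_Mapping.keys x \<subseteq> lists pos_gens \<Longrightarrow> Y \<in> nonpos \<Longrightarrow> Y' \<in> nonpos \<Longrightarrow>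
      tensor_pairing nonpos nonneg P (T Y Y') (comult A q (cl x))
      = lin (\<lambda>w. csum (\<lambda>s t. P Y (cl (word 1 s)) * P Y' (cl (word 1 t))) w) x"
proof -
  note eq = U.tensor_pairing_eq[OF linear_image_cl subspace_span_words subspace_span_words P]
  show "tensor_pairing nonpos nonneg P (comult A q (cl y)) (T X' X)
      = lin (\<lambda>w. csum (\<lambda>s t. P (cl (word 1 s)) X' * P (cl (word 1 t)) X) w) y"
    if y: "Poly_Mapping.keys y \<subseteq> lists neg_gens" and X: "X \<in> nonneg" "X' \<in> nonneg"
    unfolding comult_eq pure_tensor_def
    by (subst eq) (use keys_coproduct_span[OF _ _ y] X in \<open>auto simp: lin_coproduct case_prod_unfold\<close>)
  show "tensor_pairing nonpos nonneg P (T Y Y') (comult A q (cl x))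
      = lin (\<lambda>w. csum (\<lambda>s t. P Y (cl (word 1 s)) * P Y' (cl (word 1 t))) w) x"
    if x: "Poly_Mapping.keys x \<subseteq> lists pos_gens" and Y: "Y \<in> nonpos" "Y' \<in> nonpos"
    unfolding comult_eq pure_tensor_def
    by (subst eq) (use keys_coproduct_span[OF _ _ x] Y in \<open>auto simp: lin_coproduct case_prod_unfold\<close>)
qed

lemma bilinear_expand:
  assumes P: "bilinear_on U nonpos nonneg P"
    and y: "Poly_Mapping.keys y \<subseteq> lists neg_gens" and x: "Poly_Mapping.keys x \<subseteq> lists pos_gens"
  shows "P (cl y) (cl x) = lin (\<lambda>w. lin (\<lambda>v. P (cl (word 1 w)) (cl (word 1 v))) x) y"
proof -
  have P_zero: "P \<zero>\<^bsub>U\<^esub> X = 0" "P Y \<zero>\<^bsub>U\<^esub> = 0" if "X \<in> nonneg" "Y \<in> nonpos" for X Y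
  proof -
    have "P (0 \<odot>\<^bsub>U\<^esub> Y) X = 0 * P Y X" "P Y (0 \<odot>\<^bsub>U\<^esub> X) = 0 * P Y X"
      using P that unfolding bilinear_on_def by blast+
    then show "P \<zero>\<^bsub>U\<^esub> X = 0" "P Y \<zero>\<^bsub>U\<^esub> = 0" using that span_words_carrier by (auto simp: subset_iff)
  qed
  have 1: "P Y (cl x) = lin (\<lambda>v. P Y (cl (word 1 v))) x" if Y: "Y \<in> nonpos" for Y
    using x
  proof (induction rule: keys_induct)
    case zero
    then show ?case using P_zero(2)[OF _ Y] cl_word_in_span[of "[]" pos_gens 1] by (simp add: cl_zero)
  next
    case (add k c p)
    have "P Y (cl (word c k) \<oplus>\<^bsub>U\<^esub> cl p) = P Y (cl (word c k)) + P Y (cl p)"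
      using P Y cl_word_in_span[OF add(1)] span_wordsI[OF add(2)] unfolding bilinear_on_def by blast
    moreover have "P Y (c \<odot>\<^bsub>U\<^esub> cl (word 1 k)) = c * P Y (cl (word 1 k))"
      using P Y cl_word_in_span[OF add(1)] unfolding bilinear_on_def by blast
    ultimately show ?case using add by (simp add: cl_add cl_word[where c=c])
  qed
  have X: "cl x \<in> nonneg" using x by (rule span_wordsI)
  have "P (cl y) (cl x) = lin (\<lambda>w. P (cl (word 1 w)) (cl x)) y"
    using y
  proof (induction rule: keys_induct)
    case zero
    then show ?case using P_zero(1)[OF X] cl_word_in_span[of "[]" neg_gens 1] by (auto simp: cl_zero)
  next
    case (add k c p)
    have "P (cl (word c k) \<oplus>\<^bsub>U\<^esub> cl p) (cl x) = P (cl (word c k)) (cl x) + P (cl p) (cl x)"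
      using P X cl_word_in_span[OF add(1)] span_wordsI[OF add(2)] unfolding bilinear_on_def by blast
    moreover have "P (c \<odot>\<^bsub>U\<^esub> cl (word 1 k)) (cl x) = c * P (cl (word 1 k)) (cl x)"
      using P X cl_word_in_span[OF add(1)] unfolding bilinear_on_def by blast
    ultimately show ?case using add by (simp add: cl_add cl_word[where c=c])
  qed
  also have "\<dots> = lin (\<lambda>w. lin (\<lambda>v. P (cl (word 1 w)) (cl (word 1 v))) x) y"
    by (intro lin_cong 1 cl_word_in_span) (use y in auto)
  finally show ?thesis .
qed

section \<open>Uniqueness by restriction to words\<close>

lemma hopf_pairing_of_skew_hopf_pairing:
  assumes "skew_hopf_pairing P"
  shows "hopf_pairing (\<lambda>y x. P (cl (word 1 y)) (cl (word 1 x)))"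
proof -
  have bil: "bilinear_on U nonpos nonneg P"
    and 1: "\<And>y x x'. y \<in> nonpos \<Longrightarrow> x \<in> nonneg \<Longrightarrow> x' \<in> nonneg \<Longrightarrow>
       P y (x \<otimes>\<^bsub>U\<^esub> x') = tensor_pairing nonpos nonneg P (comult A q y) (T x' x)"
    and 2: "\<And>y y' x. y \<in> nonpos \<Longrightarrow> y' \<in> nonpos \<Longrightarrow> x \<in> nonneg \<Longrightarrow>
       P (y \<otimes>\<^bsub>U\<^esub> y') x = tensor_pairing nonpos nonneg P (T y y') (comult A q x)"
    using assms unfolding skew_hopf_pairing_def by blast+
  show ?thesis
    unfolding hopf_pairing_def
  proof (intro conjI ballI)
    fix y y' x assume "y \<in> lists neg_gens" "y' \<in> lists neg_gens" "x \<in> lists pos_gens"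
    then show "P (cl (word 1 (y @ y'))) (cl (word 1 x))
        = csum (\<lambda>s t. P (cl (word 1 y)) (cl (word 1 s)) * P (cl (word 1 y')) (cl (word 1 t))) x"
      unfolding cl_word_append
      by (subst 2) (simp_all add: cl_word_in_span tensor_pairing_comult(2)[OF bil] del: in_lists_conv_set)
  next
    fix y x x' assume "y \<in> lists neg_gens" "x \<in> lists pos_gens" "x' \<in> lists pos_gens"
    then show "P (cl (word 1 y)) (cl (word 1 (x @ x')))
        = csum (\<lambda>s t. P (cl (word 1 s)) (cl (word 1 x')) * P (cl (word 1 t)) (cl (word 1 x))) y"
      unfolding cl_word_append
      by (subst 1) (simp_all add: cl_word_in_span tensor_pairing_comult(1)[OF bil] del: in_lists_conv_set)
  qed
qed

text \<open>A word of length at most 1 represents the unit, a torus generator or some e_i. With the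
  analogous split on the other side, the four prescribed families of values settle all pairs of
  short words.\<close>

lemma torus_gen_cases:
  assumes "x \<in> lists pos_gens" "length x \<le> 1"
  obtains \<nu> where "cl (word 1 x) = omega A q \<nu>" | i where "cl (word 1 x) = u (E i)"
proof (cases x)
  case Nil
  then show ?thesis using that(1) torus_gen_is_omega(1) by (simp add: cl_one)
next
  case (Cons h x')
  then have "h \<in> pos_gens" "cl (word 1 x) = u h" using assms by (simp_all add: u_eq)
  then show ?thesis
    by (elim pos_gens_cases) (use that torus_gen_is_omega(3,4) in metis)+
qed

lemma torus_gen_cases':
  assumes "y \<in> lists neg_gens" "length y \<le> 1"
  obtains \<mu> where "cl (word 1 y) = omega' A q \<mu>" | i where "cl (word 1 y) = u (F i)"
proof (cases y)
  case Nil
  then show ?thesis using that(1) torus_gen_is_omega(2) by (simp add: cl_one)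
next
  case (Cons h y')
  then have "h \<in> neg_gens" "cl (word 1 y) = u h" using assms by (simp_all add: u_eq)
  then show ?thesis
    by (elim neg_gens_cases) (use that torus_gen_is_omega(5,6) in metis)+
qed

lemma skew_hopf_pairing_unique:
  assumes P: "skew_hopf_pairing P" and P': "skew_hopf_pairing P'" and Y: "Y \<in> nonpos" and X: "X \<in> nonneg"
  shows "P Y X = P' Y X"
proof -
  obtain y x where y: "Y = cl y" "Poly_Mapping.keys y \<subseteq> lists neg_gens"
      and x: "X = cl x" "Poly_Mapping.keys x \<subseteq> lists pos_gens"
    using Y X unfolding span_words_def by blast
  have words: "P (cl (word 1 w)) (cl (word 1 v)) = P' (cl (word 1 w)) (cl (word 1 v))"
    if "w \<in> lists neg_gens" "v \<in> lists pos_gens" for w v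
    using hopf_pairing_of_skew_hopf_pairing[OF P] hopf_pairing_of_skew_hopf_pairing[OF P'] _ that
  proof (rule hopf_pairing_unique)
    fix w v assume "w \<in> lists neg_gens" "v \<in> lists pos_gens" "length w \<le> 1" "length v \<le> 1"
    then show "P (cl (word 1 w)) (cl (word 1 v)) = P' (cl (word 1 w)) (cl (word 1 v))"
      using P P' unfolding skew_hopf_pairing_def
      by (elim torus_gen_cases torus_gen_cases') simp_all
  qed
  have bil: "bilinear_on U nonpos nonneg P" "bilinear_on U nonpos nonneg P'"
    using P P' by (simp_all add: skew_hopf_pairing_def)
  show ?thesis
    unfolding y x bilinear_expand[OF bil(1) y(2) x(2)] bilinear_expand[OF bil(2) y(2) x(2)]
    by (intro lin_cong words) (use y x in auto)
qed

section \<open>Existence: descent of the pairing from words to classes\<close>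

definition pair_poly :: "('i gen list \<Rightarrow>\<^sub>0 'k) \<Rightarrow> ('i gen list \<Rightarrow>\<^sub>0 'k) \<Rightarrow> 'k" where
  "pair_poly y x = lin (\<lambda>w. lin (pair w) x) y"

definition pair_class :: "('i gen list \<Rightarrow>\<^sub>0 'k) set \<Rightarrow> ('i gen list \<Rightarrow>\<^sub>0 'k) set \<Rightarrow> 'k" where
  "pair_class Y X = pair_poly (SOME y. Poly_Mapping.keys y \<subseteq> lists neg_gens \<and> cl y = Y)
     (SOME x. Poly_Mapping.keys x \<subseteq> lists pos_gens \<and> cl x = X)"

text \<open>Changing the representative of x is harmless because \<open>pair w\<close> kills the
  whole ideal, changing that of y by \<open>lin_pair_left_zero\<close>.\<close>

lemma pair_class_cl:
  assumes y: "Poly_Mapping.keys y \<subseteq> lists neg_gens" and x: "Poly_Mapping.keys x \<subseteq> lists pos_gens"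
  shows "pair_class (cl y) (cl x) = pair_poly y x"
proof -
  define y' where "y' = (SOME r. Poly_Mapping.keys r \<subseteq> lists neg_gens \<and> cl r = cl y)"
  define x' where "x' = (SOME r. Poly_Mapping.keys r \<subseteq> lists pos_gens \<and> cl r = cl x)"
  have y': "Poly_Mapping.keys y' \<subseteq> lists neg_gens" "cl y' = cl y"
    using someI[of "\<lambda>r. Poly_Mapping.keys r \<subseteq> lists neg_gens \<and> cl r = cl y" y] y unfolding y'_def by auto
  have x': "Poly_Mapping.keys x' \<subseteq> lists pos_gens" "cl x' = cl x"
    using someI[of "\<lambda>r. Poly_Mapping.keys r \<subseteq> lists pos_gens \<and> cl r = cl x" x] x unfolding x'_def by auto
  have "lin (pair w) x' = lin (pair w) x" if "w \<in> lists neg_gens" for w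
    using functional_cl[OF kills_ideal_pair[OF that], of x'] functional_cl[OF kills_ideal_pair[OF that], of x] x'(2)
        by simp
  then have "pair_poly y' x' = pair_poly y' x"
    unfolding pair_poly_def using y'(1) by (intro lin_cong) auto
  also have "\<dots> = pair_poly y x"
  proof -
    have "Poly_Mapping.keys (y' - y) \<subseteq> lists neg_gens"
      using y y'(1) Poly_Mapping.keys_diff[of y' y] by blast
    moreover have "y' - y \<in> Uq_ideal A q" using y'(2) by (simp add: cl_eq_iff)
    ultimately have "lin (\<lambda>w. pair w v) (y' - y) = 0" if "v \<in> lists pos_gens" for v
      using lin_pair_left_zero that by blast
    then have "lin (\<lambda>v. lin (\<lambda>w. pair w v) (y' - y)) x = lin (\<lambda>v. 0) x"
      using x by (intro lin_cong) auto
    then have "pair_poly (y' - y) x = 0" unfolding pair_poly_def by (subst lin_swap) (simp add: lin_def)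
    then show ?thesis by (simp add: pair_poly_def)
  qed
  finally show ?thesis by (simp add: pair_class_def y'_def x'_def)
qed

text \<open>Restricted in both variables, because uniqueness is asserted among functions that are
  extensional on the halves.\<close>

definition the_pairing :: "('i gen list \<Rightarrow>\<^sub>0 'k) set \<Rightarrow> ('i gen list \<Rightarrow>\<^sub>0 'k) set \<Rightarrow> 'k" where
  "the_pairing = (\<lambda>Y\<in>nonpos. \<lambda>X\<in>nonneg. pair_class Y X)"

lemma the_pairing_cl:
  "Poly_Mapping.keys y \<subseteq> lists neg_gens \<Longrightarrow> Poly_Mapping.keys x \<subseteq> lists pos_gens \<Longrightarrow>
    the_pairing (cl y) (cl x) = pair_poly y x"
  by (simp add: the_pairing_def span_wordsI pair_class_cl)

lemma the_pairing_word:
  "w \<in> lists neg_gens \<Longrightarrow> v \<in> lists pos_gens \<Longrightarrow> the_pairing (cl (word 1 w)) (cl (word 1 v)) = pair w v"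
  by (subst the_pairing_cl) (simp_all add: pair_poly_def del: in_lists_conv_set)

lemma the_pairing_word_left:
  "w \<in> lists neg_gens \<Longrightarrow> Poly_Mapping.keys x \<subseteq> lists pos_gens \<Longrightarrow> the_pairing (cl (word 1 w)) (cl x) = lin (pair w) x"
  by (subst the_pairing_cl) (simp_all add: pair_poly_def del: in_lists_conv_set)

lemma the_pairing_word_right:
  "Poly_Mapping.keys y \<subseteq> lists neg_gens \<Longrightarrow> v \<in> lists pos_gens \<Longrightarrow> the_pairing (cl y) (cl (word 1 v))
      = lin (\<lambda>w. pair w v) y"
  by (subst the_pairing_cl) (simp_all add: pair_poly_def del: in_lists_conv_set)

lemma span_wordsE:
  assumes "X \<in> span_words S"
  obtains p where "X = cl p" "Poly_Mapping.keys p \<subseteq> lists S"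
  using assms unfolding span_words_def by blast

lemma bilinear_the_pairing: "bilinear_on U nonpos nonneg the_pairing"
  unfolding bilinear_on_def
proof (intro conjI ballI allI)
  note sub = keys_add_subset order_trans[OF keys_scale]
  show "the_pairing (Y \<oplus>\<^bsub>U\<^esub> Y') X = the_pairing Y X + the_pairing Y' X"
    if "Y \<in> nonpos" "Y' \<in> nonpos" "X \<in> nonneg" for Y Y' X
    using that by (elim span_wordsE) (simp add: cl_add[symmetric] the_pairing_cl sub, simp add: pair_poly_def)
  show "the_pairing Y (X \<oplus>\<^bsub>U\<^esub> X') = the_pairing Y X + the_pairing Y X'"
    if "Y \<in> nonpos" "X \<in> nonneg" "X' \<in> nonneg" for Y X X'
    using that by (elim span_wordsE) (simp add: cl_add[symmetric] the_pairing_cl sub, simp add: pair_poly_def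
        lin_add_fun)
  show "the_pairing (c \<odot>\<^bsub>U\<^esub> Y) X = c * the_pairing Y X" "the_pairing Y (c \<odot>\<^bsub>U\<^esub> X) = c * the_pairing Y X"
    if "Y \<in> nonpos" "X \<in> nonneg" for c Y X
    using that by (elim span_wordsE, simp add: cl_scale[symmetric] the_pairing_cl sub, simp add: pair_poly_def
        lin_mult_fun)+
qed

lemma the_pairing_mult_right:
  assumes Y: "Y \<in> nonpos" and X: "X \<in> nonneg" and X': "X' \<in> nonneg"
  shows "the_pairing Y (X \<otimes>\<^bsub>U\<^esub> X') = tensor_pairing nonpos nonneg the_pairing (comult A q Y) (T X' X)"
proof -
  from Y obtain y where y: "Y = cl y" "Poly_Mapping.keys y \<subseteq> lists neg_gens" by (rule span_wordsE)
  from X obtain x where x: "X = cl x" "Poly_Mapping.keys x \<subseteq> lists pos_gens" by (rule span_wordsE)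
  from X' obtain x' where x': "X' = cl x'" "Poly_Mapping.keys x' \<subseteq> lists pos_gens" by (rule span_wordsE)
  have "the_pairing Y (X \<otimes>\<^bsub>U\<^esub> X') = lin (\<lambda>w. lin (\<lambda>v. lin (\<lambda>v'. pair w (v @ v')) x') x) y"
    using the_pairing_cl[OF y(2) keys_free_mult[OF x(2) x'(2)]]
    by (simp add: y x x' cl_mult pair_poly_def lin_free_mult)
  also have "\<dots> = lin (\<lambda>w. csum (\<lambda>s t. lin (pair s) x' * lin (pair t) x) w) y"
  proof (rule lin_cong)
    fix w assume "w \<in> Poly_Mapping.keys y"
    then have w: "w \<in> lists neg_gens" using y by auto
    have "lin (\<lambda>v. lin (\<lambda>v'. pair w (v @ v')) x') x = lin (\<lambda>v. lin (\<lambda>v'. csum (\<lambda>s t. pair s v' * pair t v) w) x') x"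
      by (intro lin_cong pair_append_right w) (use x x' in auto)
    also have "\<dots> = csum (\<lambda>s t. lin (pair s) x' * lin (pair t) x) w"
      by (simp only: lin_csum lin_mult_right lin_mult_fun)
    finally show "lin (\<lambda>v. lin (\<lambda>v'. pair w (v @ v')) x') x = csum (\<lambda>s t. lin (pair s) x' * lin (pair t) x) w" .
  qed
  also have "\<dots> = lin (\<lambda>w. csum (\<lambda>s t. the_pairing (cl (word 1 s)) X' * the_pairing (cl (word 1 t)) X) w) y"
    by (intro lin_cong csum_cong_neg) (use y x x' in \<open>auto simp: the_pairing_word_left simp del: in_lists_conv_set\<close>)
  also have "\<dots> = tensor_pairing nonpos nonneg the_pairing (comult A q Y) (T X' X)"
    using tensor_pairing_comult(1)[OF bilinear_the_pairing y(2) X X'] by (simp add: y)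
  finally show ?thesis .
qed

lemma the_pairing_mult_left:
  assumes Y: "Y \<in> nonpos" and Y': "Y' \<in> nonpos" and X: "X \<in> nonneg"
  shows "the_pairing (Y \<otimes>\<^bsub>U\<^esub> Y') X = tensor_pairing nonpos nonneg the_pairing (T Y Y') (comult A q X)"
proof -
  from Y obtain y where y: "Y = cl y" "Poly_Mapping.keys y \<subseteq> lists neg_gens" by (rule span_wordsE)
  from Y' obtain y' where y': "Y' = cl y'" "Poly_Mapping.keys y' \<subseteq> lists neg_gens" by (rule span_wordsE)
  from X obtain x where x: "X = cl x" "Poly_Mapping.keys x \<subseteq> lists pos_gens" by (rule span_wordsE)
  have "the_pairing (Y \<otimes>\<^bsub>U\<^esub> Y') X = lin (\<lambda>w. lin (\<lambda>w'. lin (pair (w @ w')) x) y') y"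
    using the_pairing_cl[OF keys_free_mult[OF y(2) y'(2)] x(2)]
    by (simp add: y y' x cl_mult pair_poly_def lin_free_mult)
  also have "\<dots> = lin (\<lambda>v. lin (\<lambda>w. lin (\<lambda>w'. pair (w @ w') v) y') y) x"
    by (simp only: lin_swap[of _ x])
  also have "\<dots> = lin (\<lambda>v. csum (\<lambda>s t. lin (\<lambda>w. pair w s) y * lin (\<lambda>w. pair w t) y') v) x"
  proof (rule lin_cong)
    fix v
    show "lin (\<lambda>w. lin (\<lambda>w'. pair (w @ w') v) y') y = csum (\<lambda>s t. lin (\<lambda>w. pair w s) y * lin (\<lambda>w. pair w t) y') v"
      by (simp only: pair_append lin_csum lin_mult_fun lin_mult_right)
  qed
  also have "\<dots> = lin (\<lambda>v. csum (\<lambda>s t. the_pairing Y (cl (word 1 s)) * the_pairing Y' (cl (word 1 t))) v) x"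
    by (intro lin_cong csum_cong_pos) (use y y' x in \<open>auto simp: the_pairing_word_right simp del: in_lists_conv_set\<close>)
  also have "\<dots> = tensor_pairing nonpos nonneg the_pairing (T Y Y') (comult A q X)"
    using tensor_pairing_comult(2)[OF bilinear_the_pairing x(2) Y Y'] by (simp add: x)
  finally show ?thesis .
qed

lemma skew_hopf_pairing_the_pairing: "skew_hopf_pairing the_pairing"
  unfolding skew_hopf_pairing_def
proof (intro conjI ballI allI)
  show "bilinear_on U nonpos nonneg the_pairing" by (rule bilinear_the_pairing)
  obtain xs :: "'i list" where xs: "set xs = UNIV" "distinct xs"
      using finite_distinct_list[OF finite_class.finite_UNIV] by blast
  note omega = omega_eq[OF xs(2,1)]
  show "the_pairing (u (F i)) (u (E j)) = (if i = j then q i i / (1 - q i i) else 0)" for i j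
    unfolding u_eq by (simp add: the_pairing_word pair_gens fe_value_def del: pair.simps)
  show "the_pairing (omega' A q \<mu>) (omega A q \<nu>) = q_lattice q \<nu> \<mu>" for \<mu> \<nu>
  proof -
    have "(\<Prod>i\<leftarrow>xs. f i) = (\<Prod>i\<in>UNIV. f i)" for f :: "'i \<Rightarrow> 'k"
      using prod.distinct_set_conv_list[OF xs(2), of f] xs(1) by simp
    then have "the_pairing (omega' A q \<mu>) (omega A q \<nu>) = (\<Prod>i\<in>UNIV. \<Prod>j\<in>UNIV. q j i powi (\<mu> i * \<nu> j))"
      unfolding omega by (simp add: the_pairing_word omega_word_gens pair_omega_words del: in_lists_conv_set)
    also have "\<dots> = q_lattice q \<nu> \<mu>"
      unfolding q_lattice_def by (subst prod.swap) (simp add: mult.commute)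
    finally show ?thesis .
  qed
  show "the_pairing (omega' A q \<mu>) (u (E i)) = 0" for \<mu> i
  proof -
    have "pair w [E i] = 0" if "w \<in> lists torus_gens" "w \<in> lists neg_gens" for w
      using that
    proof (induction w)
      case (Cons g w)
      then have "g \<in> neg_gens" "g \<in> torus_gens" by simp_all
      then show ?case using Cons by (elim neg_gens_cases) (simp_all add: mult_op_def vacuum_def)
    qed simp
    then show ?thesis unfolding omega u_eq by (simp add: the_pairing_word omega_word_gens omega_word_torus
        del: in_lists_conv_set)
  qed
  show "the_pairing (u (F i)) (omega A q \<mu>) = 0" for \<mu> i
  proof -
    \<comment> \<open>Torus generators act diagonally, so the value at [i] stays 0 once it is 0, as
      it is for the vacuum.\<close>
    have "act_word (\<lambda>j. q j i) w \<phi> [i] = 0" if "w \<in> lists torus_gens" "\<phi> [i] = 0" for w \<phi>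
      using that
    proof (induction w arbitrary: \<phi>)
      case (Cons g w)
      then have "g \<in> torus_gens" by simp
      then have "act (\<lambda>j. q j i) g \<phi> [i] = 0" using Cons.prems by (cases g) (simp_all add: mult_op_def)
      then show ?case using Cons by simp
    qed simp
    then show ?thesis unfolding omega u_eq
      by (simp add: the_pairing_word omega_word_gens omega_word_torus pair_single del: in_lists_conv_set pair.simps)
  qed
qed (simp_all only: the_pairing_mult_right the_pairing_mult_left)

end

theorem theorem20:
  fixes A :: "'i::finite \<Rightarrow> 'i \<Rightarrow> int"
    and q :: "'i \<Rightarrow> 'i \<Rightarrow> 'k::field_char_0"
  assumes "symmetrizable_gcm A"
    and "generic_parameters A q"
    and "\<And>i m. m > 0 \<Longrightarrow> \<exists>r. r ^ m = q i i"
    and "\<And>i m. m > 0 \<Longrightarrow> q i i ^ m \<noteq> 1"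
  shows "\<exists>!P. P \<in> Uq_nonpos A q \<rightarrow>\<^sub>E (Uq_nonneg A q \<rightarrow>\<^sub>E (UNIV :: 'k set)) \<and>
    bilinear_on (Uq A q) (Uq_nonpos A q) (Uq_nonneg A q) P \<and>
    (\<forall>y\<in>Uq_nonpos A q. \<forall>x\<in>Uq_nonneg A q. \<forall>x'\<in>Uq_nonneg A q.
       P y (x \<otimes>\<^bsub>Uq A q\<^esub> x') =
         tensor_pairing (Uq_nonpos A q) (Uq_nonneg A q) P (comult A q y) (utensor A q x' x)) \<and>
    (\<forall>y\<in>Uq_nonpos A q. \<forall>y'\<in>Uq_nonpos A q. \<forall>x\<in>Uq_nonneg A q.
       P (y \<otimes>\<^bsub>Uq A q\<^esub> y') x =
         tensor_pairing (Uq_nonpos A q) (Uq_nonneg A q) P (utensor A q y y') (comult A q x)) \<and>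
    (\<forall>i j. P (ugen A q (F i)) (ugen A q (E j)) = (if i = j then q i i / (1 - q i i) else 0)) \<and>
    (\<forall>\<mu> \<nu>. P (omega' A q \<mu>) (omega A q \<nu>) = q_lattice q \<nu> \<mu>) \<and>
    (\<forall>\<mu> i. P (omega' A q \<mu>) (ugen A q (E i)) = 0) \<and>
    (\<forall>\<mu> i. P (ugen A q (F i)) (omega A q \<mu>) = 0)"
proof -
  interpret quantum_parameters A q
    using assms by unfold_locales (auto simp: symmetrizable_gcm_def generic_parameters_def)
  show ?thesis
    unfolding Uq_nonneg_eq Uq_nonpos_eq skew_hopf_pairing_def[symmetric]
  proof (rule ex1I[of _ the_pairing])
    show "the_pairing \<in> nonpos \<rightarrow>\<^sub>E nonneg \<rightarrow>\<^sub>E UNIV \<and> skew_hopf_pairing the_pairing"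
      using skew_hopf_pairing_the_pairing by (auto simp: the_pairing_def)
  next
    fix P assume P: "P \<in> nonpos \<rightarrow>\<^sub>E nonneg \<rightarrow>\<^sub>E UNIV \<and> skew_hopf_pairing P"
    show "P = the_pairing"
    \<comment> \<open>Both functions are extensional in each variable, so agreement on the halves is
      equality.\<close>
    proof (rule PiE_ext)
      show "P \<in> nonpos \<rightarrow>\<^sub>E nonneg \<rightarrow>\<^sub>E UNIV" using P by blast
      show "the_pairing \<in> nonpos \<rightarrow>\<^sub>E nonneg \<rightarrow>\<^sub>E UNIV" by (auto simp: the_pairing_def)
      show "P Y = the_pairing Y" if Y: "Y \<in> nonpos" for Y
      proof (rule PiE_ext)
        show "P Y \<in> nonneg \<rightarrow>\<^sub>E UNIV" using P Y by blast
        show "the_pairing Y \<in> nonneg \<rightarrow>\<^sub>E UNIV" using Y by (auto simp: the_pairing_def)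
        show "P Y X = the_pairing Y X" if "X \<in> nonneg" for X
          using skew_hopf_pairing_unique P skew_hopf_pairing_the_pairing Y that by blast
      qed
    qed
  qed
qed

end
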